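(* Assume H1, H2 and H3 hold, where the constant $\upsilon$ of H2 satisfies $b\ell\upsilon<1$. Assume that the deterministic positive sequence $(\lambda_n)$ and the (possibly random) nonnegative sequence $(\rho_n)$ satisfy $$\frac{\lambda_n}{n}\xrightarrow[n\to\infty]{}0,\qquad \frac{\lambda_n}{\sqrt n}\xrightarrow[n\to\infty]{}+\infty,\qquad \rho_n=O_{\mathbb P}\Big(\frac{\lambda_n}{n}\Big).$$ Then, for any $\rho_n$-MPLE $(\widehat f_n,\widehat\nu_n)$ and $\widehat p_n=p_{\widehat f_n,\widehat\nu_n}$, $$h^2(\widehat p_n,p_\star)=O_{\mathbb P}\Big(\frac{\lambda_n}{n}\Big)\qquad\text{and}\qquad I(\widehat f_n)=O_{\mathbb P}(1).$$
   Context: Setting. Let $(\mathbb X,\mathcal X)$ be a measurable space equipped with a measure $\mu$ and let $(X_k)_{k\in\mathbb Z}$ be a stationary process with values in $\mathbb X$ defined on a probability space $(\Omega,\mathcal E,\mathbb P)$. Let $\ell\ge1$ and let $f_\star:\mathbb X\to\mathbb R^\ell$ be measurable. The observations are $Y_k=f_\star(X_k)+\epsilon_k$, $k\ge0$, where $(\epsilon_k)_{k\ge0}$ are i.i.d. standard Gaussian vectors of $\mathbb R^\ell$, independent of $(X_k)$, with density $\varphi(y)=(2\pi)^{-\ell/2}\exp(-\tfrac12\|y\|^2)$. Fix an integer $b\ge1$ and write $\mathbf X_k=(X_{kb},\dots,X_{(k+1)b-1})$, $\mathbf Y_k=(Y_{kb},\dots,Y_{(k+1)b-1})$. For $f:\mathbb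 X\to\mathbb R^\ell$ and a probability density $\nu$ on $\mathbb X^b$ with respect to $\mu^{\otimes b}$, define for $\mathbf y=(y_0,\dots,y_{b-1})\in(\mathbb R^\ell)^b$ $$p_{f,\nu}(\mathbf y)=\int_{\mathbb X^b}\nu(\mathbf x)\prod_{k=0}^{b-1}\varphi(y_k-f(x_k))\,\mu^{\otimes b}(\mathrm d\mathbf x).$$ $\mathcal F$ is a class of measurable functions $\mathbb X\to\mathbb R^\ell$ containing $f_\star$; $\mathcal D_b$ is a set of probability densities on $\mathbb X^b$ (w.r.t. $\mu^{\otimes b}$) containing the density $\nu_{b,\star}$ of $\mathbf X_0$. Put $p_\star=p_{f_\star,\nu_{b,\star}}$ (the density of $\mathbf Y_0$) and let $\mathbb P_\star$ be the law of $\mathbf Y_0$. $I:\mathcal F\to\mathbb R_+$ is a complexity function. Given $\lambda_n>0$ and $\rho_n\ge0$, a $\rho_n$-MPLE is any pair $(\widehat f_n,\widehat\nu_n)\in\mathcal F\times\mathcal D_b$ with $$\sum_{k=0}^{n-1}\ln p_{\widehat f_n,\widehat\nu_n}(\mathbf Y_k)-\lambda_nI(\widehat f_n)\ge\sup_{f\in\mathcal F,\nu\in\mathcal D_b}\Big\{\sum_{k=0}^{n-1}\ln p_{f,\nu}(\mathbf Y_k)-\lambda_nI(f)\Big\}-\rho_n .$$ Hellinger distance between densities $p_1,p_2$ on $\mathbb R^{b\ell}$: $h(p_1,p_2)=\big[\tfrac12\int(\sqrt{p_1}-\sqrt{p_2})^2\,\mathrm dy\big]^{1/2}$. $\Phi$-mixing: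 for $\sigma$-fields $\mathcal U,\mathcal V\subset\mathcal E$, $\Phi(\mathcal U,\mathcal V)=\sup\{|\mathbb P(U\cap V)/\mathbb P(U)-\mathbb P(V)|:U\in\mathcal U,V\in\mathcal V,\mathbb P(U)>0\}$, and $\Phi^X_i=\Phi(\sigma(X_k;k\le0),\sigma(X_k;k\ge i))$. H1: $\mathbf\Phi:=\sum_{i\ge1}(\Phi^X_i)^{1/2}<\infty$. H2: there exist $C>0,\upsilon>0$ such that $\|f\|_\infty\le C\,I(f)^\upsilon$ for all $f\in\mathcal F$, where $\|f\|_\infty=\max_{1\le j\le\ell}\sup_{x\in\mathbb X}|f^j(x)|$. H3: there exist $0<\nu_-<\nu_+<\infty$ such that $\nu_-\le\nu\le\nu_+$ for every $\nu\in\mathcal D_b$. Notation: $Z_n=O_{\mathbb P}(\alpha_n)$ means $\lim_{T\to\infty}\limsup_n\mathbb P(|Z_n|>T\alpha_n)=0$; $Z_n=o_{\mathbb P}(\alpha_n)$ means $\mathbb P(|Z_n|>T\alpha_n)\to0$ for all $T>0$. *)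

theory Defs
  imports "HOL-Probability.Probability"
begin

definition gauss_dens :: "real^'l \<Rightarrow> real" where
  "gauss_dens y = (2 * pi) powr (- real CARD('l) / 2) * exp (- (norm y)\<^sup>2 / 2)"

definition p_dens :: "'x measure \<Rightarrow> nat \<Rightarrow> ('x \<Rightarrow> real^'l) \<Rightarrow> ((nat \<Rightarrow> 'x) \<Rightarrow> real)
    \<Rightarrow> (nat \<Rightarrow> real^'l) \<Rightarrow> real" where
  "p_dens mu b f nu y =
     (LINT x | PiM {..<b} (\<lambda>_. mu). nu x * (\<Prod>k<b. gauss_dens (y k - f (x k))))"

definition hellinger :: "nat \<Rightarrow> ((nat \<Rightarrow> real^'l) \<Rightarrow> real) \<Rightarrow> ((nat \<Rightarrow> real^'l) \<Rightarrow> real) \<Rightarrow> real" where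
  "hellinger b p1 p2 =
     sqrt (1/2 * (LINT y | PiM {..<b} (\<lambda>_. (lborel :: (real^'l) measure)).
                     (sqrt (p1 y) - sqrt (p2 y))\<^sup>2))"

definition prob_density :: "'x measure \<Rightarrow> nat \<Rightarrow> ((nat \<Rightarrow> 'x) \<Rightarrow> real) \<Rightarrow> bool" where
  "prob_density mu b nu \<longleftrightarrow>
     nu \<in> borel_measurable (PiM {..<b} (\<lambda>_. mu)) \<and>
     (\<forall>x\<in>space (PiM {..<b} (\<lambda>_. mu)). 0 \<le> nu x) \<and>
     (\<integral>\<^sup>+ x. ennreal (nu x) \<partial>(PiM {..<b} (\<lambda>_. mu))) = 1"

definition phi_coef :: "'w measure \<Rightarrow> 'w set set \<Rightarrow> 'w set set \<Rightarrow> real" where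
  "phi_coef M U V = Sup {\<bar>measure M (A \<inter> B) / measure M A - measure M B\<bar> | A B.
                          A \<in> U \<and> B \<in> V \<and> measure M A > 0}"

definition gen_sigma :: "'w measure \<Rightarrow> 'x measure \<Rightarrow> (int \<Rightarrow> 'w \<Rightarrow> 'x) \<Rightarrow> int set \<Rightarrow> 'w set set" where
  "gen_sigma M mu X K = sigma_sets (space M) (\<Union>k\<in>K. {X k -` A \<inter> space M | A. A \<in> sets mu})"

definition phiX :: "'w measure \<Rightarrow> 'x measure \<Rightarrow> (int \<Rightarrow> 'w \<Rightarrow> 'x) \<Rightarrow> int \<Rightarrow> real" where
  "phiX M mu X i = phi_coef M (gen_sigma M mu X {..0}) (gen_sigma M mu X {i..})"

definition bigOP :: "'w measure \<Rightarrow> (nat \<Rightarrow> 'w \<Rightarrow> real) \<Rightarrow> (nat \<Rightarrow> real) \<Rightarrow> bool" where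
  "bigOP M Z \<alpha> \<longleftrightarrow>
     ((\<lambda>T::real. limsup (\<lambda>n. ereal (measure M {\<omega> \<in> space M. \<bar>Z n \<omega>\<bar> > T * \<alpha> n})))
        \<longlongrightarrow> 0) at_top"

end

theory Submission
  imports Defs
begin

text \<open>
  The law of a block is a Gaussian mixture, so up to a Gaussian factor \<open>p f \<nu> (y)\<close> equals
  \<open>Q(y) = \<integral> exp \<langle>y, f(x)\<rangle> dm(x)\<close> for a finite measure \<open>m\<close>. With \<open>Qs\<close> belonging to the true density,
  \<open>ln ((p + ps) / (2 ps)) = ln (Q + Qs) - ln Qs - ln 2\<close>, and every mixed partial derivative of this
  function that uses each of the \<open>d = b l\<close> coordinates at most once is bounded by a multiple of \<open>R ^ d\<close>,
  \<open>R\<close> being the sup norm of \<open>f\<close> and of the true regression function. By H2 and \<open>b l \<upsilon> < 1\<close>, \<open>R ^ d\<close> is at most a multiple of \<open>1 + I f\<close>.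

  A function with such derivatives is an integral of indicators of orthants against its mixed derivatives.
  Hence the centred empirical process at \<open>ln ((p + ps) / (2 ps))\<close> is at most a multiple of \<open>(1 + I f) W\<close>, where
  \<open>W\<close> integrates the absolute centred empirical measures of orthants and depends neither on \<open>f\<close> nor on \<open>\<nu>\<close>.
  For a single event the covariances are controlled by the definition of the \<open>\<Phi>\<close>-coefficients,
  so \<open>W\<close> has mean of order \<open>sqrt n = o(lam n)\<close>; no chaining, peeling or bracketing is needed.
  Together with \<open>ln p - ln ps \<le> 2 ln ((p + ps) / (2 ps))\<close> and the fact that the right-hand side has mean at most \<open>- h\<^sup>2 / 4\<close>,
  the maximality of the estimator yields both rates.
\<close>

section \<open>Functions with bounded mixed partial derivatives\<close>

text \<open>Differentiating \<open>Q\<close> in an observation coordinate brings down the matching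
  coordinate of \<open>f(x)\<close>. A mixed derivative divided by \<open>Q\<close> is therefore a
  moment of \<open>f\<close> under an exponentially tilted probability measure, at most
  \<open>R\<close> to the power of its order, although the logarithm itself may be unbounded. Using
  each coordinate at most once limits the power of \<open>R\<close> to \<open>d\<close>, which the
  penalty, linear in \<open>I f\<close>, can absorb.

  The obstacle is that the corners of the orthants range over a space of infinite volume, so the
  deviation for one orthant must decay in its corner. The variance of the number of visits to an
  event must hence be bounded by \<open>n\<close> times the probability of the event, not merely by
  \<open>n\<close>. The \<Phi>-coefficient provides this because its definition divides by the
  probability of the past event: the covariance is at most that probability times the coefficient.
  Exponential moments of the noise make the probability of an orthant decay exponentially in its
  corner, and half of the rate survives the root taken between variance and mean absolute
  deviation.\<close>

text \<open>
  The flag \<open>bd\<close> says whether the undifferentiated function must be bounded as well: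
  a logarithm is not, but all its mixed derivatives are.
\<close>
fun mixed_bdd :: "real \<Rightarrow> bool \<Rightarrow> 'j list \<Rightarrow> (('j \<Rightarrow> real) \<Rightarrow> real) \<Rightarrow> real \<Rightarrow> bool" where
  "mixed_bdd R bd [] h B \<longleftrightarrow>
     h \<in> borel_measurable (PiM UNIV (\<lambda>_. borel)) \<and> (bd \<longrightarrow> (\<forall>z. \<bar>h z\<bar> \<le> B))"
| "mixed_bdd R bd (j # js) h B \<longleftrightarrow> mixed_bdd R bd js h B \<and>
     (\<exists>h'. (\<forall>z t. ((\<lambda>s. h (z(j := s))) has_real_derivative h' (z(j := t))) (at t)) \<and>
           mixed_bdd R True js h' (R * B))"

lemma mixed_bdd_mono:
  "mixed_bdd R bd js h B \<Longrightarrow> B \<le> B' \<Longrightarrow> 0 \<le> R \<Longrightarrow> mixed_bdd R bd js h B'"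
proof (induction js arbitrary: bd h B B')
  case Nil then show ?case by (auto intro: order_trans)
next
  case (Cons j js)
  then show ?case by (metis mixed_bdd.simps(2) mult_left_mono)
qed

lemma mixed_bdd_measurable:
  "mixed_bdd R bd js h B \<Longrightarrow> h \<in> borel_measurable (PiM UNIV (\<lambda>_. borel))"
  by (induction js arbitrary: bd h B) auto

lemma mixed_bdd_bound: "mixed_bdd R True js h B \<Longrightarrow> \<bar>h z\<bar> \<le> B"
  by (induction js arbitrary: h B) auto

lemma mixed_bdd_diff:
  "mixed_bdd R bd js h1 B1 \<Longrightarrow> mixed_bdd R bd js h2 B2 \<Longrightarrow>
   mixed_bdd R bd js (\<lambda>z. h1 z - h2 z) (B1 + B2)"
proof (induction js arbitrary: bd h1 h2 B1 B2)
  case Nil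
  then show ?case by (auto intro: order_trans[OF abs_triangle_ineq4] add_mono)
next
  case (Cons j js)
  from Cons.prems obtain h1' h2' where
    d: "\<And>z t. ((\<lambda>s. h1 (z(j := s))) has_real_derivative h1' (z(j := t))) (at t)"
       "\<And>z t. ((\<lambda>s. h2 (z(j := s))) has_real_derivative h2' (z(j := t))) (at t)"
    and m: "mixed_bdd R True js h1' (R * B1)" "mixed_bdd R True js h2' (R * B2)"
    by auto
  have "mixed_bdd R True js (\<lambda>z. h1' z - h2' z) (R * (B1 + B2))"
    using Cons.IH[OF m] by (simp add: distrib_left)
  with Cons d show ?case
    by (auto intro!: exI[of _ "\<lambda>z. h1' z - h2' z"] DERIV_diff)
qed

lemma mixed_bdd_add:
  "mixed_bdd R bd js h1 B1 \<Longrightarrow> mixed_bdd R bd js h2 B2 \<Longrightarrow>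
   mixed_bdd R bd js (\<lambda>z. h1 z + h2 z) (B1 + B2)"
proof (induction js arbitrary: bd h1 h2 B1 B2)
  case Nil
  then show ?case by (auto intro: order_trans[OF abs_triangle_ineq] add_mono)
next
  case (Cons j js)
  from Cons.prems obtain h1' h2' where
    d: "\<And>z t. ((\<lambda>s. h1 (z(j := s))) has_real_derivative h1' (z(j := t))) (at t)"
       "\<And>z t. ((\<lambda>s. h2 (z(j := s))) has_real_derivative h2' (z(j := t))) (at t)"
    and m: "mixed_bdd R True js h1' (R * B1)" "mixed_bdd R True js h2' (R * B2)"
    by auto
  have "mixed_bdd R True js (\<lambda>z. h1' z + h2' z) (R * (B1 + B2))"
    using Cons.IH[OF m] by (simp add: distrib_left)
  with Cons d show ?case
    by (auto intro!: exI[of _ "\<lambda>z. h1' z + h2' z"] DERIV_add)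
qed

text \<open>By the Leibniz rule each differentiation splits a product into two products of the same
  kind and so doubles the bound; hence the power of 2. Both flags are \<open>True\<close> since
  bounding a product uses bounds of both factors.\<close>

lemma mixed_bdd_mult:
  assumes "0 \<le> R"
  shows "mixed_bdd R True js h1 B1 \<Longrightarrow> mixed_bdd R True js h2 B2 \<Longrightarrow>
   mixed_bdd R True js (\<lambda>z. h1 z * h2 z) (2 ^ length js * B1 * B2)"
proof (induction js arbitrary: h1 h2 B1 B2)
  case Nil
  have "\<bar>h1 z * h2 z\<bar> \<le> B1 * B2" for z
    using Nil abs_ge_zero[of "h1 z"] abs_ge_zero[of "h2 z"] unfolding abs_mult
    by (intro mult_mono) (auto intro: order_trans)
  with Nil show ?case by auto
next
  case (Cons j js)
  from Cons.prems obtain h1' h2' where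
    d: "\<And>z t. ((\<lambda>s. h1 (z(j := s))) has_real_derivative h1' (z(j := t))) (at t)"
       "\<And>z t. ((\<lambda>s. h2 (z(j := s))) has_real_derivative h2' (z(j := t))) (at t)"
    and m: "mixed_bdd R True js h1' (R * B1)" "mixed_bdd R True js h2' (R * B2)"
    and n: "mixed_bdd R True js h1 B1" "mixed_bdd R True js h2 B2"
    by auto
  have B: "0 \<le> B1" "0 \<le> B2"
    using n[THEN mixed_bdd_bound] by (meson abs_ge_zero order_trans)+
  have 1: "mixed_bdd R True js (\<lambda>z. h1' z * h2 z + h2' z * h1 z) (R * (2 ^ length (j # js) * B1 * B2))"
    by (rule mixed_bdd_mono[OF mixed_bdd_add[OF Cons.IH[OF m(1) n(2)] Cons.IH[OF m(2) n(1)]]])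
       (use assms in \<open>auto simp: algebra_simps\<close>)
  have 2: "mixed_bdd R True js (\<lambda>z. h1 z * h2 z) (2 ^ length (j # js) * B1 * B2)"
    by (rule mixed_bdd_mono[OF Cons.IH[OF n]]) (use assms B in \<open>auto intro!: mult_right_mono\<close>)
  show ?case
    unfolding mixed_bdd.simps
    using 2 1 d by (intro conjI exI[of _ "\<lambda>z. h1' z * h2 z + h2' z * h1 z"]) (auto intro!: DERIV_mult)
qed

text \<open>The recursion mirrors the quotient rule in \<open>mixed_bdd_ratio\<close>: a derivative
  is one normalised moment minus a product of two, which costs \<open>ratio_const n\<close> and,
  through \<open>mixed_bdd_mult\<close>, \<open>2 ^ n * (ratio_const n)\<^sup>2\<close>.\<close>

fun ratio_const :: "nat \<Rightarrow> real" where
  "ratio_const 0 = 1"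
| "ratio_const (Suc n) = ratio_const n + 2 ^ n * (ratio_const n)\<^sup>2"

lemma ratio_const_ge_1: "1 \<le> ratio_const n"
  by (induction n) (auto intro: add_increasing2)

text \<open>\<open>Q A\<close> stands for the mixed derivative of \<open>Q {}\<close> in the
  directions \<open>A\<close>. The axioms survive addition of two families, so that one lemma on
  logarithms serves both \<open>ln Qs\<close> and \<open>ln (Q + Qs)\<close>; the bound relative to
  \<open>Q {}\<close> is what keeps logarithmic derivatives bounded.\<close>

locale moment_family =
  fixes J :: "'j set" and R :: real and Q :: "'j set \<Rightarrow> ('j \<Rightarrow> real) \<Rightarrow> real"
  assumes R_nonneg: "0 \<le> R"
    and Q_deriv: "\<And>j A z t. j \<in> J \<Longrightarrow> A \<subseteq> J \<Longrightarrow> j \<notin> A \<Longrightarrow>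
      ((\<lambda>s. Q A (z(j := s))) has_real_derivative Q (insert j A) (z(j := t))) (at t)"
    and Q_bound: "\<And>A z. A \<subseteq> J \<Longrightarrow> \<bar>Q A z\<bar> \<le> R ^ card A * Q {} z"
    and Q_pos: "\<And>z. 0 < Q {} z"
    and Q_meas: "\<And>A. A \<subseteq> J \<Longrightarrow> Q A \<in> borel_measurable (PiM UNIV (\<lambda>_. borel))"
    and fin_J: "finite J"
begin

text \<open>With \<open>m A = Q A / Q {}\<close>, the derivative of \<open>m A\<close> in direction
  \<open>j\<close> is \<open>m (insert j A) - m A * m {j}\<close>. Normalised moments are thus
  closed under differentiation up to products. Disjointness of \<open>A\<close> and
  \<open>set js\<close> ensures that no direction is used twice.\<close>

lemma mixed_bdd_ratio:
  "distinct js \<Longrightarrow> set js \<subseteq> J \<Longrightarrow> A \<subseteq> J \<Longrightarrow> A \<inter> set js = {} \<Longrightarrow>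
   mixed_bdd R True js (\<lambda>z. Q A z / Q {} z) (ratio_const (length js) * R ^ card A)"
proof (induction js arbitrary: A)
  case Nil
  have [measurable]: "Q A \<in> borel_measurable (PiM UNIV (\<lambda>_. borel))"
     "Q {} \<in> borel_measurable (PiM UNIV (\<lambda>_. borel))"
    using Nil by (auto intro: Q_meas)
  show ?case
    using Q_bound[of A] Q_pos Nil by (auto simp: abs_div divide_le_eq abs_of_pos)
next
  case (Cons j js)
  let ?L = "length js" and ?m = "\<lambda>A z. Q A z / Q {} z"
  have j: "j \<in> J" "j \<notin> A" "finite A"
    using Cons.prems fin_J by (auto intro: finite_subset)
  have mA: "mixed_bdd R True js (?m A) (ratio_const ?L * R ^ card A)"
    and mj: "mixed_bdd R True js (?m {j}) (ratio_const ?L * R ^ card {j})"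
    and mAj: "mixed_bdd R True js (?m (insert j A)) (ratio_const ?L * R ^ card (insert j A))"
    by (rule Cons.IH; use Cons.prems in auto)+
  have "mixed_bdd R True js (\<lambda>z. ?m (insert j A) z - ?m A z * ?m {j} z)
         (R * (ratio_const (length (j # js)) * R ^ card A))"
    by (rule mixed_bdd_mono[OF mixed_bdd_diff[OF mAj mixed_bdd_mult[OF R_nonneg mA mj]]])
       (use R_nonneg j in \<open>auto simp: algebra_simps power2_eq_square\<close>)
  moreover have "((\<lambda>s. ?m A (z(j := s))) has_real_derivative
      (?m (insert j A) (z(j := t)) - ?m A (z(j := t)) * ?m {j} (z(j := t)))) (at t)" for z t
  proof -
    have "((\<lambda>s. ?m A (z(j := s))) has_real_derivative
       (Q (insert j A) (z(j := t)) * Q {} (z(j := t)) - Q A (z(j := t)) * Q {j} (z(j := t)))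
         / (Q {} (z(j := t)) * Q {} (z(j := t)))) (at t)"
      using Cons.prems j Q_pos[of "z(j := t)"] by (intro DERIV_divide Q_deriv) auto
    then show ?thesis
      using Q_pos[of "z(j := t)"] by (simp add: diff_divide_distrib)
  qed
  moreover have "mixed_bdd R True js (?m A) (ratio_const (length (j # js)) * R ^ card A)"
    by (rule mixed_bdd_mono[OF mA]) (use R_nonneg in \<open>auto intro!: mult_right_mono\<close>)
  ultimately show ?case
    unfolding mixed_bdd.simps
    by (intro conjI exI[of _ "\<lambda>z. ?m (insert j A) z - ?m A z * ?m {j} z"]) auto
qed

text \<open>One differentiation turns the logarithm into the normalised moment
  \<open>Q {j} / Q {}\<close>, to which \<open>mixed_bdd_ratio\<close> applies; this moment brings
  the one factor \<open>R\<close> that the first derivative is allowed.\<close>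

lemma mixed_bdd_ln:
  "distinct js \<Longrightarrow> set js \<subseteq> J \<Longrightarrow>
   mixed_bdd R False js (\<lambda>z. ln (Q {} z)) (ratio_const (length js))"
proof (induction js)
  case Nil
  show ?case
    using Q_meas[of "{}"] by simp
next
  case (Cons j js)
  have "mixed_bdd R True js (\<lambda>z. Q {j} z / Q {} z) (R * ratio_const (length (j # js)))"
    by (rule mixed_bdd_mono[OF mixed_bdd_ratio])
      (use Cons.prems R_nonneg in \<open>auto simp: distrib_left algebra_simps\<close>)
  moreover have "mixed_bdd R False js (\<lambda>z. ln (Q {} z)) (ratio_const (length (j # js)))"
    by (rule mixed_bdd_mono[OF Cons.IH]) (use Cons.prems R_nonneg in auto)
  moreover have "((\<lambda>s. ln (Q {} (z(j := s)))) has_real_derivative Q {j} (z(j := t)) / Q {} (z(j := t))) (at t)" for z t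
    using DERIV_chain2[OF DERIV_ln_divide[OF Q_pos[of "z(j := t)"]] Q_deriv[of j "{}" z t]] Cons.prems by simp
  ultimately show ?case
    unfolding mixed_bdd.simps by (intro conjI exI[of _ "\<lambda>z. Q {j} z / Q {} z"]) auto
qed

end

section \<open>Reconstruction of a function of one variable by signed interval indicators\<close>

definition sgn_ind :: "real \<Rightarrow> real \<Rightarrow> real" where
  "sgn_ind s y = (if 0 < s \<and> s \<le> y then 1 else if y < s \<and> s \<le> 0 then - 1 else 0)"

lemma sgn_ind_measurable [measurable (raw)]:
  assumes [measurable]: "f \<in> borel_measurable N" "g \<in> borel_measurable N"
  shows "(\<lambda>x. sgn_ind (f x) (g x)) \<in> borel_measurable N"
  unfolding sgn_ind_def by measurable

lemma abs_sgn_ind_le: "\<bar>sgn_ind s y\<bar> \<le> indicator {- \<bar>y\<bar>..\<bar>y\<bar>} s"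
  by (auto simp: sgn_ind_def indicator_def)

lemma integrable_sgn_ind: "integrable lborel (\<lambda>s. sgn_ind s y)"
  by (rule Bochner_Integration.integrable_bound[of _ "indicator {- \<bar>y\<bar>..\<bar>y\<bar>} :: real \<Rightarrow> real"])
     (use abs_sgn_ind_le in \<open>auto simp: abs_of_nonneg\<close>)

text \<open>\<open>sgn_ind\<close> orients the interval between \<open>0\<close> and
  \<open>y\<close>, so that one formula covers both signs of \<open>y\<close>. Its half-open
  intervals differ from the closed ones of the fundamental theorem of calculus by a single point, a
  null set.\<close>

lemma integral_sgn_ind:
  fixes h h' :: "real \<Rightarrow> real"
  assumes der: "\<And>t. (h has_real_derivative h' t) (at t)"
    and [measurable]: "h' \<in> borel_measurable borel" and bd: "\<And>t. \<bar>h' t\<bar> \<le> B"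
  shows "(LINT s|lborel. h' s * sgn_ind s y) = h y - h 0"
proof -
  have I: "(LINT s:{a..c}|lborel. h' s) = h c - h a" if "a \<le> c" for a c
  proof -
    have "integrable lborel (indicator {a..c} :: real \<Rightarrow> real)"
      by (simp add: emeasure_lborel_Icc_eq)
    then have "integrable lborel (\<lambda>s. B * indicator {a..c} s)"
      by (rule integrable_mult_right)
    then have si: "set_integrable lborel {a..c} h'"
      unfolding set_integrable_def
      by (rule Bochner_Integration.integrable_bound)
         (use bd abs_ge_self[of B] in \<open>auto simp: indicator_def intro: order_trans\<close>)
    have 1: "(h' has_integral (LINT s:{a..c}|lborel. h' s)) {a..c}"
      using set_borel_integral_eq_integral[OF si] by (auto simp: has_integral_iff)
    have "(h' has_integral (h c - h a)) {a..c}"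
      using der that by (intro fundamental_theorem_of_calculus)
         (auto simp: has_real_derivative_iff_has_vector_derivative[symmetric] intro: has_field_derivative_at_within)
    with 1 show ?thesis by (rule has_integral_unique)
  qed
  show ?thesis
  proof (cases "0 \<le> y")
    case True
    have "(LINT s|lborel. h' s * sgn_ind s y) = (LINT s:{0..y}|lborel. h' s)"
      unfolding set_lebesgue_integral_def
      using AE_lborel_singleton[of 0] True by (intro integral_cong_AE) (auto elim!: eventually_mono simp: sgn_ind_def indicator_def)
    with I[OF True] show ?thesis by simp
  next
    case False
    have "(LINT s|lborel. h' s * sgn_ind s y) = (LINT s|lborel. - (indicator {y..0} s *\<^sub>R h' s))"
      using AE_lborel_singleton[of y] False by (intro integral_cong_AE) (auto elim!: eventually_mono simp: sgn_ind_def indicator_def)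
    also have "\<dots> = - (LINT s:{y..0}|lborel. h' s)"
      unfolding set_lebesgue_integral_def by simp
    finally show ?thesis using I[of y 0] False by simp
  qed
qed

section \<open>Representation by orthant indicators\<close>

text \<open>Splits off coordinate \<open>i\<close> as the outer integral. The recursion over
  coordinates applies a one-dimensional formula in the new variable around an existing integral over
  \<open>I\<close>, and so delivers the integrals in this order.\<close>

lemma (in product_sigma_finite) product_integral_insert_rev:
  fixes f :: "_ \<Rightarrow> _::{banach, second_countable_topology}"
  assumes I: "finite I" "i \<notin> I"
    and f: "integrable (Pi\<^sub>M (insert i I) M) f"
  shows "integral\<^sup>L (Pi\<^sub>M (insert i I) M) f = (\<integral>y. (\<integral>x. f (x(i := y)) \<partial>Pi\<^sub>M I M) \<partial>M i)"
proof -
  note [measurable] = borel_measurable_integrable[OF f]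
  interpret I: finite_product_sigma_finite M I by standard fact
  have f': "integrable (Pi\<^sub>M ({i} \<union> I) M) f"
    using f by simp
  have "integral\<^sup>L (Pi\<^sub>M (insert i I) M) f = (\<integral>x. (\<integral>y. f (merge {i} I (x, y)) \<partial>Pi\<^sub>M I M) \<partial>Pi\<^sub>M {i} M)"
    using product_integral_fold[OF _ _ _ f'] I by simp
  also have "\<dots> = (\<integral>x. (\<integral>y. f (y(i := x i)) \<partial>Pi\<^sub>M I M) \<partial>Pi\<^sub>M {i} M)"
    using I(2)
    by (intro Bochner_Integration.integral_cong refl arg_cong[where f = f])
       (auto simp: merge_def space_PiM extensional_def PiE_def fun_eq_iff)
  also have "\<dots> = (\<integral>y. (\<integral>x. f (x(i := y)) \<partial>Pi\<^sub>M I M) \<partial>M i)"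
    by (rule product_integral_singleton) measurable
  finally show ?thesis .
qed

text \<open>Anchors the expansion at the origin: coordinates in \<open>S\<close> are integration
  variables, the others in \<open>K\<close> are frozen at \<open>0\<close>, and those outside
  \<open>K\<close>, not yet reached by the recursion, keep the value of \<open>z\<close>.\<close>

definition graft :: "'j set \<Rightarrow> 'j set \<Rightarrow> ('j \<Rightarrow> real) \<Rightarrow> ('j \<Rightarrow> real) \<Rightarrow> 'j \<Rightarrow> real" where
  "graft K S t z = (\<lambda>i. if i \<in> S then t i else if i \<in> K then 0 else z i)"

lemma measurable_graft [measurable]:
  "(\<lambda>t. graft K S t z) \<in> measurable (PiM S (\<lambda>_. lborel)) (PiM UNIV (\<lambda>_. borel))"
proof (rule measurable_PiM_single')
  fix i show "(\<lambda>t. graft K S t z i) \<in> borel_measurable (PiM S (\<lambda>_. lborel))"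
    by (cases "i \<in> S") (auto simp: graft_def)
qed (auto simp: space_PiM)

interpretation lborel_prod: product_sigma_finite "\<lambda>_::'j. lborel :: real measure"
  by standard

text \<open>For empty \<open>S\<close> the product space is a single point and integrability is
  automatic. This is the term in which the undifferentiated, possibly unbounded function occurs, so
  the bound is assumed for nonempty \<open>S\<close> only.\<close>

lemma integrable_graft_sgn_ind:
  assumes [measurable]: "G \<in> borel_measurable (PiM UNIV (\<lambda>_. borel))"
    and bd: "S \<noteq> {} \<Longrightarrow> (\<And>z. \<bar>G z\<bar> \<le> B)" and fin: "finite S"
  shows "integrable (PiM S (\<lambda>_. lborel)) (\<lambda>t. G (graft K S t z) * (\<Prod>i\<in>S. sgn_ind (t i) (z i)))"
proof (cases "S = {}")
  case True
  then show ?thesis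
    by (simp add: PiM_empty integrable_count_space)
next
  case False
  have B: "0 \<le> B" using bd[OF False] abs_ge_zero order_trans by blast
  have "integrable (PiM S (\<lambda>_. lborel)) (\<lambda>t. B * (\<Prod>i\<in>S. sgn_ind (t i) (z i)))"
    using fin by (intro integrable_mult_right lborel_prod.product_integrable_prod integrable_sgn_ind)
  then show ?thesis
    by (rule Bochner_Integration.integrable_bound)
       (use B bd[OF False] in \<open>auto simp: abs_mult intro!: mult_right_mono\<close>)
qed

text \<open>Iterating the formula "value at 0 plus integral of the derivative" over the coordinates
  gives one term for each set \<open>S\<close> of differentiated coordinates, \<open>D S\<close>
  being the mixed derivative in the directions \<open>S\<close>. It is a variant of the
  Hlawka-Zaremba expansion. When \<open>bd\<close> is false, only the term \<open>S = {}\<close>, a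
  value of \<open>h\<close> itself, comes without a bound.\<close>

lemma mixed_bdd_representation:
  assumes "mixed_bdd R bd js h B" "distinct js" "0 \<le> R"
  shows "\<exists>D. (\<forall>S. D S \<in> borel_measurable (PiM UNIV (\<lambda>_. borel))) \<and>
     (\<forall>S z. S \<subseteq> set js \<longrightarrow> bd \<or> S \<noteq> {} \<longrightarrow> \<bar>D S z\<bar> \<le> B * R ^ card S) \<and>
     (\<forall>z. h z = (\<Sum>S\<in>Pow (set js). LINT t|PiM S (\<lambda>_. lborel).
         D S (graft (set js) S t z) * (\<Prod>i\<in>S. sgn_ind (t i) (z i))))"
  using assms
proof (induction js arbitrary: bd h B)
  case Nil
  have "graft {} {} t z = z" for t z :: "'a \<Rightarrow> real"
    by (simp add: graft_def)
  with Nil show ?case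
    by (intro exI[of _ "\<lambda>_. h"]) (auto simp: PiM_empty)
next
  case (Cons j js)
  let ?K = "set js"
  from Cons.prems obtain h' where
    der: "\<And>z t. ((\<lambda>s. h (z(j := s))) has_real_derivative h' (z(j := t))) (at t)"
    and h: "mixed_bdd R bd js h B" and h': "mixed_bdd R True js h' (R * B)" by auto
  have js: "distinct js" "j \<notin> ?K" "finite ?K" using Cons.prems by auto
  obtain D0 where D0m [measurable]: "\<And>S. D0 S \<in> borel_measurable (PiM UNIV (\<lambda>_. borel))"
    and D0b: "\<And>S z. S \<subseteq> ?K \<Longrightarrow> bd \<or> S \<noteq> {} \<Longrightarrow> \<bar>D0 S z\<bar> \<le> B * R ^ card S"
    and D0: "\<And>z. h z = (\<Sum>S\<in>Pow ?K. LINT t|PiM S (\<lambda>_. lborel).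
         D0 S (graft ?K S t z) * (\<Prod>i\<in>S. sgn_ind (t i) (z i)))"
    using Cons.IH[OF h js(1) \<open>0 \<le> R\<close>] by blast
  obtain D1 where D1m [measurable]: "\<And>S. D1 S \<in> borel_measurable (PiM UNIV (\<lambda>_. borel))"
    and D1b: "\<And>S z. S \<subseteq> ?K \<Longrightarrow> True \<or> S \<noteq> {} \<Longrightarrow> \<bar>D1 S z\<bar> \<le> R * B * R ^ card S"
    and D1: "\<And>z. h' z = (\<Sum>S\<in>Pow ?K. LINT t|PiM S (\<lambda>_. lborel).
         D1 S (graft ?K S t z) * (\<Prod>i\<in>S. sgn_ind (t i) (z i)))"
    using Cons.IH[OF h' js(1) \<open>0 \<le> R\<close>] by blast
  have h'm [measurable]: "h' \<in> borel_measurable (PiM UNIV (\<lambda>_. borel))"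
    using mixed_bdd_measurable[OF h'] .
  \<comment> \<open>Sets containing \<open>j\<close> are served by the expansion of the derivative
    \<open>h'\<close>, the others by the expansion of \<open>h\<close>, later evaluated with
    coordinate \<open>j\<close> at \<open>0\<close>.\<close>
  define D where "D S = (if j \<in> S then D1 (S - {j}) else D0 S)" for S
  let ?T = "\<lambda>z S t. D S (graft (insert j ?K) S t z) * (\<Prod>i\<in>S. sgn_ind (t i) (z i))"
  have Db: "\<bar>D S z\<bar> \<le> B * R ^ card S" if "S \<subseteq> set (j # js)" "bd \<or> S \<noteq> {}" for S z
  proof (cases "j \<in> S")
    case True
    then have "card S = Suc (card (S - {j}))"
      using that js by (metis List.finite_set card.remove finite_subset)
    then have "B * R ^ card S = R * B * R ^ card (S - {j})"
      by (simp only: power_Suc mult_ac)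
    moreover have "S - {j} \<subseteq> ?K" using that by auto
    ultimately show ?thesis
      using D1b[of "S - {j}" z] True unfolding D_def by (simp only: if_True) blast
  qed (use D0b that in \<open>auto simp: D_def\<close>)
  have Dm [measurable]: "D S \<in> borel_measurable (PiM UNIV (\<lambda>_. borel))" for S
    unfolding D_def by simp
  have fin: "finite S" if "S \<subseteq> ?K" for S
    using that js(3) finite_subset by blast
  have rep: "h z = (\<Sum>S\<in>Pow (set (j # js)). LINT t|PiM S (\<lambda>_. lborel). ?T z S t)" for z
  proof -
    have upd [measurable]: "(\<lambda>s. z(j := s)) \<in> measurable borel (PiM UNIV (\<lambda>_. borel))"
      by (rule measurable_PiM_single') (auto simp: space_PiM fun_upd_def)
    \<comment> \<open>The left side is \<open>h z - h (z(j := 0))\<close>. Its expansion gives the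
      sets containing \<open>j\<close>; the expansion of \<open>h (z(j := 0))\<close> below gives
      the remaining ones.\<close>
    have "h (z(j := z j)) - h (z(j := 0)) = (LINT s|lborel. h' (z(j := s)) * sgn_ind s (z j))"
      by (rule integral_sgn_ind[symmetric, OF der _ mixed_bdd_bound[OF h']]) measurable
    also have "\<dots> = (LINT s|lborel. (\<Sum>S\<in>Pow ?K. (LINT t|PiM S (\<lambda>_. lborel). ?T z (insert j S) (t(j := s)))))"
    proof (intro Bochner_Integration.integral_cong refl)
      fix s
      have "D1 S (graft ?K S t (z(j := s))) * (\<Prod>i\<in>S. sgn_ind (t i) ((z(j := s)) i)) * sgn_ind s (z j)
        = ?T z (insert j S) (t(j := s))" if S: "S \<subseteq> ?K" for S t
      proof -
        have "graft ?K S t (z(j := s)) = graft (insert j ?K) (insert j S) (t(j := s)) z"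
          using js S by (auto simp: graft_def fun_eq_iff)
        moreover have "insert j S - {j} = S" "j \<notin> S" using js S by auto
        moreover have "(\<Prod>i\<in>S. sgn_ind (t i) ((z(j := s)) i)) = (\<Prod>i\<in>S. sgn_ind ((t(j := s)) i) (z i))"
          using \<open>j \<notin> S\<close> by (intro prod.cong) auto
        ultimately show ?thesis using fin[OF S] by (simp add: D_def mult_ac)
      qed
      then show "h' (z(j := s)) * sgn_ind s (z j) =
         (\<Sum>S\<in>Pow ?K. LINT t|PiM S (\<lambda>_. lborel). ?T z (insert j S) (t(j := s)))"
        unfolding D1[of "z(j := s)"] sum_distrib_right
        by (intro sum.cong refl) (simp flip: Bochner_Integration.integral_mult_left_zero)
    qed
    also have "\<dots> = (\<Sum>S\<in>Pow ?K. LINT s|lborel. (LINT t|PiM S (\<lambda>_. lborel). ?T z (insert j S) (t(j := s))))"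
    proof (rule Bochner_Integration.integral_sum)
      fix S assume "S \<in> Pow ?K"
      then have S: "finite S" "j \<notin> S" "S \<subseteq> ?K" using js fin by auto
      have int: "integrable (PiM (insert j S) (\<lambda>_. lborel)) (?T z (insert j S))"
        using Db[of "insert j S"] S by (intro integrable_graft_sgn_ind[where B = "B * R ^ card (insert j S)"]) auto
      interpret PS: finite_product_sigma_finite "\<lambda>_. lborel :: real measure" S
        by standard (rule S)
      let ?P = "LINT t|PiM S (\<lambda>_. lborel). \<bar>\<Prod>i\<in>S. sgn_ind (t i) (z i)\<bar>"
      let ?c = "B * R ^ card (insert j S)"
      have c: "0 \<le> ?c"
        by (rule order_trans[OF abs_ge_zero Db[of "insert j S" "\<lambda>_. 0"]]) (use S in auto)
      \<comment> \<open>The inner integral is dominated by a multiple of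
        \<open>\<bar>sgn_ind s (z j)\<bar>\<close>, which is integrable in \<open>s\<close>; this
        justifies interchanging the sum with the outer integral.\<close>
      have bound: "\<bar>LINT t|PiM S (\<lambda>_. lborel). ?T z (insert j S) (t(j := s))\<bar> \<le> ?c * ?P * \<bar>sgn_ind s (z j)\<bar>" for s
      proof -
        have "\<bar>LINT t|PiM S (\<lambda>_. lborel). ?T z (insert j S) (t(j := s))\<bar>
            \<le> (LINT t|PiM S (\<lambda>_. lborel). \<bar>?T z (insert j S) (t(j := s))\<bar>)"
          by (rule integral_abs_bound)
        also have "\<dots> \<le> (LINT t|PiM S (\<lambda>_. lborel). ?c * \<bar>\<Prod>i\<in>S. sgn_ind (t i) (z i)\<bar> * \<bar>sgn_ind s (z j)\<bar>)"
        proof (rule integral_mono')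
          show "integrable (PiM S (\<lambda>_. lborel)) (\<lambda>t. ?c * \<bar>\<Prod>i\<in>S. sgn_ind (t i) (z i)\<bar> * \<bar>sgn_ind s (z j)\<bar>)"
            by (intro integrable_mult_left integrable_mult_right integrable_abs
                  lborel_prod.product_integrable_prod integrable_sgn_ind S)
          fix t
          let ?g = "graft (insert j ?K) (insert j S) (t(j := s)) z" and ?p = "\<Prod>i\<in>S. sgn_ind (t i) (z i)"
          have "(\<Prod>i\<in>S. sgn_ind ((t(j := s)) i) (z i)) = ?p"
            using S(2) by (intro prod.cong) auto
          then have "?T z (insert j S) (t(j := s)) = D (insert j S) ?g * (?p * sgn_ind s (z j))"
            using S by simp
          moreover have "\<bar>D (insert j S) ?g\<bar> \<le> ?c"
            by (rule Db) (use S in auto)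
          ultimately show "\<bar>?T z (insert j S) (t(j := s))\<bar> \<le> ?c * \<bar>?p\<bar> * \<bar>sgn_ind s (z j)\<bar>"
            by (simp only: abs_mult mult.assoc[of ?c]) (intro mult_right_mono mult_nonneg_nonneg abs_ge_zero)
        qed (use c in auto)
        finally show ?thesis by simp
      qed
      show "integrable lborel (\<lambda>s. (LINT t|PiM S (\<lambda>_. lborel). ?T z (insert j S) (t(j := s))))"
      proof (rule Bochner_Integration.integrable_bound)
        show "integrable lborel (\<lambda>s. ?c * ?P * \<bar>sgn_ind s (z j)\<bar>)"
          by (intro integrable_mult_right integrable_abs integrable_sgn_ind)
        show "(\<lambda>s. (LINT t|PiM S (\<lambda>_. lborel). ?T z (insert j S) (t(j := s)))) \<in> borel_measurable lborel"
        proof (rule PS.borel_measurable_lebesgue_integral)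
          have "(\<lambda>p. (snd p)(j := fst p)) \<in> measurable (lborel \<Otimes>\<^sub>M PiM S (\<lambda>_. lborel)) (PiM (insert j S) (\<lambda>_. lborel))"
            by (rule measurable_compose[OF _ measurable_add_dim[of j S "\<lambda>_. lborel"], of "\<lambda>p. (snd p, fst p)", simplified]) measurable
          from measurable_compose[OF this borel_measurable_integrable[OF int]]
          show "(\<lambda>(s, t). ?T z (insert j S) (t(j := s))) \<in> borel_measurable (lborel \<Otimes>\<^sub>M PiM S (\<lambda>_. lborel))"
            by (simp add: case_prod_unfold)
        qed
      qed (use bound c in auto)
    qed
    also have "\<dots> = (\<Sum>S\<in>Pow ?K. LINT t|PiM (insert j S) (\<lambda>_. lborel). ?T z (insert j S) t)"
    proof (intro sum.cong refl)
      fix S assume "S \<in> Pow ?K"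
      then have S: "finite S" "j \<notin> S" "S \<subseteq> ?K" using js fin by auto
      have int: "integrable (PiM (insert j S) (\<lambda>_. lborel)) (?T z (insert j S))"
        using Db[of "insert j S"] S by (intro integrable_graft_sgn_ind[where B = "B * R ^ card (insert j S)"]) auto
      show "(LINT s|lborel. (LINT t|PiM S (\<lambda>_. lborel). ?T z (insert j S) (t(j := s)))) =
        (LINT t|PiM (insert j S) (\<lambda>_. lborel). ?T z (insert j S) t)"
        using lborel_prod.product_integral_insert_rev[OF S(1,2) int] by simp
    qed
    also have "\<dots> = (\<Sum>S\<in>insert j ` Pow ?K. LINT t|PiM S (\<lambda>_. lborel). ?T z S t)"
      using js(2) by (subst sum.reindex) (auto simp: inj_on_def insert_eq_iff)
    finally have 1: "h z - h (z(j := 0)) = (\<Sum>S\<in>insert j ` Pow ?K. LINT t|PiM S (\<lambda>_. lborel). ?T z S t)"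
      by simp
    have 2: "h (z(j := 0)) = (\<Sum>S\<in>Pow ?K. LINT t|PiM S (\<lambda>_. lborel). ?T z S t)"
      unfolding D0[of "z(j := 0)"]
    proof (intro sum.cong refl Bochner_Integration.integral_cong)
      fix S t assume "S \<in> Pow ?K"
      then have j: "j \<notin> S" using js by auto
      then have "graft ?K S t (z(j := 0)) = graft (insert j ?K) S t z"
        using js by (auto simp: graft_def fun_eq_iff)
      moreover have "(\<Prod>i\<in>S. sgn_ind (t i) ((z(j := 0)) i)) = (\<Prod>i\<in>S. sgn_ind (t i) (z i))"
        using j by (intro prod.cong) auto
      ultimately show "D0 S (graft ?K S t (z(j := 0))) * (\<Prod>i\<in>S. sgn_ind (t i) ((z(j := 0)) i)) = ?T z S t"
        using j by (simp add: D_def)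
    qed
    have "Pow ?K \<inter> insert j ` Pow ?K = {}" using js by auto
    then have "(\<Sum>S\<in>Pow (set (j # js)). LINT t|PiM S (\<lambda>_. lborel). ?T z S t)
       = (\<Sum>S\<in>Pow ?K. LINT t|PiM S (\<lambda>_. lborel). ?T z S t) +
         (\<Sum>S\<in>insert j ` Pow ?K. LINT t|PiM S (\<lambda>_. lborel). ?T z S t)"
      by (simp add: Pow_insert sum.union_disjoint)
    with 1 2 show ?thesis by simp
  qed
  show ?case
    using Db rep Dm by (intro exI[of _ D]) auto
qed

section \<open>A uniform bound for the empirical process\<close>

text \<open>A Chernoff-type bound that separates \<open>s\<close> from \<open>y\<close>, valid
  because the indicator vanishes for \<open>\<bar>s\<bar> > \<bar>y\<bar>\<close>. The rate is 2
  because half of it is lost to a square root, which leaves the integrable factor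
  \<open>exp (- \<bar>s\<bar>)\<close>.\<close>

lemma sgn_ind_exp: "\<bar>sgn_ind s y\<bar> \<le> exp (2 * \<bar>y\<bar>) * exp (- 2 * \<bar>s\<bar>)"
proof (cases "\<bar>s\<bar> \<le> \<bar>y\<bar>")
  case True
  then have "exp 0 \<le> exp (2 * \<bar>y\<bar> + (- 2 * \<bar>s\<bar>))" by simp
  then have "1 \<le> exp (2 * \<bar>y\<bar>) * exp (- 2 * \<bar>s\<bar>)" by (simp only: exp_add exp_zero)
  moreover have "\<bar>sgn_ind s y\<bar> \<le> 1" by (simp add: sgn_ind_def)
  ultimately show ?thesis by linarith
next
  case False
  then have "sgn_ind s y = 0" by (auto simp: sgn_ind_def)
  then show ?thesis by simp
qed

lemma prod_sgn_ind_exp: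
  assumes "finite J" "S \<subseteq> J"
  shows "\<bar>\<Prod>i\<in>S. sgn_ind (t i) (z i)\<bar> \<le> exp (2 * (\<Sum>i\<in>J. \<bar>z i\<bar>)) * (\<Prod>i\<in>S. exp (- 2 * \<bar>t i\<bar>))"
proof -
  have S: "finite S" using assms finite_subset by blast
  have "\<bar>\<Prod>i\<in>S. sgn_ind (t i) (z i)\<bar> \<le> (\<Prod>i\<in>S. exp (2 * \<bar>z i\<bar>) * exp (- 2 * \<bar>t i\<bar>))"
    unfolding abs_prod by (intro prod_mono conjI sgn_ind_exp abs_ge_zero)
  also have "\<dots> = exp (2 * (\<Sum>i\<in>S. \<bar>z i\<bar>)) * (\<Prod>i\<in>S. exp (- 2 * \<bar>t i\<bar>))"
    using S by (simp add: prod.distrib exp_sum sum_distrib_left)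
  also have "\<dots> \<le> exp (2 * (\<Sum>i\<in>J. \<bar>z i\<bar>)) * (\<Prod>i\<in>S. exp (- 2 * \<bar>t i\<bar>))"
    using assms by (intro mult_right_mono prod_nonneg) (auto intro!: sum_mono2)
  finally show ?thesis .
qed

lemma integrable_exp_neg_abs: 
  assumes "0 < c" shows "integrable lborel (\<lambda>t::real. exp (- c * \<bar>t\<bar>))"
proof -
  note 1 = integrable_I0i_exp_mscale[OF assms]
  have "integrable lborel (\<lambda>t::real. indicator {0<..} (- t) *\<^sub>R exp (- ((- t) * c)))"
    using lborel_integrable_real_affine[OF 1[unfolded set_integrable_def], of "-1" 0] by simp
  from Bochner_Integration.integrable_add[OF 1[unfolded set_integrable_def] this]
  show ?thesis
    by (rule Bochner_Integration.integrable_bound)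
       (use AE_lborel_singleton[of 0] in \<open>auto elim!: eventually_mono simp: indicator_def mult.commute\<close>)
qed

text \<open>Collects what the deviation bound uses about the observations. The probability of the
  event on the right of \<open>variance_le\<close> transfers the decay of tail probabilities to the
  deviations, so that they can be integrated over all corners. \<open>Z_supp\<close> lets functions
  on the whole index type stand for vectors indexed by \<open>J\<close>.\<close>

locale concentrated_process = prob_space M for M :: "'w measure" +
  fixes Z :: "nat \<Rightarrow> 'w \<Rightarrow> 'j \<Rightarrow> real" and J :: "'j set" and K :: real
  assumes Z_meas [measurable]: "\<And>k. Z k \<in> measurable M (PiM UNIV (\<lambda>_. borel))"
    and Z_supp: "\<And>k \<omega> i. i \<notin> J \<Longrightarrow> Z k \<omega> i = 0"
    and fin_J: "finite J"
    and exp_moment: "\<And>k. integrable M (\<lambda>\<omega>. exp (2 * (\<Sum>i\<in>J. \<bar>Z k \<omega> i\<bar>)))"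
    and K_nonneg: "0 \<le> K"
    and variance_le: "\<And>A n. A \<in> sets (PiM UNIV (\<lambda>_. borel)) \<Longrightarrow>
      expectation (\<lambda>\<omega>. ((\<Sum>k<n. indicator A (Z k \<omega>)) - real n * expectation (\<lambda>\<omega>. indicator A (Z 0 \<omega>)))\<^sup>2)
        \<le> K * real n * expectation (\<lambda>\<omega>. indicator A (Z 0 \<omega>))"
begin

abbreviation "LB S \<equiv> PiM S (\<lambda>_. lborel :: real measure)"

text \<open>Up to a sign depending on \<open>t\<close> only, the indicator of the orthant with
  corner \<open>t\<close> that points away from the origin: \<open>t i \<le> z i\<close> where
  \<open>t i > 0\<close>, and \<open>z i < t i\<close> elsewhere in \<open>S\<close>.\<close>

definition orth :: "'j set \<Rightarrow> ('j \<Rightarrow> real) \<Rightarrow> ('j \<Rightarrow> real) \<Rightarrow> real" where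
  "orth S t z = (\<Prod>i\<in>S. sgn_ind (t i) (z i))"

definition orth_dev :: "nat \<Rightarrow> 'j set \<Rightarrow> ('j \<Rightarrow> real) \<Rightarrow> 'w \<Rightarrow> real" where
  "orth_dev n S t \<omega> = (\<Sum>k<n. orth S t (Z k \<omega>)) - real n * expectation (\<lambda>\<omega>. orth S t (Z 0 \<omega>))"

text \<open>The empty set contributes nothing: \<open>orth {} t\<close> is constant, so its centred
  sum vanishes.\<close>

definition total_dev :: "nat \<Rightarrow> 'w \<Rightarrow> real" where
  "total_dev n \<omega> = (\<Sum>S\<in>Pow J - {{}}. LINT t|LB S. \<bar>orth_dev n S t \<omega>\<bar>)"

section \<open>Joint integrability in the sample point and the corner of the orthant\<close>

lemma finite_sub: "S \<subseteq> J \<Longrightarrow> finite S"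
  using fin_J finite_subset by blast

lemma pair_LB: "S \<subseteq> J \<Longrightarrow> pair_sigma_finite M (LB S)"
proof -
  assume "S \<subseteq> J"
  then interpret finite_product_sigma_finite "\<lambda>_::'j. lborel :: real measure" S
    by unfold_locales (rule finite_sub)
  show ?thesis ..
qed

lemma integrable_exp_prod:
  assumes "S \<subseteq> J" "0 < c"
  shows "integrable (LB S) (\<lambda>t. \<Prod>i\<in>S. exp (- c * \<bar>t i\<bar>))"
  by (rule lborel_prod.product_integrable_prod[OF finite_sub[OF assms(1)] integrable_exp_neg_abs[OF assms(2)]])

lemma orth_measurable [measurable]:
  assumes "S \<subseteq> J"
  shows "(\<lambda>p. orth S (snd p) (Z k (fst p))) \<in> borel_measurable (M \<Otimes>\<^sub>M LB S)"
  unfolding orth_def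
proof (rule borel_measurable_prod)
  fix i assume i: "i \<in> S"
  have [measurable]: "(\<lambda>p. snd p i) \<in> borel_measurable (M \<Otimes>\<^sub>M LB S)"
    by (rule measurable_compose[OF measurable_snd, where g = "\<lambda>t. t i"])
       (use measurable_component_singleton[OF i, of "\<lambda>_. lborel :: real measure"] in simp)
  have [measurable]: "(\<lambda>\<omega>. Z k \<omega> i) \<in> borel_measurable M"
    using measurable_compose[OF Z_meas measurable_component_singleton[of i UNIV]] by simp
  show "(\<lambda>p. sgn_ind (snd p i) (Z k (fst p) i)) \<in> borel_measurable (M \<Otimes>\<^sub>M LB S)"
    by measurable
qed

text \<open>The dominating function for orthant indicators on the product of sample space and corner
  space; \<open>prod_sgn_ind_exp\<close> has made it a product of a function of the sample point and
  a function of the corner.\<close>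

lemma integrable_exp_pair:
  assumes S: "S \<subseteq> J"
  shows "integrable (M \<Otimes>\<^sub>M LB S) (\<lambda>p. exp (2 * (\<Sum>i\<in>J. \<bar>Z k (fst p) i\<bar>)) * (\<Prod>i\<in>S. exp (- 2 * \<bar>snd p i\<bar>)))"
proof -
  interpret P: pair_sigma_finite M "LB S" by (rule pair_LB[OF S])
  note [measurable] = borel_measurable_integrable[OF exp_moment]
    borel_measurable_integrable[OF integrable_exp_prod[OF S, of 2]]
  show ?thesis
  proof (rule P.Fubini_integrable)
    show "(\<lambda>p. exp (2 * (\<Sum>i\<in>J. \<bar>Z k (fst p) i\<bar>)) * (\<Prod>i\<in>S. exp (- 2 * \<bar>snd p i\<bar>))) \<in> borel_measurable (M \<Otimes>\<^sub>M LB S)"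
      using integrable_exp_prod[OF S, of 2]
      by (intro borel_measurable_times measurable_compose[OF measurable_fst] measurable_compose[OF measurable_snd]
          borel_measurable_integrable exp_moment) auto
  qed (use integrable_exp_prod[OF S, of 2] exp_moment[of k] in \<open>auto simp: abs_mult abs_prod intro!: AE_I2\<close>)
qed

lemma integrable_orth_pair:
  assumes S: "S \<subseteq> J"
  shows "integrable (M \<Otimes>\<^sub>M LB S) (\<lambda>p. orth S (snd p) (Z k (fst p)))"
  by (rule Bochner_Integration.integrable_bound[OF integrable_exp_pair[OF S, of k]])
     (use prod_sgn_ind_exp[OF fin_J S] orth_measurable[OF S]
       in \<open>auto simp: orth_def abs_mult abs_prod\<close>)

lemma integrable_orth: "integrable M (\<lambda>\<omega>. orth S t (Z k \<omega>))"
proof (rule integrable_const_bound[where B = 1])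
  have "\<bar>sgn_ind s y\<bar> \<le> 1" for s y by (simp add: sgn_ind_def)
  then show "AE \<omega> in M. norm (orth S t (Z k \<omega>)) \<le> 1"
    by (auto simp: orth_def abs_prod intro!: prod_le_1)
  show "(\<lambda>\<omega>. orth S t (Z k \<omega>)) \<in> borel_measurable M"
    unfolding orth_def
  proof (rule borel_measurable_prod)
    fix i
    have [measurable]: "(\<lambda>\<omega>. Z k \<omega> i) \<in> borel_measurable M"
      using measurable_compose[OF Z_meas measurable_component_singleton[of i UNIV]] by simp
    show "(\<lambda>\<omega>. sgn_ind (t i) (Z k \<omega> i)) \<in> borel_measurable M" by measurable
  qed
qed

lemma integrable_orth_LB:
  assumes "S \<subseteq> J" shows "integrable (LB S) (\<lambda>t. orth S t z)"
  unfolding orth_def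
  by (rule lborel_prod.product_integrable_prod[OF finite_sub[OF assms] integrable_sgn_ind])

lemma integrable_expectation_orth:
  assumes S: "S \<subseteq> J" shows "integrable (LB S) (\<lambda>t. expectation (\<lambda>\<omega>. orth S t (Z k \<omega>)))"
proof -
  interpret P: pair_sigma_finite M "LB S" by (rule pair_LB[OF S])
  interpret Q: pair_sigma_finite "LB S" M ..
  show ?thesis
    using Q.integrable_fst'[OF P.integrable_product_swap[OF integrable_orth_pair[OF S]]] by simp
qed

lemma integrable_orth_dev_LB:
  assumes S: "S \<subseteq> J" shows "integrable (LB S) (\<lambda>t. orth_dev n S t \<omega>)"
  unfolding orth_dev_def
  by (intro Bochner_Integration.integrable_diff Bochner_Integration.integrable_sum integrable_mult_right
      integrable_orth_LB integrable_expectation_orth S)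

lemma integrable_orth_dev: "integrable M (\<lambda>\<omega>. orth_dev n S t \<omega>)"
  unfolding orth_dev_def
  by (intro Bochner_Integration.integrable_diff Bochner_Integration.integrable_sum integrable_const integrable_orth)

lemma integrable_orth_dev_pair:
  assumes S: "S \<subseteq> J" shows "integrable (M \<Otimes>\<^sub>M LB S) (\<lambda>p. orth_dev n S (snd p) (fst p))"
proof -
  interpret P: pair_sigma_finite M "LB S" by (rule pair_LB[OF S])
  have "integrable (M \<Otimes>\<^sub>M LB S) (\<lambda>p. expectation (\<lambda>\<omega>. orth S (snd p) (Z 0 \<omega>)))"
    by (rule P.Fubini_integrable)
       (use integrable_expectation_orth[OF S, of 0] in
         \<open>auto intro!: measurable_compose[OF measurable_snd] integrable_const borel_measurable_integrable\<close>)
  then show ?thesis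
    unfolding orth_dev_def
    by (intro Bochner_Integration.integrable_diff Bochner_Integration.integrable_sum integrable_mult_right integrable_orth_pair S)
qed

lemma total_dev_nonneg: "0 \<le> total_dev n \<omega>"
  unfolding total_dev_def by (intro sum_nonneg) auto

lemma integrable_total_dev: "integrable M (total_dev n)"
proof -
  have "integrable M (\<lambda>\<omega>. LINT t|LB S. \<bar>orth_dev n S t \<omega>\<bar>)" if S: "S \<subseteq> J" for S
  proof -
    interpret P: pair_sigma_finite M "LB S" by (rule pair_LB[OF S])
    show ?thesis
      using P.integrable_fst'[OF integrable_abs[OF integrable_orth_dev_pair[OF S]]] by simp
  qed
  then show ?thesis
    unfolding total_dev_def by (intro Bochner_Integration.integrable_sum) auto
qed

text \<open>
  For fixed \<open>t\<close> the function \<open>orth S t\<close> is a constant sign times an indicator, so that the variance bound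
  for events applies.
\<close>
lemma expectation_abs_orth_dev_le:
  assumes S: "S \<subseteq> J"
  shows "expectation (\<lambda>\<omega>. \<bar>orth_dev n S t \<omega>\<bar>) \<le>
     sqrt (K * expectation (\<lambda>\<omega>. exp (2 * (\<Sum>i\<in>J. \<bar>Z 0 \<omega> i\<bar>)))) * sqrt (real n) * (\<Prod>i\<in>S. exp (- 1 * \<bar>t i\<bar>))"
proof -
  let ?V = "\<lambda>\<omega>. exp (2 * (\<Sum>i\<in>J. \<bar>Z 0 \<omega> i\<bar>))"
  define A where "A = {z \<in> space (PiM UNIV (\<lambda>_. borel)). orth S t z \<noteq> 0}"
  have om: "(\<lambda>z. orth S t z) \<in> borel_measurable (PiM UNIV (\<lambda>_. borel))"
    unfolding orth_def by measurable
  have A [measurable]: "A \<in> sets (PiM UNIV (\<lambda>_. borel))"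
    unfolding A_def using om by measurable
  define \<sigma> where "\<sigma> = (\<Prod>i\<in>S. if 0 < t i then 1 else - 1 :: real)"
  have orth_eq: "orth S t z = \<sigma> * indicator A z" for z
  proof (cases "z \<in> A")
    case True
    then have "\<forall>i\<in>S. sgn_ind (t i) (z i) \<noteq> 0"
      using finite_sub[OF S] by (auto simp: A_def orth_def)
    then have "orth S t z = \<sigma>"
      unfolding orth_def \<sigma>_def by (intro prod.cong) (auto simp: sgn_ind_def split: if_splits)
    with True show ?thesis by simp
  qed (auto simp: A_def space_PiM)
  have \<sigma>: "\<sigma>\<^sup>2 = 1"
    unfolding \<sigma>_def power2_eq_square prod.distrib[symmetric] by (intro prod.neutral) auto
  let ?p = "expectation (\<lambda>\<omega>. indicator A (Z 0 \<omega>)) :: real"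
  have sq: "(orth_dev n S t \<omega>)\<^sup>2 = ((\<Sum>k<n. indicator A (Z k \<omega>)) - real n * ?p)\<^sup>2" for \<omega>
  proof -
    have "orth_dev n S t \<omega> = \<sigma> * ((\<Sum>k<n. indicator A (Z k \<omega>)) - real n * ?p)"
      unfolding orth_dev_def orth_eq by (simp add: sum_distrib_left algebra_simps)
    then show ?thesis using \<sigma> by (simp add: power_mult_distrib)
  qed
  \<comment> \<open>A Markov-type bound: the exponential moment of the observation makes the
    probability of the orthant decay like the product of the factors
    \<open>exp (- 2 * \<bar>t i\<bar>)\<close>.\<close>
  have pV: "?p \<le> expectation ?V * (\<Prod>i\<in>S. exp (- 2 * \<bar>t i\<bar>))"
  proof -
    have "?p \<le> expectation (\<lambda>\<omega>. ?V \<omega> * (\<Prod>i\<in>S. exp (- 2 * \<bar>t i\<bar>)))"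
    proof (rule integral_mono')
      show "integrable M (\<lambda>\<omega>. ?V \<omega> * (\<Prod>i\<in>S. exp (- 2 * \<bar>t i\<bar>)))"
        using exp_moment by (intro integrable_mult_left)
      fix \<omega>
      have "\<bar>\<sigma>\<bar> = 1" using \<sigma> by (simp add: power2_eq_1_iff) linarith
      then have "indicator A (Z 0 \<omega>) = \<bar>orth S t (Z 0 \<omega>)\<bar>"
        unfolding orth_eq by (simp add: abs_mult)
      then show "indicator A (Z 0 \<omega>) \<le> ?V \<omega> * (\<Prod>i\<in>S. exp (- 2 * \<bar>t i\<bar>))"
        using prod_sgn_ind_exp[OF fin_J S] by (simp add: orth_def)
    qed (auto intro!: mult_nonneg_nonneg prod_nonneg)
    then show ?thesis by simp
  qed
  have int2: "integrable M (\<lambda>\<omega>. (orth_dev n S t \<omega>)\<^sup>2)"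
  proof (rule integrable_const_bound[where B = "(real n + real n * \<bar>?p\<bar>)\<^sup>2"])
    show "AE \<omega> in M. norm ((orth_dev n S t \<omega>)\<^sup>2) \<le> (real n + real n * \<bar>?p\<bar>)\<^sup>2"
    proof (rule AE_I2)
      fix \<omega>
      have "\<bar>(\<Sum>k<n. indicator A (Z k \<omega>)) - real n * ?p\<bar> \<le> \<bar>\<Sum>k<n. indicator A (Z k \<omega>) :: real\<bar> + \<bar>real n * ?p\<bar>"
        by (rule abs_triangle_ineq4)
      also have "\<bar>\<Sum>k<n. indicator A (Z k \<omega>) :: real\<bar> \<le> (\<Sum>k<n. 1)"
        by (intro order_trans[OF sum_abs] sum_mono) (auto simp: indicator_def)
      finally have "\<bar>(\<Sum>k<n. indicator A (Z k \<omega>)) - real n * ?p\<bar> \<le> real n + real n * \<bar>?p\<bar>"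
        by (simp add: abs_mult)
      then show "norm ((orth_dev n S t \<omega>)\<^sup>2) \<le> (real n + real n * \<bar>?p\<bar>)\<^sup>2"
        unfolding sq by (simp add: abs_le_square_iff[symmetric] abs_mult)
    qed
    show "(\<lambda>\<omega>. (orth_dev n S t \<omega>)\<^sup>2) \<in> borel_measurable M"
      using borel_measurable_integrable[OF integrable_orth_dev] by measurable
  qed
  \<comment> \<open>Jensen's inequality for the square, in the form that a variance is
    nonnegative.\<close>
  have "(expectation (\<lambda>\<omega>. \<bar>orth_dev n S t \<omega>\<bar>))\<^sup>2 \<le> expectation (\<lambda>\<omega>. (orth_dev n S t \<omega>)\<^sup>2)"
  proof -
    have "0 \<le> variance (\<lambda>\<omega>. \<bar>orth_dev n S t \<omega>\<bar>)"
      by (rule variance_positive)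
    also have "\<dots> = expectation (\<lambda>\<omega>. \<bar>orth_dev n S t \<omega>\<bar>\<^sup>2) - (expectation (\<lambda>\<omega>. \<bar>orth_dev n S t \<omega>\<bar>))\<^sup>2"
      by (rule variance_eq) (use int2 integrable_orth_dev in auto)
    finally show ?thesis by simp
  qed
  also have "\<dots> \<le> K * real n * ?p"
    unfolding sq by (rule variance_le[OF A])
  also have "\<dots> \<le> K * real n * (expectation ?V * (\<Prod>i\<in>S. exp (- 2 * \<bar>t i\<bar>)))"
    using K_nonneg by (intro mult_left_mono pV) auto
  \<comment> \<open>Writing the bound as a square prepares the root, which turns the rate 2 of the
    tail bound into rate 1 and \<open>n\<close> into \<open>sqrt n\<close>.\<close>
  also have "\<dots> = (sqrt (K * expectation ?V) * sqrt (real n) * (\<Prod>i\<in>S. exp (- 1 * \<bar>t i\<bar>)))\<^sup>2"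
  proof -
    have "exp (- (2 * \<bar>a\<bar>)) = (exp (- \<bar>a\<bar>))\<^sup>2" for a :: real
      by (simp add: power2_eq_square flip: exp_add)
    moreover have "0 \<le> expectation ?V" by (intro integral_nonneg_AE) auto
    ultimately show ?thesis
      using K_nonneg by (simp add: power_mult_distrib prod_power_distrib real_sqrt_mult mult_ac)
  qed
  finally show ?thesis
    by (rule power2_le_imp_le) (auto intro!: mult_nonneg_nonneg prod_nonneg integral_nonneg_AE K_nonneg)
qed

text \<open>Exchanging the expectation with the integral over corners reduces the claim to a single
  corner, where the factors \<open>exp (- \<bar>t i\<bar>)\<close> are integrable.\<close>

lemma expectation_total_dev: "\<exists>c\<ge>0. \<forall>n. expectation (total_dev n) \<le> c * sqrt (real n)"
proof -
  define c where "c = sqrt (K * expectation (\<lambda>\<omega>. exp (2 * (\<Sum>i\<in>J. \<bar>Z 0 \<omega> i\<bar>))))"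
  have c: "0 \<le> c" by (auto simp: c_def intro!: mult_nonneg_nonneg K_nonneg integral_nonneg_AE)
  let ?e = "\<lambda>S t. \<Prod>i\<in>S. exp (- 1 * \<bar>t i\<bar>) :: real"
  have "expectation (total_dev n) \<le> (\<Sum>S\<in>Pow J - {{}}. c * (LINT t|LB S. ?e S t)) * sqrt (real n)" for n
  proof -
    have "expectation (total_dev n) = (\<Sum>S\<in>Pow J - {{}}. LINT \<omega>|M. (LINT t|LB S. \<bar>orth_dev n S t \<omega>\<bar>))"
      unfolding total_dev_def
    proof (rule Bochner_Integration.integral_sum)
      fix S assume "S \<in> Pow J - {{}}"
      then have S: "S \<subseteq> J" by auto
      interpret P: pair_sigma_finite M "LB S" by (rule pair_LB[OF S])
      show "integrable M (\<lambda>\<omega>. LINT t|LB S. \<bar>orth_dev n S t \<omega>\<bar>)"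
        using P.integrable_fst'[OF integrable_abs[OF integrable_orth_dev_pair[OF S]]] by simp
    qed
    also have "\<dots> \<le> (\<Sum>S\<in>Pow J - {{}}. c * sqrt (real n) * (LINT t|LB S. ?e S t))"
    proof (rule sum_mono)
      fix S assume "S \<in> Pow J - {{}}"
      then have S: "S \<subseteq> J" by auto
      interpret P: pair_sigma_finite M "LB S" by (rule pair_LB[OF S])
      have "(LINT \<omega>|M. (LINT t|LB S. \<bar>orth_dev n S t \<omega>\<bar>)) = (LINT t|LB S. (LINT \<omega>|M. \<bar>orth_dev n S t \<omega>\<bar>))"
        by (rule P.Fubini_integral[symmetric])
           (use integrable_abs[OF integrable_orth_dev_pair[OF S]] in \<open>simp add: case_prod_unfold\<close>)
      also have "\<dots> \<le> (LINT t|LB S. c * sqrt (real n) * ?e S t)"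
        using expectation_abs_orth_dev_le[OF S, of n, folded c_def] integrable_exp_prod[OF S, of 1] c
        by (intro integral_mono') (auto intro!: mult_nonneg_nonneg prod_nonneg)
      finally show "(LINT \<omega>|M. (LINT t|LB S. \<bar>orth_dev n S t \<omega>\<bar>)) \<le> c * sqrt (real n) * (LINT t|LB S. ?e S t)"
        by simp
    qed
    finally show ?thesis by (simp add: sum_distrib_left sum_distrib_right mult_ac)
  qed
  then show ?thesis
    using c by (intro exI[of _ "\<Sum>S\<in>Pow J - {{}}. c * (LINT t|LB S. ?e S t)"])
      (auto intro!: sum_nonneg mult_nonneg_nonneg integral_nonneg_AE prod_nonneg)
qed

text \<open>After anchoring at the origin the weights \<open>E S t\<close> depend neither on the
  sample point nor on \<open>k\<close>. The centred sum of \<open>h\<close> is therefore their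
  integral against \<open>orth_dev\<close>, and the triangle inequality leaves
  \<open>total_dev\<close>. \<open>1 \<le> R\<close> allows \<open>R ^ card J\<close> as a common
  factor. The bound holds for every \<open>\<omega>\<close>, which later permits an \<open>h\<close>
  that depends on \<open>\<omega>\<close>.\<close>

theorem uniform_deviation:
  assumes h: "mixed_bdd R False js h B" and js: "distinct js" "set js = J" and R: "1 \<le> R" and B: "0 \<le> B"
  shows "integrable M (\<lambda>\<omega>. h (Z 0 \<omega>))"
    and "\<bar>(\<Sum>k<n. h (Z k \<omega>)) - real n * expectation (\<lambda>\<omega>. h (Z 0 \<omega>))\<bar> \<le> B * R ^ card J * total_dev n \<omega>"
proof -
  have "0 \<le> R" using R by simp
  from mixed_bdd_representation[OF h js(1) this, unfolded js(2)]
  obtain D where D':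
    "(\<forall>S. D S \<in> borel_measurable (PiM UNIV (\<lambda>_. borel))) \<and>
     (\<forall>S z. S \<subseteq> J \<longrightarrow> False \<or> S \<noteq> {} \<longrightarrow> \<bar>D S z\<bar> \<le> B * R ^ card S) \<and>
     (\<forall>z. h z = (\<Sum>S\<in>Pow J. LINT t|LB S. D S (graft J S t z) * (\<Prod>i\<in>S. sgn_ind (t i) (z i))))"
    by (rule exE)
  note Dm [measurable] = D'[THEN conjunct1, rule_format]
  note Db = D'[THEN conjunct2, THEN conjunct1, rule_format, OF _ disjI2]
  note D = D'[THEN conjunct2, THEN conjunct2, rule_format]
  define C where "C = B * R ^ card J"
  have c: "0 \<le> C" using B R by (simp add: C_def)
  define E where "E S t = D S (graft J S t (\<lambda>_. 0))" for S t
  have Em [measurable]: "E S \<in> borel_measurable (LB S)" for S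
    unfolding E_def by measurable
  have Eb: "\<bar>E S t\<bar> \<le> C" if "S \<in> Pow J - {{}}" for S t
  proof -
    have "R ^ card S \<le> R ^ card J"
      using R that fin_J by (intro power_increasing card_mono) auto
    then show ?thesis
      using order_trans[OF Db[of S "graft J S t (\<lambda>_. 0)"] mult_left_mono[OF _ B]] that
      unfolding E_def C_def by auto
  qed
  \<comment> \<open>The product space over the empty index set is the single point
    \<open>\<lambda>_. undefined\<close>, so the term \<open>S = {}\<close> is this constant; it
    cancels under centring.\<close>
  let ?c0 = "E {} (\<lambda>_. undefined)"
  have h_eq: "h (Z k \<omega>) = ?c0 + (\<Sum>S\<in>Pow J - {{}}. LINT t|LB S. E S t * orth S t (Z k \<omega>))" for k \<omega>
  proof -
    have "graft J S t (Z k \<omega>) = graft J S t (\<lambda>_. 0)" for S t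
      using Z_supp by (auto simp: graft_def fun_eq_iff)
    then have "h (Z k \<omega>) = (\<Sum>S\<in>Pow J. LINT t|LB S. E S t * orth S t (Z k \<omega>))"
      unfolding D[of "Z k \<omega>"] E_def orth_def by simp
    also have "\<dots> = (LINT t|LB {}. E {} t * orth {} t (Z k \<omega>)) + (\<Sum>S\<in>Pow J - {{}}. LINT t|LB S. E S t * orth S t (Z k \<omega>))"
      using fin_J by (intro sum.remove) auto
    also have "(LINT t|LB {}. E {} t * orth {} t (Z k \<omega>)) = ?c0"
      by (simp add: PiM_empty orth_def lebesgue_integral_count_space_finite)
    finally show ?thesis .
  qed
  have int_pair: "integrable (M \<Otimes>\<^sub>M LB S) (\<lambda>p. E S (snd p) * orth S (snd p) (Z 0 (fst p)))" if S: "S \<in> Pow J - {{}}" for S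
  proof (rule Bochner_Integration.integrable_bound)
    show "integrable (M \<Otimes>\<^sub>M LB S) (\<lambda>p. C * orth S (snd p) (Z 0 (fst p)))"
      using S by (intro integrable_mult_right integrable_orth_pair) auto
    have [measurable]: "(\<lambda>p. orth S (snd p) (Z 0 (fst p))) \<in> borel_measurable (M \<Otimes>\<^sub>M LB S)"
      using S by (intro orth_measurable) auto
    show "(\<lambda>p. E S (snd p) * orth S (snd p) (Z 0 (fst p))) \<in> borel_measurable (M \<Otimes>\<^sub>M LB S)"
      by (intro borel_measurable_times measurable_compose[OF measurable_snd Em]) measurable
  qed (use Eb[OF S] c in \<open>auto simp: abs_mult abs_of_nonneg intro!: mult_right_mono\<close>)
  have int_S: "integrable M (\<lambda>\<omega>. LINT t|LB S. E S t * orth S t (Z 0 \<omega>))"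
    and exp_S: "(LINT \<omega>|M. (LINT t|LB S. E S t * orth S t (Z 0 \<omega>))) = (LINT t|LB S. E S t * expectation (\<lambda>\<omega>. orth S t (Z 0 \<omega>)))"
    if S: "S \<in> Pow J - {{}}" for S
  proof -
    interpret P: pair_sigma_finite M "LB S" by (rule pair_LB) (use S in auto)
    show "integrable M (\<lambda>\<omega>. LINT t|LB S. E S t * orth S t (Z 0 \<omega>))"
      using P.integrable_fst'[OF int_pair[OF S]] by simp
    show "(LINT \<omega>|M. (LINT t|LB S. E S t * orth S t (Z 0 \<omega>))) = (LINT t|LB S. E S t * expectation (\<lambda>\<omega>. orth S t (Z 0 \<omega>)))"
      using P.Fubini_integral[of "\<lambda>\<omega> t. E S t * orth S t (Z 0 \<omega>)"] int_pair[OF S] by (simp add: case_prod_unfold)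
  qed
  show "integrable M (\<lambda>\<omega>. h (Z 0 \<omega>))"
    unfolding h_eq by (intro Bochner_Integration.integrable_add Bochner_Integration.integrable_sum int_S integrable_const) auto
  have Eh: "expectation (\<lambda>\<omega>. h (Z 0 \<omega>)) = ?c0 + (\<Sum>S\<in>Pow J - {{}}. LINT t|LB S. E S t * expectation (\<lambda>\<omega>. orth S t (Z 0 \<omega>)))"
  proof -
    have "expectation (\<lambda>\<omega>. h (Z 0 \<omega>)) = ?c0 + (LINT \<omega>|M. (\<Sum>S\<in>Pow J - {{}}. LINT t|LB S. E S t * orth S t (Z 0 \<omega>)))"
      unfolding h_eq
    proof (subst Bochner_Integration.integral_add)
      show "integrable M (\<lambda>\<omega>. \<Sum>S\<in>Pow J - {{}}. LINT t|LB S. E S t * orth S t (Z 0 \<omega>))"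
        by (rule Bochner_Integration.integrable_sum) (rule int_S)
    qed (auto simp: prob_space)
    also have "(LINT \<omega>|M. (\<Sum>S\<in>Pow J - {{}}. LINT t|LB S. E S t * orth S t (Z 0 \<omega>)))
       = (\<Sum>S\<in>Pow J - {{}}. LINT \<omega>|M. (LINT t|LB S. E S t * orth S t (Z 0 \<omega>)))"
      by (rule Bochner_Integration.integral_sum[OF int_S])
    also have "\<dots> = (\<Sum>S\<in>Pow J - {{}}. LINT t|LB S. E S t * expectation (\<lambda>\<omega>. orth S t (Z 0 \<omega>)))"
      by (intro sum.cong refl exp_S)
    finally show ?thesis .
  qed
  have int_E: "integrable (LB S) (\<lambda>t. E S t * g t)" if "S \<in> Pow J - {{}}" and g: "integrable (LB S) g" for S g
  proof (rule Bochner_Integration.integrable_bound)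
    show "integrable (LB S) (\<lambda>t. C * g t)"
      using g by (intro integrable_mult_right)
    show "(\<lambda>t. E S t * g t) \<in> borel_measurable (LB S)"
      using g by (intro borel_measurable_times Em borel_measurable_integrable)
  qed (use Eb[OF that(1)] c in \<open>auto simp: abs_mult abs_of_nonneg intro!: mult_right_mono\<close>)
  have "(\<Sum>k<n. h (Z k \<omega>)) - real n * expectation (\<lambda>\<omega>. h (Z 0 \<omega>))
     = (\<Sum>S\<in>Pow J - {{}}. LINT t|LB S. E S t * orth_dev n S t \<omega>)"
  proof -
    have "(LINT t|LB S. E S t * orth_dev n S t \<omega>) =
      (\<Sum>k<n. LINT t|LB S. E S t * orth S t (Z k \<omega>)) - real n * (LINT t|LB S. E S t * expectation (\<lambda>\<omega>. orth S t (Z 0 \<omega>)))"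
      if S: "S \<in> Pow J - {{}}" for S
    proof -
      have S': "S \<subseteq> J" using S by auto
      have "(LINT t|LB S. E S t * orth_dev n S t \<omega>) = (LINT t|LB S. (\<Sum>k<n. E S t * orth S t (Z k \<omega>))
          - real n * (E S t * expectation (\<lambda>\<omega>. orth S t (Z 0 \<omega>))))"
        unfolding orth_dev_def by (simp add: right_diff_distrib sum_distrib_left mult_ac)
      also have "\<dots> = (LINT t|LB S. (\<Sum>k<n. E S t * orth S t (Z k \<omega>)))
          - (LINT t|LB S. real n * (E S t * expectation (\<lambda>\<omega>. orth S t (Z 0 \<omega>))))"
        by (intro Bochner_Integration.integral_diff Bochner_Integration.integrable_sum integrable_mult_right
            int_E[OF S] integrable_orth_LB integrable_expectation_orth S')
      also have "(LINT t|LB S. (\<Sum>k<n. E S t * orth S t (Z k \<omega>))) = (\<Sum>k<n. LINT t|LB S. E S t * orth S t (Z k \<omega>))"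
        by (intro Bochner_Integration.integral_sum int_E[OF S] integrable_orth_LB S')
      finally show ?thesis by simp
    qed
    then have "(\<Sum>S\<in>Pow J - {{}}. LINT t|LB S. E S t * orth_dev n S t \<omega>) =
      (\<Sum>S\<in>Pow J - {{}}. \<Sum>k<n. LINT t|LB S. E S t * orth S t (Z k \<omega>))
      - real n * (\<Sum>S\<in>Pow J - {{}}. LINT t|LB S. E S t * expectation (\<lambda>\<omega>. orth S t (Z 0 \<omega>)))"
      by (simp add: sum_subtractf sum_distrib_left)
    also have "(\<Sum>S\<in>Pow J - {{}}. \<Sum>k<n. LINT t|LB S. E S t * orth S t (Z k \<omega>)) =
       (\<Sum>k<n. \<Sum>S\<in>Pow J - {{}}. LINT t|LB S. E S t * orth S t (Z k \<omega>))"
      by (rule sum.swap)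
    finally show ?thesis
      unfolding Eh unfolding h_eq by (simp add: sum.distrib algebra_simps)
  qed
  also have "\<bar>\<dots>\<bar> \<le> (\<Sum>S\<in>Pow J - {{}}. C * (LINT t|LB S. \<bar>orth_dev n S t \<omega>\<bar>))"
  proof (intro order_trans[OF sum_abs] sum_mono)
    fix S assume S: "S \<in> Pow J - {{}}"
    have "\<bar>LINT t|LB S. E S t * orth_dev n S t \<omega>\<bar> \<le> (LINT t|LB S. \<bar>E S t * orth_dev n S t \<omega>\<bar>)"
      by (rule integral_abs_bound)
    also have "\<dots> \<le> (LINT t|LB S. C * \<bar>orth_dev n S t \<omega>\<bar>)"
      using S Eb[OF S] c
      by (intro integral_mono' integrable_mult_right integrable_abs integrable_orth_dev_LB)
         (auto simp: abs_mult intro!: mult_right_mono)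
    finally show "\<bar>LINT t|LB S. E S t * orth_dev n S t \<omega>\<bar> \<le> C * (LINT t|LB S. \<bar>orth_dev n S t \<omega>\<bar>)"
      by simp
  qed
  also have "\<dots> = C * total_dev n \<omega>"
    by (simp add: total_dev_def sum_distrib_left)
  finally show "\<bar>(\<Sum>k<n. h (Z k \<omega>)) - real n * expectation (\<lambda>\<omega>. h (Z 0 \<omega>))\<bar> \<le> B * R ^ card J * total_dev n \<omega>"
    by (simp only: C_def)
qed

end

section \<open>Block observations under mixing\<close>

text \<open>The product formula on rectangles identifies the joint law with the product of the
  marginals, after which Tonelli's theorem freezes the second variable.\<close>

lemma (in prob_space) nn_integral_independent_pair:
  assumes [measurable]: "U \<in> measurable M S" "V \<in> measurable M T"
    and ind: "\<And>A B. A \<in> sets S \<Longrightarrow> B \<in> sets T \<Longrightarrow>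
      prob ((U -` A \<inter> space M) \<inter> (V -` B \<inter> space M)) = prob (U -` A \<inter> space M) * prob (V -` B \<inter> space M)"
    and f [measurable]: "f \<in> borel_measurable (S \<Otimes>\<^sub>M T)"
  shows "(\<integral>\<^sup>+ \<omega>. f (U \<omega>, V \<omega>) \<partial>M) = (\<integral>\<^sup>+ v. (\<integral>\<^sup>+ \<omega>. f (U \<omega>, v) \<partial>M) \<partial>distr M T V)"
proof -
  interpret U: prob_space "distr M S U" by (rule prob_space_distr) simp
  interpret V: prob_space "distr M T V" by (rule prob_space_distr) simp
  interpret UV: pair_sigma_finite "distr M S U" "distr M T V" ..
  have joint: "distr M S U \<Otimes>\<^sub>M distr M T V = distr M (S \<Otimes>\<^sub>M T) (\<lambda>\<omega>. (U \<omega>, V \<omega>))"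
  proof (rule pair_measure_eqI)
    fix A B assume "A \<in> sets (distr M S U)" "B \<in> sets (distr M T V)"
    then have [measurable]: "A \<in> sets S" "B \<in> sets T" by auto
    have "(\<lambda>\<omega>. (U \<omega>, V \<omega>)) -` (A \<times> B) \<inter> space M = (U -` A \<inter> space M) \<inter> (V -` B \<inter> space M)" by auto
    then show "emeasure (distr M S U) A * emeasure (distr M T V) B =
        emeasure (distr M (S \<Otimes>\<^sub>M T) (\<lambda>\<omega>. (U \<omega>, V \<omega>))) (A \<times> B)"
      by (simp add: emeasure_distr emeasure_eq_measure ind ennreal_mult)
  qed (auto intro: U.sigma_finite_measure_axioms V.sigma_finite_measure_axioms)
  have "(\<integral>\<^sup>+ \<omega>. f (U \<omega>, V \<omega>) \<partial>M) = (\<integral>\<^sup>+ p. f p \<partial>(distr M S U \<Otimes>\<^sub>M distr M T V))"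
    unfolding joint by (simp add: nn_integral_distr)
  also have "\<dots> = (\<integral>\<^sup>+ v. (\<integral>\<^sup>+ u. f (u, v) \<partial>distr M S U) \<partial>distr M T V)"
    by (rule UV.nn_integral_snd[symmetric]) simp
  also have "\<dots> = (\<integral>\<^sup>+ v. (\<integral>\<^sup>+ \<omega>. f (U \<omega>, v) \<partial>M) \<partial>distr M T V)"
    by (intro nn_integral_cong) (simp add: nn_integral_distr)
  finally show ?thesis .
qed

lemma nn_integral_pred:
  assumes "{\<omega> \<in> space M. P \<omega>} \<in> sets M" "\<And>\<omega>. \<omega> \<in> space M \<Longrightarrow> f \<omega> = (if P \<omega> then 1 else 0)"
  shows "(\<integral>\<^sup>+ \<omega>. f \<omega> \<partial>M) = emeasure M {\<omega> \<in> space M. P \<omega>}"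
proof -
  have "(\<integral>\<^sup>+ \<omega>. f \<omega> \<partial>M) = (\<integral>\<^sup>+ \<omega>. indicator {\<omega> \<in> space M. P \<omega>} \<omega> \<partial>M)"
    by (rule nn_integral_cong) (simp add: assms(2) indicator_def)
  then show ?thesis using assms(1) by simp
qed

text \<open>Adding one event at a time, the new cross terms are covariances with earlier events, at
  most \<open>p * \<phi> m\<close> where \<open>m\<close> counts the events strictly between. Their
  sum is at most \<open>p * suminf \<phi>\<close> and enters twice, whence the constant. The factor
  \<open>p\<close> is kept throughout.\<close>

lemma (in prob_space) variance_sum_events_le:
  fixes E :: "nat \<Rightarrow> 'a set" and p :: real
  assumes ev [measurable]: "\<And>k. E k \<in> events" and p: "\<And>k. prob (E k) = p"
    and cov: "\<And>i j. i < j \<Longrightarrow> prob (E i \<inter> E j) \<le> p * (p + \<phi> (j - i - 1))"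
    and \<phi>: "\<And>m. 0 \<le> \<phi> m" "summable \<phi>"
  shows "expectation (\<lambda>\<omega>. ((\<Sum>k<n. indicator (E k) \<omega>) - real n * p)\<^sup>2) \<le> (1 + 2 * suminf \<phi>) * real n * p"
proof (induction n)
  case 0 then show ?case by simp
next
  case (Suc n)
  define u where "u k \<omega> = indicator (E k) \<omega> - p" for k \<omega>
  define T where "T \<omega> = (\<Sum>k<n. u k \<omega>)" for \<omega>
  have p0: "0 \<le> p" "p \<le> 1" using p[of 0] prob_le_1 measure_nonneg by metis+
  have um [measurable]: "u k \<in> borel_measurable M" for k unfolding u_def by measurable
  have ub: "\<bar>u k \<omega>\<bar> \<le> 1" for k \<omega> using p0 by (auto simp: u_def indicator_def)
  have int_uu: "integrable M (\<lambda>\<omega>. u i \<omega> * u j \<omega>)" for i j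
  proof (rule integrable_const_bound[where B = 1])
    show "AE \<omega> in M. norm (u i \<omega> * u j \<omega>) \<le> 1"
      using mult_mono[OF ub ub] by (auto simp: abs_mult)
  qed measurable
  have Tu: "T \<omega> * u n \<omega> = (\<Sum>k<n. u k \<omega> * u n \<omega>)" and TT: "(T \<omega>)\<^sup>2 = (\<Sum>i<n. \<Sum>j<n. u i \<omega> * u j \<omega>)" for \<omega>
    by (simp add: T_def sum_distrib_right) (simp add: T_def power2_eq_square sum_product)
  have int_Tu: "integrable M (\<lambda>\<omega>. T \<omega> * u n \<omega>)"
    unfolding Tu by (intro Bochner_Integration.integrable_sum int_uu)
  have int_TT: "integrable M (\<lambda>\<omega>. (T \<omega>)\<^sup>2)"
    unfolding TT by (intro Bochner_Integration.integrable_sum int_uu)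
  have euu: "expectation (\<lambda>\<omega>. u i \<omega> * u j \<omega>) = prob (E i \<inter> E j) - p * p" for i j
  proof -
    have "u i \<omega> * u j \<omega> = indicator (E i \<inter> E j) \<omega> - p * indicator (E i) \<omega> - p * indicator (E j) \<omega> + p * p" for \<omega>
      by (simp add: u_def indicator_inter_arith algebra_simps)
    then have "expectation (\<lambda>\<omega>. u i \<omega> * u j \<omega>) = expectation (\<lambda>\<omega>. indicator (E i \<inter> E j) \<omega> - p * indicator (E i) \<omega> - p * indicator (E j) \<omega> + p * p)"
      by simp
    also have "\<dots> = prob (E i \<inter> E j) - p * prob (E i) - p * prob (E j) + p * p"
      by (simp add: prob_space emeasure_eq_measure)
    finally show ?thesis by (simp add: p)
  qed
  have eq: "(\<Sum>k<Suc n. indicator (E k) \<omega>) - real (Suc n) * p = T \<omega> + u n \<omega>" for \<omega>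
    by (simp add: T_def u_def sum_subtractf algebra_simps)
  have eqn: "(\<Sum>k<n. indicator (E k) \<omega>) - real n * p = T \<omega>" for \<omega>
    by (simp add: T_def u_def sum_subtractf)
  have "expectation (\<lambda>\<omega>. (T \<omega> + u n \<omega>)\<^sup>2) = expectation (\<lambda>\<omega>. (T \<omega>)\<^sup>2 + 2 * (T \<omega> * u n \<omega>) + u n \<omega> * u n \<omega>)"
    by (simp add: power2_sum power2_eq_square algebra_simps)
  also have "\<dots> = expectation (\<lambda>\<omega>. (T \<omega>)\<^sup>2) + 2 * expectation (\<lambda>\<omega>. T \<omega> * u n \<omega>) + expectation (\<lambda>\<omega>. u n \<omega> * u n \<omega>)"
    using int_TT int_Tu int_uu by simp
  also have "expectation (\<lambda>\<omega>. u n \<omega> * u n \<omega>) \<le> p"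
    unfolding euu using p p0 by simp
  also have "expectation (\<lambda>\<omega>. T \<omega> * u n \<omega>) \<le> suminf \<phi> * p"
  proof -
    have "expectation (\<lambda>\<omega>. T \<omega> * u n \<omega>) = (\<Sum>k<n. prob (E k \<inter> E n) - p * p)"
      unfolding Tu by (subst Bochner_Integration.integral_sum) (auto simp: int_uu euu)
    also have "\<dots> \<le> (\<Sum>k<n. p * \<phi> (n - Suc k))"
      using cov by (intro sum_mono) (auto simp: algebra_simps)
    also have "\<dots> = p * (\<Sum>k<n. \<phi> k)"
      by (simp add: sum_distrib_left sum.nat_diff_reindex[of "\<lambda>k. p * \<phi> k"])
    also have "\<dots> \<le> p * suminf \<phi>"
      using p0 \<phi> by (intro mult_left_mono sum_le_suminf) auto
    finally show ?thesis by (simp add: mult.commute)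
  qed
  also have "expectation (\<lambda>\<omega>. (T \<omega>)\<^sup>2) \<le> (1 + 2 * suminf \<phi>) * real n * p"
    using Suc.IH unfolding eqn .
  finally show ?case
    unfolding eq by (simp add: algebra_simps)
qed

lemma gauss_dens_measurable [measurable]: "gauss_dens \<in> borel_measurable borel"
  unfolding gauss_dens_def by measurable

lemma gauss_dens_pos: "0 < gauss_dens y"
  by (simp add: gauss_dens_def)

text \<open>Places events of a family of coordinates in the sigma-field generated by the times in
  \<open>K\<close>; the reindexing \<open>g\<close> accommodates shifted blocks.\<close>

lemma sigma_sets_vimage_restrict:
  assumes X_meas: "\<And>k. X k \<in> measurable M mu"
    and sub: "\<And>i. i \<in> L \<Longrightarrow> g i \<in> K" and B: "B \<in> sets (PiM L (\<lambda>_. mu))"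
  shows "(\<lambda>\<omega>. \<lambda>i\<in>L. X (g i) \<omega>) -` B \<inter> space M \<in>
    sigma_sets (space M) (\<Union>k\<in>K. {X k -` A \<inter> space M | A. A \<in> sets mu})"
proof -
  let ?G = "\<Union>k\<in>K. {X k -` A \<inter> space M |A. A \<in> sets mu}"
  let ?S = "sigma (space M) ?G"
  have G: "?G \<subseteq> Pow (space M)" by auto
  have "X k \<in> measurable ?S mu" if "k \<in> K" for k
  proof (rule measurableI)
    show "X k x \<in> space mu" if "x \<in> space ?S" for x
      using measurable_space[OF X_meas] that by (simp add: space_measure_of[OF G])
    show "X k -` A \<inter> space ?S \<in> sets ?S" if "A \<in> sets mu" for A
      unfolding sets_measure_of[OF G] space_measure_of[OF G]
      using that \<open>k \<in> K\<close> by (intro sigma_sets.Basic) auto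
  qed
  then have "(\<lambda>\<omega>. \<lambda>i\<in>L. X (g i) \<omega>) \<in> measurable ?S (PiM L (\<lambda>_. mu))"
    using sub by (intro measurable_restrict) auto
  from measurable_sets[OF this B] show ?thesis
    unfolding sets_measure_of[OF G] space_measure_of[OF G] .
qed

section \<open>Signal, noise and block observations\<close>

locale noisy_process = prob_space M for M :: "'w measure" +
  fixes mu :: "'x measure" and X :: "int \<Rightarrow> 'w \<Rightarrow> 'x"
    and eps :: "nat \<Rightarrow> 'w \<Rightarrow> real^'l" and fstar :: "'x \<Rightarrow> real^'l" and b :: nat
  assumes X_meas [measurable]: "\<And>k. X k \<in> measurable M mu"
    and stationary: "\<And>h::int. distr M (PiM UNIV (\<lambda>_::int. mu)) (\<lambda>\<omega> k. X (k + h) \<omega>)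
                              = distr M (PiM UNIV (\<lambda>_::int. mu)) (\<lambda>\<omega> k. X k \<omega>)"
    and eps_gauss: "\<And>k. distributed M lborel (eps k) (\<lambda>y. ennreal (gauss_dens y))"
    and eps_indep: "indep_vars (\<lambda>_. lborel) eps UNIV"
    and eps_X_indep: "indep_set (gen_sigma M mu X UNIV)
                        (sigma_sets (space M) (\<Union>k. {eps k -` A \<inter> space M | A. A \<in> sets (lborel :: (real^'l) measure)}))"
    and b_pos: "b \<ge> 1"
    and fstar_meas [measurable]: "fstar \<in> borel_measurable mu"
begin

abbreviation "LN \<equiv> PiM {..<b} (\<lambda>_. lborel :: (real^'l) measure)"
abbreviation "XN \<equiv> PiM {..<b} (\<lambda>_. mu)"
definition "GN = PiM {..<b} (\<lambda>_. density lborel (\<lambda>y::real^'l. ennreal (gauss_dens y)))"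
definition "Xb k \<omega> = (\<lambda>j\<in>{..<b}. X (int (k * b + j)) \<omega>)"
definition "Eb k \<omega> = (\<lambda>j\<in>{..<b}. eps (k * b + j) \<omega>)"
text \<open>States and noise are separate arguments so that the noise can be frozen: for fixed
  \<open>e\<close>, an event of \<open>obs (Xb k \<omega>) e\<close> concerns the states alone, for
  which the mixing coefficients are defined.\<close>

definition "obs x e = (\<lambda>j\<in>{..<b}. fstar (x j) + e j)"
definition "Ob k \<omega> = obs (Xb k \<omega>) (Eb k \<omega>)"

lemma sets_GN [measurable_cong]: "sets GN = sets LN"
  unfolding GN_def by (intro sets_PiM_cong) auto

lemma eps_meas [measurable]: "eps k \<in> borel_measurable M"
  using distributed_measurable[OF eps_gauss[of k]] by simp

lemma Xb_meas [measurable]: "Xb k \<in> measurable M XN"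
  unfolding Xb_def by measurable

lemma Eb_meas [measurable]: "Eb k \<in> measurable M LN"
  unfolding Eb_def by measurable

lemma obs_meas [measurable]: "(\<lambda>p. obs (fst p) (snd p)) \<in> measurable (XN \<Otimes>\<^sub>M LN) LN"
  unfolding obs_def
proof (rule measurable_restrict)
  fix j assume j: "j \<in> {..<b}"
  have 1: "(\<lambda>p. fst p j) \<in> measurable (XN \<Otimes>\<^sub>M LN) mu"
    by (rule measurable_compose[OF measurable_fst measurable_component_singleton[OF j]])
  have 2: "(\<lambda>p. snd p j) \<in> measurable (XN \<Otimes>\<^sub>M LN) lborel"
    by (rule measurable_compose[OF measurable_snd measurable_component_singleton[OF j]])
  have "(\<lambda>p. fstar (fst p j)) \<in> measurable (XN \<Otimes>\<^sub>M LN) borel"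
    by (rule measurable_compose[OF 1 fstar_meas])
  with 2 show "(\<lambda>p. fstar (fst p j) + snd p j) \<in> measurable (XN \<Otimes>\<^sub>M LN) lborel"
    by (simp add: borel_measurable_add)
qed

lemma Ob_meas [measurable]: "Ob k \<in> measurable M LN"
  unfolding Ob_def
  using measurable_compose[OF measurable_Pair[OF Xb_meas Eb_meas] obs_meas] by simp

lemma prob_space_gauss: "prob_space (density lborel (\<lambda>y::real^'l. ennreal (gauss_dens y)))"
  using prob_space_distr[of "eps 0" lborel] distributed_distr_eq_density[OF eps_gauss[of 0]]
  by simp

lemma distr_Eb: "distr M LN (Eb k) = GN"
proof -
  let ?D = "density lborel (\<lambda>y::real^'l. ennreal (gauss_dens y))"
  let ?K = "(\<lambda>j. k * b + j) ` {..<b}"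
  interpret D: prob_space ?D by (rule prob_space_gauss)
  interpret PD: product_sigma_finite "\<lambda>_::nat. ?D" ..
  show ?thesis
    unfolding GN_def
  proof (rule PD.PiM_eqI)
    show "sets (distr M LN (Eb k)) = sets (PiM {..<b} (\<lambda>_. ?D))"
      using sets_GN by (simp add: GN_def)
    fix A :: "nat \<Rightarrow> (real^'l) set" assume "\<And>i. i \<in> {..<b} \<Longrightarrow> A i \<in> sets ?D"
    then have A: "\<And>i. i < b \<Longrightarrow> A i \<in> sets borel" by simp
    have "emeasure (distr M LN (Eb k)) (Pi\<^sub>E {..<b} A) = emeasure M (Eb k -` (Pi\<^sub>E {..<b} A) \<inter> space M)"
      using A by (intro emeasure_distr sets_PiM_I_finite) auto
    also have "Eb k -` (Pi\<^sub>E {..<b} A) \<inter> space M = (\<Inter>m\<in>?K. eps m -` (A (m - k * b)) \<inter> space M)"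
    proof (rule set_eqI)
      fix \<omega>
      have ne: "0 \<in> {..<b}" using b_pos by simp
      have "\<omega> \<in> (\<Inter>m\<in>?K. eps m -` (A (m - k * b)) \<inter> space M) \<longleftrightarrow>
          (\<forall>j\<in>{..<b}. eps (k * b + j) \<omega> \<in> A j \<and> \<omega> \<in> space M)"
        using ne by simp blast
      also have "\<dots> \<longleftrightarrow> (\<forall>j\<in>{..<b}. eps (k * b + j) \<omega> \<in> A j) \<and> \<omega> \<in> space M"
        using ne by blast
      also have "\<dots> \<longleftrightarrow> \<omega> \<in> Eb k -` (Pi\<^sub>E {..<b} A) \<inter> space M"
        by (simp add: Eb_def PiE_iff)
      finally show "\<omega> \<in> Eb k -` (Pi\<^sub>E {..<b} A) \<inter> space M \<longleftrightarrow>
          \<omega> \<in> (\<Inter>m\<in>?K. eps m -` (A (m - k * b)) \<inter> space M)" ..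
    qed
    also have "emeasure M \<dots> = ennreal (\<Prod>m\<in>?K. prob (eps m -` (A (m - k * b)) \<inter> space M))"
      unfolding emeasure_eq_measure using b_pos A
      by (subst indep_varsD[OF eps_indep]) (auto simp: lessThan_empty_iff)
    also have "\<dots> = (\<Prod>m\<in>?K. emeasure M (eps m -` (A (m - k * b)) \<inter> space M))"
      by (simp add: prod_ennreal emeasure_eq_measure)
    also have "\<dots> = (\<Prod>j<b. emeasure M (eps (k * b + j) -` (A j) \<inter> space M))"
      by (subst prod.reindex) (auto simp: inj_on_def)
    also have "\<dots> = (\<Prod>j<b. emeasure ?D (A j))"
    proof (rule prod.cong[OF refl])
      fix j assume "j \<in> {..<b}"
      then show "emeasure M (eps (k * b + j) -` (A j) \<inter> space M) = emeasure ?D (A j)"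
        using A[of j] unfolding distributed_distr_eq_density[OF eps_gauss[of "k * b + j"], symmetric]
        by (subst emeasure_distr) auto
    qed
    finally show "emeasure (distr M LN (Eb k)) (Pi\<^sub>E {..<b} A) = (\<Prod>j<b. emeasure ?D (A j))" .
  qed simp
qed

lemma indep_Eb:
  assumes "i < j" shows "indep_var LN (Eb i) LN (Eb j)"
proof -
  let ?I = "\<lambda>k. {k * b..<k * b + b}"
  have disj: "?I i \<inter> ?I j = {}"
  proof -
    have "i * b + b \<le> j * b" using mult_le_mono1[of "Suc i" j b] assms by simp
    then show ?thesis by auto
  qed
  have ind: "indep_var (PiM (?I i) (\<lambda>_. lborel)) (\<lambda>\<omega>. \<lambda>m\<in>?I i. eps m \<omega>)
         (PiM (?I j) (\<lambda>_. lborel)) (\<lambda>\<omega>. \<lambda>m\<in>?I j. eps m \<omega>)"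
    by (rule indep_var_restrict[OF eps_indep disj]) auto
  have m: "(\<lambda>y. \<lambda>m\<in>{..<b}. y (k * b + m)) \<in> measurable (PiM (?I k) (\<lambda>_. lborel :: (real^'l) measure)) LN" for k
    by (intro measurable_restrict measurable_component_singleton) auto
  have e: "(\<lambda>y. \<lambda>m\<in>{..<b}. y (k * b + m)) \<circ> (\<lambda>\<omega>. \<lambda>m\<in>?I k. eps m \<omega>) = Eb k" for k
    by (auto simp: Eb_def fun_eq_iff restrict_def)
  show ?thesis
    using indep_var_compose[OF ind m[of i] m[of j]] unfolding e .
qed

lemma X_all_meas [measurable]: "(\<lambda>\<omega> k. X k \<omega>) \<in> measurable M (PiM UNIV (\<lambda>_. mu))"
  by (rule measurable_PiM_single') (auto simp: space_PiM PiE_def dest: measurable_space[OF X_meas])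

text \<open>The whole path of the states is kept as the first argument and \<open>V\<close> is any
  variable built from the noise, so that single blocks and pairs of blocks are both covered.\<close>

lemma nn_integral_X_E:
  assumes V: "V \<in> measurable M T"
    and sub: "\<And>A. A \<in> sets T \<Longrightarrow> V -` A \<inter> space M \<in> sigma_sets (space M) (\<Union>k. {eps k -` A \<inter> space M | A. A \<in> sets (lborel :: (real^'l) measure)})"
    and f: "f \<in> borel_measurable (PiM UNIV (\<lambda>_. mu) \<Otimes>\<^sub>M T)"
  shows "(\<integral>\<^sup>+ \<omega>. f ((\<lambda>k. X k \<omega>), V \<omega>) \<partial>M) = (\<integral>\<^sup>+ v. (\<integral>\<^sup>+ \<omega>. f ((\<lambda>k. X k \<omega>), v) \<partial>M) \<partial>distr M T V)"
proof (rule nn_integral_independent_pair[OF X_all_meas V _ f])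
  fix A B assume A: "A \<in> sets (PiM (UNIV :: int set) (\<lambda>_. mu))" and B: "B \<in> sets T"
  have "(\<lambda>\<omega> k. X k \<omega>) -` A \<inter> space M \<in> gen_sigma M mu X UNIV"
    using sigma_sets_vimage_restrict[of X M mu UNIV "\<lambda>i. i" UNIV, OF X_meas _ A]
    by (simp add: restrict_UNIV gen_sigma_def)
  with eps_X_indep sub[OF B]
  show "prob (((\<lambda>\<omega> k. X k \<omega>) -` A \<inter> space M) \<inter> (V -` B \<inter> space M)) =
      prob ((\<lambda>\<omega> k. X k \<omega>) -` A \<inter> space M) * prob (V -` B \<inter> space M)"
    unfolding indep_sets2_eq by blast
qed

lemma Eb_vimage:
  assumes "A \<in> sets LN"
  shows "Eb k -` A \<inter> space M \<in> sigma_sets (space M) (\<Union>k. {eps k -` A \<inter> space M | A. A \<in> sets (lborel :: (real^'l) measure)})"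
proof -
  have "eps j \<in> measurable M lborel" for j by simp
  from sigma_sets_vimage_restrict[of eps M lborel "{..<b}" "\<lambda>j. k * b + j" UNIV A, OF this] assms
  show ?thesis unfolding Eb_def by simp
qed


lemma Eb_pair_vimage:
  assumes "A \<in> sets (LN \<Otimes>\<^sub>M LN)"
  shows "(\<lambda>\<omega>. (Eb i \<omega>, Eb j \<omega>)) -` A \<inter> space M \<in> sigma_sets (space M) (\<Union>k. {eps k -` A \<inter> space M | A. A \<in> sets (lborel :: (real^'l) measure)})"
proof -
  let ?G = "\<Union>k. {eps k -` A \<inter> space M |A. A \<in> sets (lborel :: (real^'l) measure)}"
  have G: "?G \<subseteq> Pow (space M)" by auto
  have "Eb k \<in> measurable (sigma (space M) ?G) LN" for k
  proof (rule measurableI)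
    show "Eb k x \<in> space LN" for x
      by (auto simp: Eb_def space_PiM)
    show "Eb k -` A \<inter> space (sigma (space M) ?G) \<in> sets (sigma (space M) ?G)" if "A \<in> sets LN" for A
      using Eb_vimage[OF that] unfolding sets_measure_of[OF G] space_measure_of[OF G] .
  qed
  then have "(\<lambda>\<omega>. (Eb i \<omega>, Eb j \<omega>)) \<in> measurable (sigma (space M) ?G) (LN \<Otimes>\<^sub>M LN)"
    by measurable
  from measurable_sets[OF this assms] show ?thesis
    unfolding sets_measure_of[OF G] space_measure_of[OF G] .
qed

definition "blk (k::nat) x = (\<lambda>j\<in>{..<b}. x (int (k * b + j)) :: 'x)"

lemma blk_meas [measurable]: "blk k \<in> measurable (PiM UNIV (\<lambda>_. mu)) XN"
  unfolding blk_def by (intro measurable_restrict measurable_component_singleton) auto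

lemma Xb_blk: "Xb k \<omega> = blk k (\<lambda>k. X k \<omega>)"
  by (simp add: Xb_def blk_def)

lemma obs_meas' [measurable (raw)]:
  assumes "f \<in> measurable S XN" "g \<in> measurable S LN"
  shows "(\<lambda>s. obs (f s) (g s)) \<in> measurable S LN"
  using measurable_compose[OF measurable_Pair[OF assms] obs_meas] by simp

lemma GN_prob: "prob_space GN"
  using prob_space_distr[of "Eb 0" LN] distr_Eb by simp

lemma sections_Ob:
  assumes A [measurable]: "A \<in> sets LN"
  shows "emeasure M {\<omega> \<in> space M. Ob k \<omega> \<in> A} =
    (\<integral>\<^sup>+ e. emeasure M {\<omega> \<in> space M. obs (Xb k \<omega>) e \<in> A} \<partial>GN)"
proof -
  have "emeasure M {\<omega> \<in> space M. Ob k \<omega> \<in> A} = (\<integral>\<^sup>+ \<omega>. indicator A (obs (blk k (\<lambda>k. X k \<omega>)) (Eb k \<omega>)) \<partial>M)"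
    unfolding Ob_def[symmetric] Xb_blk[symmetric]
    by (intro nn_integral_pred[symmetric]) (auto simp: indicator_def)
  also have "\<dots> = (\<integral>\<^sup>+ e. (\<integral>\<^sup>+ \<omega>. indicator A (obs (blk k (\<lambda>k. X k \<omega>)) e) \<partial>M) \<partial>GN)"
    unfolding distr_Eb[of k, symmetric]
    by (rule nn_integral_X_E[OF Eb_meas Eb_vimage,
          where f = "\<lambda>p. indicator A (obs (blk k (fst p)) (snd p))", simplified]) measurable
  also have "\<dots> = (\<integral>\<^sup>+ e. emeasure M {\<omega> \<in> space M. obs (Xb k \<omega>) e \<in> A} \<partial>GN)"
  proof (rule nn_integral_cong)
    fix e assume "e \<in> space GN"
    then have [measurable]: "e \<in> space LN" using sets_eq_imp_space_eq[OF sets_GN] by simp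
    show "(\<integral>\<^sup>+ \<omega>. indicator A (obs (blk k (\<lambda>k. X k \<omega>)) e) \<partial>M) = emeasure M {\<omega> \<in> space M. obs (Xb k \<omega>) e \<in> A}"
      unfolding Xb_blk[symmetric]
      by (intro nn_integral_pred) (auto simp: indicator_def)
  qed
  finally show ?thesis .
qed

text \<open>The noises of two distinct blocks have the product law, so they can be frozen at
  independent values \<open>e\<close> and \<open>e'\<close>; the dependence between the blocks is
  then confined to the states.\<close>

lemma sections_Ob_pair:
  assumes A [measurable]: "A \<in> sets LN" and ij: "i < j"
  shows "emeasure M {\<omega> \<in> space M. Ob i \<omega> \<in> A \<and> Ob j \<omega> \<in> A} =
    (\<integral>\<^sup>+ e. (\<integral>\<^sup>+ e'. emeasure M {\<omega> \<in> space M. obs (Xb i \<omega>) e \<in> A \<and> obs (Xb j \<omega>) e' \<in> A} \<partial>GN) \<partial>GN)"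
proof -
  let ?f = "\<lambda>x e e'. indicator A (obs (blk i x) e) * indicator A (obs (blk j x) e') :: ennreal"
  interpret GN: prob_space GN by (rule GN_prob)
  have dist: "distr M (LN \<Otimes>\<^sub>M LN) (\<lambda>\<omega>. (Eb i \<omega>, Eb j \<omega>)) = GN \<Otimes>\<^sub>M GN"
    using indep_Eb[OF ij] unfolding indep_var_distribution_eq distr_Eb by simp
  have "emeasure M {\<omega> \<in> space M. Ob i \<omega> \<in> A \<and> Ob j \<omega> \<in> A} = (\<integral>\<^sup>+ \<omega>. ?f (\<lambda>k. X k \<omega>) (Eb i \<omega>) (Eb j \<omega>) \<partial>M)"
    unfolding Ob_def[symmetric] Xb_blk[symmetric]
    by (intro nn_integral_pred[symmetric]) (auto simp: indicator_def)
  also have "\<dots> = (\<integral>\<^sup>+ p. (\<integral>\<^sup>+ \<omega>. ?f (\<lambda>k. X k \<omega>) (fst p) (snd p) \<partial>M) \<partial>(GN \<Otimes>\<^sub>M GN))"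
    unfolding dist[symmetric]
    by (rule nn_integral_X_E[OF measurable_Pair[OF Eb_meas Eb_meas] Eb_pair_vimage,
          where f = "\<lambda>p. ?f (fst p) (fst (snd p)) (snd (snd p))", simplified fst_conv snd_conv]) measurable
  also have "\<dots> = (\<integral>\<^sup>+ e. (\<integral>\<^sup>+ e'. (\<integral>\<^sup>+ \<omega>. ?f (\<lambda>k. X k \<omega>) e e' \<partial>M) \<partial>GN) \<partial>GN)"
  proof (subst GN.nn_integral_fst[symmetric])
    have [measurable]: "(\<lambda>\<omega> k. X k \<omega>) \<in> measurable M (PiM UNIV (\<lambda>_. mu))"
      by (rule measurable_PiM_single') (auto simp: space_PiM PiE_def dest: measurable_space[OF X_meas])
    show "(\<lambda>p. \<integral>\<^sup>+ \<omega>. ?f (\<lambda>k. X k \<omega>) (fst p) (snd p) \<partial>M) \<in> borel_measurable (GN \<Otimes>\<^sub>M GN)"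
      by measurable
  qed simp
  also have "\<dots> = (\<integral>\<^sup>+ e. (\<integral>\<^sup>+ e'. emeasure M {\<omega> \<in> space M. obs (Xb i \<omega>) e \<in> A \<and> obs (Xb j \<omega>) e' \<in> A} \<partial>GN) \<partial>GN)"
  proof (intro nn_integral_cong)
    fix e e' assume "e \<in> space GN" "e' \<in> space GN"
    then have [measurable]: "e \<in> space LN" "e' \<in> space LN" using sets_eq_imp_space_eq[OF sets_GN] by auto
    show "(\<integral>\<^sup>+ \<omega>. ?f (\<lambda>k. X k \<omega>) e e' \<partial>M) = emeasure M {\<omega> \<in> space M. obs (Xb i \<omega>) e \<in> A \<and> obs (Xb j \<omega>) e' \<in> A}"
      unfolding Xb_blk[symmetric]
      by (intro nn_integral_pred) (auto simp: indicator_def)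
  qed
  finally show ?thesis .
qed


section \<open>Mixing coefficients and covariances of block events\<close>

definition "past_future i = {\<bar>prob (A \<inter> B) / prob A - prob B\<bar> | A B.
   A \<in> gen_sigma M mu X {..0} \<and> B \<in> gen_sigma M mu X {i..} \<and> prob A > 0}"

text \<open>A real \<open>Sup\<close> is informative only for a nonempty set that is bounded above;
  \<open>zero_past_future\<close> and \<open>bdd_past_future\<close> supply both properties.\<close>

lemma phiX_Sup: "phiX M mu X i = Sup (past_future i)"
  by (simp add: phiX_def phi_coef_def past_future_def)

lemma gen_sigma_events: "A \<in> gen_sigma M mu X K \<Longrightarrow> A \<in> events"
  unfolding gen_sigma_def
proof -
  assume "A \<in> sigma_sets (space M) (\<Union>k\<in>K. {X k -` A \<inter> space M |A. A \<in> sets mu})"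
  moreover have "(\<Union>k\<in>K. {X k -` A \<inter> space M |A. A \<in> sets mu}) \<subseteq> sets M"
    using measurable_sets[OF X_meas] by auto
  ultimately show "A \<in> sets M"
    by (meson sets.sigma_sets_subset subsetD)
qed

lemma past_future_le_1:
  assumes "x \<in> past_future i" shows "x \<le> 1"
proof -
  obtain A B where x: "x = \<bar>prob (A \<inter> B) / prob A - prob B\<bar>" and A: "A \<in> events" "prob A > 0"
    using assms gen_sigma_events unfolding past_future_def by blast
  have "prob (A \<inter> B) / prob A \<le> 1"
    using finite_measure_mono[of "A \<inter> B" A] A by (simp add: divide_le_eq)
  moreover have "0 \<le> prob (A \<inter> B) / prob A" by simp
  ultimately show ?thesis
    using prob_le_1[of B] measure_nonneg[of M B] unfolding x by linarith
qed

lemma bdd_past_future: "bdd_above (past_future i)"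
  using past_future_le_1 by (auto intro!: bdd_aboveI)

lemma zero_past_future: "0 \<in> past_future i"
proof -
  have "space M \<in> gen_sigma M mu X K" for K
    unfolding gen_sigma_def by (rule sigma_sets_top)
  then show ?thesis
    unfolding past_future_def by (intro CollectI exI[of _ "space M"]) (simp add: prob_space)
qed

lemma phiX_nonneg: "0 \<le> phiX M mu X i"
  unfolding phiX_Sup by (rule cSup_upper[OF zero_past_future bdd_past_future])

lemma phiX_le_1: "phiX M mu X i \<le> 1"
  unfolding phiX_Sup using zero_past_future past_future_le_1 by (intro cSup_least) auto

text \<open>Multiplying the quotient in the coefficient by \<open>prob A\<close> gives a form that
  also covers null events. The asymmetric factor \<open>prob A\<close> is the source of variances
  linear in the probability.\<close>

lemma past_future_prob_le:
  assumes A: "A \<in> gen_sigma M mu X {..0}" and B: "B \<in> gen_sigma M mu X {i..}"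
  shows "prob (A \<inter> B) \<le> prob A * (prob B + phiX M mu X i)"
proof (cases "prob A = 0")
  case True
  have "prob (A \<inter> B) \<le> prob A"
    using gen_sigma_events[OF A] by (intro finite_measure_mono) auto
  with True show ?thesis by simp
next
  case False
  then have pos: "prob A > 0" by (simp add: zero_less_measure_iff)
  have "\<bar>prob (A \<inter> B) / prob A - prob B\<bar> \<le> phiX M mu X i"
    unfolding phiX_Sup using A B pos
    by (intro cSup_upper bdd_past_future) (auto simp: past_future_def)
  then have "prob (A \<inter> B) / prob A \<le> prob B + phiX M mu X i" by linarith
  with pos show ?thesis by (simp add: divide_le_eq mult.commute)
qed

lemma prob_shift:
  assumes S: "S \<in> sets (PiM UNIV (\<lambda>_. mu))"
  shows "prob {\<omega> \<in> space M. (\<lambda>k. X (k + h) \<omega>) \<in> S} = prob {\<omega> \<in> space M. (\<lambda>k. X k \<omega>) \<in> S}"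
proof -
  have "(\<lambda>\<omega> k. X (k + h) \<omega>) \<in> measurable M (PiM UNIV (\<lambda>_. mu))"
    by (rule measurable_PiM_single') (auto simp: space_PiM PiE_def dest: measurable_space[OF X_meas])
  then have "prob {\<omega> \<in> space M. (\<lambda>k. X (k + h) \<omega>) \<in> S} = measure (distr M (PiM UNIV (\<lambda>_. mu)) (\<lambda>\<omega> k. X (k + h) \<omega>)) S"
    using S by (subst measure_distr) (auto intro!: arg_cong[where f = prob])
  also have "\<dots> = measure (distr M (PiM UNIV (\<lambda>_. mu)) (\<lambda>\<omega> k. X k \<omega>)) S"
    by (simp only: stationary)
  also have "\<dots> = prob {\<omega> \<in> space M. (\<lambda>k. X k \<omega>) \<in> S}"
    using S by (subst measure_distr) (auto intro!: arg_cong[where f = prob])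
  finally show ?thesis .
qed

lemma prob_Xb_eq:
  assumes [measurable]: "B \<in> sets XN"
  shows "prob {\<omega> \<in> space M. Xb k \<omega> \<in> B} = prob {\<omega> \<in> space M. Xb 0 \<omega> \<in> B}"
proof -
  have S: "{x \<in> space (PiM UNIV (\<lambda>_. mu)). blk 0 x \<in> B} \<in> sets (PiM UNIV (\<lambda>_. mu))"
    by measurable
  have sp: "(\<lambda>k. X (k + h) \<omega>) \<in> space (PiM UNIV (\<lambda>_. mu))" if "\<omega> \<in> space M" for h \<omega>
    using measurable_space[OF X_meas that] by (auto simp: space_PiM)
  have "blk 0 (\<lambda>j. X (j + int (k * b)) \<omega>) = Xb k \<omega>" for \<omega>
    by (simp add: blk_def Xb_def fun_eq_iff add.commute)
  with prob_shift[OF S, of "int (k * b)"] sp[of _ "int (k * b)"] sp[of _ 0] show ?thesis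
    by (simp add: Xb_blk cong: conj_cong Collect_cong)
qed

lemma prob_Xb_pair_le:
  assumes ij: "i < j" and B [measurable]: "B \<in> sets XN" and B' [measurable]: "B' \<in> sets XN"
  shows "prob {\<omega> \<in> space M. Xb i \<omega> \<in> B \<and> Xb j \<omega> \<in> B'} \<le>
    prob {\<omega> \<in> space M. Xb 0 \<omega> \<in> B} * (prob {\<omega> \<in> space M. Xb 0 \<omega> \<in> B'} + phiX M mu X (int (Suc (j - i - 1))))"
proof -
  \<comment> \<open>The shift moves the last time of block \<open>i\<close> to \<open>0\<close>, so
    that block \<open>i\<close> belongs to the past. Block \<open>j\<close> then starts at
    \<open>(j - i - 1) * b + 1\<close>, which is at least \<open>j - i\<close> because
    \<open>b \<ge> 1\<close>; a lag counted in blocks may thus replace the lag in time.\<close>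
  define h where "h = int (i * b + b - 1)"
  have hb: "h = int (i * b) + int b - 1" using b_pos by (simp add: h_def of_nat_diff)
  define P where "P = (\<lambda>\<omega>. \<lambda>m\<in>{..<b}. X (int (i * b + m) - h) \<omega>)"
  define Q where "Q = (\<lambda>\<omega>. \<lambda>m\<in>{..<b}. X (int (j * b + m) - h) \<omega>)"
  let ?PB = "P -` B \<inter> space M" and ?QB = "Q -` B' \<inter> space M"
  have sp: "(\<lambda>k. X (k + h) \<omega>) \<in> space (PiM UNIV (\<lambda>_. mu))" if "\<omega> \<in> space M" for h \<omega>
    using measurable_space[OF X_meas that] by (auto simp: space_PiM)
  have PB: "?PB \<in> gen_sigma M mu X {..0}"
    unfolding P_def gen_sigma_def
    by (rule sigma_sets_vimage_restrict[OF X_meas _ B]) (auto simp: hb)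
  have QB: "?QB \<in> gen_sigma M mu X {int (Suc (j - i - 1))..}"
    unfolding Q_def gen_sigma_def
  proof (rule sigma_sets_vimage_restrict[OF X_meas _ B'])
    fix m
    obtain d where "j = Suc (i + d)" using less_imp_Suc_add[OF ij] by blast
    then have "int (j * b) - int (i * b) - int b = int ((j - i - 1) * b)"
      by (simp add: algebra_simps)
    moreover have "j - i - 1 \<le> (j - i - 1) * b" using b_pos by simp
    ultimately have "int (j - i - 1) \<le> int (j * b) - int (i * b) - int b" by linarith
    then show "int (j * b + m) - h \<in> {int (Suc (j - i - 1))..}"
      by (simp add: hb)
  qed
  have P: "blk i (\<lambda>k. X (k + - h) \<omega>) = P \<omega>" and Q: "blk j (\<lambda>k. X (k + - h) \<omega>) = Q \<omega>" for \<omega>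
    by (simp_all add: blk_def P_def Q_def fun_eq_iff)
  have sets: "{x \<in> space (PiM UNIV (\<lambda>_. mu)). blk i x \<in> B \<and> blk j x \<in> B'} \<in> sets (PiM UNIV (\<lambda>_. mu))"
    "{x \<in> space (PiM UNIV (\<lambda>_. mu)). blk i x \<in> B} \<in> sets (PiM UNIV (\<lambda>_. mu))"
    "{x \<in> space (PiM UNIV (\<lambda>_. mu)). blk j x \<in> B'} \<in> sets (PiM UNIV (\<lambda>_. mu))"
    by measurable
  note shift = sets[THEN prob_shift[where h = "- h"]]
  have eqs: "prob (?PB \<inter> ?QB) = prob {\<omega> \<in> space M. Xb i \<omega> \<in> B \<and> Xb j \<omega> \<in> B'}"
    "prob ?PB = prob {\<omega> \<in> space M. Xb i \<omega> \<in> B}"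
    "prob ?QB = prob {\<omega> \<in> space M. Xb j \<omega> \<in> B'}"
  proof -
    have m: "{\<omega> \<in> space M. (\<lambda>k. X (k + h') \<omega>) \<in> {x \<in> space (PiM UNIV (\<lambda>_. mu)). R x}} =
        {\<omega> \<in> space M. R (\<lambda>k. X (k + h') \<omega>)}" for R h'
      by (intro Collect_cong conj_cong refl) (simp only: mem_Collect_eq sp simp_thms)
    have m0: "{\<omega> \<in> space M. (\<lambda>k. X k \<omega>) \<in> {x \<in> space (PiM UNIV (\<lambda>_. mu)). R x}} =
        {\<omega> \<in> space M. R (\<lambda>k. X k \<omega>)}" for R
      using sp[of _ 0] by (intro Collect_cong conj_cong refl) (simp only: mem_Collect_eq add_0_right simp_thms)
    have "?PB \<inter> ?QB = {\<omega> \<in> space M. P \<omega> \<in> B \<and> Q \<omega> \<in> B'}" "?PB = {\<omega> \<in> space M. P \<omega> \<in> B}"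
      "?QB = {\<omega> \<in> space M. Q \<omega> \<in> B'}" by auto
    then show "prob (?PB \<inter> ?QB) = prob {\<omega> \<in> space M. Xb i \<omega> \<in> B \<and> Xb j \<omega> \<in> B'}"
      "prob ?PB = prob {\<omega> \<in> space M. Xb i \<omega> \<in> B}"
      "prob ?QB = prob {\<omega> \<in> space M. Xb j \<omega> \<in> B'}"
      using shift[unfolded m m0] unfolding P Q Xb_blk by simp_all
  qed
  show ?thesis
    using past_future_prob_le[OF PB QB] unfolding eqs prob_Xb_eq[OF B, of i] prob_Xb_eq[OF B', of j] .
qed

lemma obs_section_sets:
  assumes [measurable]: "A \<in> sets LN" "e \<in> space LN"
  shows "{x \<in> space XN. obs x e \<in> A} \<in> sets XN"
  by measurable

lemma obs_section_eq:
  "{\<omega> \<in> space M. Xb k \<omega> \<in> {x \<in> space XN. obs x e \<in> A}} = {\<omega> \<in> space M. obs (Xb k \<omega>) e \<in> A}"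
  using measurable_space[OF Xb_meas] by auto

lemma prob_Ob_eq:
  assumes A: "A \<in> sets LN"
  shows "prob {\<omega> \<in> space M. Ob k \<omega> \<in> A} = prob {\<omega> \<in> space M. Ob 0 \<omega> \<in> A}"
proof -
  have "emeasure M {\<omega> \<in> space M. obs (Xb k \<omega>) e \<in> A} = emeasure M {\<omega> \<in> space M. obs (Xb 0 \<omega>) e \<in> A}"
    if "e \<in> space GN" for e
    using prob_Xb_eq[OF obs_section_sets[OF A, of e], of k] that
    unfolding obs_section_eq by (simp add: emeasure_eq_measure sets_eq_imp_space_eq[OF sets_GN])
  then have "emeasure M {\<omega> \<in> space M. Ob k \<omega> \<in> A} = emeasure M {\<omega> \<in> space M. Ob 0 \<omega> \<in> A}"
    unfolding sections_Ob[OF A] by (intro nn_integral_cong) simp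
  then show ?thesis by (simp add: emeasure_eq_measure)
qed

text \<open>
  For fixed noise an event of the observations is an event of the \<open>X\<close>-blocks; integrating over the independent
  noise of the two blocks preserves the bilinear bound.
\<close>
lemma prob_Ob_pair_le:
  assumes A [measurable]: "A \<in> sets LN" and ij: "i < j"
  shows "prob {\<omega> \<in> space M. Ob i \<omega> \<in> A \<and> Ob j \<omega> \<in> A} \<le>
    prob {\<omega> \<in> space M. Ob 0 \<omega> \<in> A} * (prob {\<omega> \<in> space M. Ob 0 \<omega> \<in> A} + phiX M mu X (int (Suc (j - i - 1))))"
proof -
  define \<phi> where "\<phi> = phiX M mu X (int (Suc (j - i - 1)))"
  have \<phi>: "0 \<le> \<phi>" unfolding \<phi>_def by (rule phiX_nonneg)
  let ?a = "\<lambda>e. emeasure M {\<omega> \<in> space M. obs (Xb 0 \<omega>) e \<in> A}"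
  interpret GN: prob_space GN by (rule GN_prob)
  have am [measurable]: "?a \<in> borel_measurable GN"
  proof -
    have "(\<lambda>e. emeasure M (Pair e -` {p \<in> space (GN \<Otimes>\<^sub>M M). obs (Xb 0 (snd p)) (fst p) \<in> A})) \<in> borel_measurable GN"
      by (rule measurable_emeasure_Pair) measurable
    moreover have "Pair e -` {p \<in> space (GN \<Otimes>\<^sub>M M). obs (Xb 0 (snd p)) (fst p) \<in> A} = {\<omega> \<in> space M. obs (Xb 0 \<omega>) e \<in> A}"
      if "e \<in> space GN" for e using that by (auto simp: space_pair_measure)
    ultimately show ?thesis by (simp cong: measurable_cong)
  qed
  have "emeasure M {\<omega> \<in> space M. Ob i \<omega> \<in> A \<and> Ob j \<omega> \<in> A} =
    (\<integral>\<^sup>+ e. (\<integral>\<^sup>+ e'. emeasure M {\<omega> \<in> space M. obs (Xb i \<omega>) e \<in> A \<and> obs (Xb j \<omega>) e' \<in> A} \<partial>GN) \<partial>GN)"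
    by (rule sections_Ob_pair[OF A ij])
  also have "\<dots> \<le> (\<integral>\<^sup>+ e. (\<integral>\<^sup>+ e'. ?a e * (?a e' + ennreal \<phi>) \<partial>GN) \<partial>GN)"
  proof (intro nn_integral_mono)
    fix e e' assume "e \<in> space GN" "e' \<in> space GN"
    then have e: "e \<in> space LN" "e' \<in> space LN" using sets_eq_imp_space_eq[OF sets_GN] by auto
    have eq: "{\<omega> \<in> space M. Xb i \<omega> \<in> {x \<in> space XN. obs x e \<in> A} \<and> Xb j \<omega> \<in> {x \<in> space XN. obs x e' \<in> A}}
       = {\<omega> \<in> space M. obs (Xb i \<omega>) e \<in> A \<and> obs (Xb j \<omega>) e' \<in> A}"
      using measurable_space[OF Xb_meas] by auto
    have "prob {\<omega> \<in> space M. obs (Xb i \<omega>) e \<in> A \<and> obs (Xb j \<omega>) e' \<in> A} \<le>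
       prob {\<omega> \<in> space M. obs (Xb 0 \<omega>) e \<in> A} * (prob {\<omega> \<in> space M. obs (Xb 0 \<omega>) e' \<in> A} + \<phi>)"
      using prob_Xb_pair_le[OF ij obs_section_sets[OF A e(1)] obs_section_sets[OF A e(2)]]
      unfolding eq obs_section_eq \<phi>_def .
    then show "emeasure M {\<omega> \<in> space M. obs (Xb i \<omega>) e \<in> A \<and> obs (Xb j \<omega>) e' \<in> A} \<le> ?a e * (?a e' + ennreal \<phi>)"
      unfolding emeasure_eq_measure using \<phi>
      by (simp add: ennreal_mult[symmetric] ennreal_plus[symmetric] del: ennreal_plus)
  qed
  also have "\<dots> = (\<integral>\<^sup>+ e. ?a e \<partial>GN) * ((\<integral>\<^sup>+ e. ?a e \<partial>GN) + ennreal \<phi>)"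
    by (simp add: nn_integral_cmult nn_integral_multc nn_integral_add GN.emeasure_space_1)
  also have "\<dots> = ennreal (prob {\<omega> \<in> space M. Ob 0 \<omega> \<in> A} * (prob {\<omega> \<in> space M. Ob 0 \<omega> \<in> A} + \<phi>))"
    unfolding sections_Ob[OF A, symmetric] unfolding emeasure_eq_measure using \<phi>
    by (simp add: ennreal_mult)
  finally show ?thesis
    using \<phi> unfolding emeasure_eq_measure \<phi>_def[symmetric]
    by (subst (asm) ennreal_le_iff) auto
qed

text \<open>Each coefficient lies between 0 and 1 and is thus at most its root, so H1 yields
  summability of the coefficients themselves, the form that enters the covariance bound.\<close>

lemma summable_phiX:
  assumes sum: "summable (\<lambda>i. sqrt (phiX M mu X (int (Suc i))))"
  shows "summable (\<lambda>i. phiX M mu X (int (Suc i)))"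
proof (rule summable_comparison_test'[OF sum])
  fix n
  have "phiX M mu X (int (Suc n)) = sqrt (phiX M mu X (int (Suc n))) * sqrt (phiX M mu X (int (Suc n)))"
    using phiX_nonneg by simp
  also have "\<dots> \<le> sqrt (phiX M mu X (int (Suc n))) * 1"
    using phiX_le_1 phiX_nonneg by (intro mult_left_mono) auto
  finally show "norm (phiX M mu X (int (Suc n))) \<le> sqrt (phiX M mu X (int (Suc n)))"
    using phiX_nonneg by simp
qed

lemma variance_Ob_le:
  assumes A [measurable]: "A \<in> sets LN"
    and sum: "summable (\<lambda>i. sqrt (phiX M mu X (int (Suc i))))"
  shows "expectation (\<lambda>\<omega>. ((\<Sum>k<n. indicator A (Ob k \<omega>)) - real n * expectation (\<lambda>\<omega>. indicator A (Ob 0 \<omega>)))\<^sup>2)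
     \<le> (1 + 2 * (\<Sum>i. phiX M mu X (int (Suc i)))) * real n * expectation (\<lambda>\<omega>. indicator A (Ob 0 \<omega>))"
proof -
  let ?E = "\<lambda>k. {\<omega> \<in> space M. Ob k \<omega> \<in> A}"
  note sum' = summable_phiX[OF sum]
  have ind: "indicator A (Ob k \<omega>) = (indicator (?E k) \<omega> :: real)" if "\<omega> \<in> space M" for k \<omega>
    using that by (simp add: indicator_def)
  have p: "expectation (\<lambda>\<omega>. indicator A (Ob 0 \<omega>)) = prob (?E 0)"
  proof -
    have "expectation (\<lambda>\<omega>. indicator A (Ob 0 \<omega>)) = expectation (indicator (?E 0) :: _ \<Rightarrow> real)"
      by (intro Bochner_Integration.integral_cong refl) (simp add: ind)
    then show ?thesis by simp
  qed
  have "expectation (\<lambda>\<omega>. ((\<Sum>k<n. indicator A (Ob k \<omega>)) - real n * prob (?E 0))\<^sup>2) =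
     expectation (\<lambda>\<omega>. ((\<Sum>k<n. indicator (?E k) \<omega>) - real n * prob (?E 0))\<^sup>2)"
    by (intro Bochner_Integration.integral_cong refl) (simp add: ind)
  also have "\<dots> \<le> (1 + 2 * (\<Sum>i. phiX M mu X (int (Suc i)))) * real n * prob (?E 0)"
  proof (rule variance_sum_events_le)
    show "prob (?E k) = prob (?E 0)" for k by (rule prob_Ob_eq[OF A])
    show "prob (?E i \<inter> ?E j) \<le> prob (?E 0) * (prob (?E 0) + phiX M mu X (int (Suc (j - i - 1))))" if "i < j" for i j
    proof -
      have "?E i \<inter> ?E j = {\<omega> \<in> space M. Ob i \<omega> \<in> A \<and> Ob j \<omega> \<in> A}" by auto
      with prob_Ob_pair_le[OF A that] show ?thesis by simp
    qed
  qed (use sum' phiX_nonneg in auto)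
  finally show ?thesis unfolding p .
qed

end

section \<open>Moment integrals of exponential families\<close>

lemma abs_exp_remainder_le: "\<bar>exp u - 1 - u\<bar> \<le> u\<^sup>2 * exp \<bar>u\<bar>" for u :: real
proof -
  obtain t where t: "\<bar>t\<bar> \<le> \<bar>u\<bar>" "exp u = (\<Sum>m<2. u ^ m / fact m) + exp t / fact 2 * u ^ 2"
    using Maclaurin_exp_le[of u 2] by auto
  have "\<bar>exp u - 1 - u\<bar> = exp t / 2 * u\<^sup>2"
    using t(2) by (simp add: numeral_2_eq_2 abs_mult)
  also have "\<dots> \<le> exp \<bar>u\<bar> * u\<^sup>2"
  proof (rule mult_right_mono)
    have "exp t \<le> exp \<bar>u\<bar>" using t(1) by simp
    then show "exp t / 2 \<le> exp \<bar>u\<bar>"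
      using exp_ge_zero[of "\<bar>u\<bar>"] by linarith
  qed simp
  finally show ?thesis by (simp add: mult.commute)
qed

text \<open>The difference quotient minus the candidate derivative is at most a constant times
  \<open>\<bar>h\<bar>\<close>, by the second-order remainder of the exponential; boundedness of
  \<open>a\<close> makes this remainder uniform in \<open>x\<close>.\<close>

lemma has_real_derivative_integral_exp:
  fixes u a :: "'x \<Rightarrow> real"
  assumes u: "integrable N u" and a [measurable]: "a \<in> borel_measurable N"
    and a_le: "\<And>x. x \<in> space N \<Longrightarrow> \<bar>a x\<bar> \<le> R"
  shows "((\<lambda>s. LINT x|N. u x * exp (s * a x)) has_real_derivative (LINT x|N. u x * a x * exp (t * a x))) (at t)"
proof -
  note [measurable] = borel_measurable_integrable[OF u]
  have bd: "\<bar>exp (s * a x)\<bar> \<le> exp (\<bar>s\<bar> * R)" if "x \<in> space N" for s x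
  proof -
    have "s * a x \<le> \<bar>s\<bar> * \<bar>a x\<bar>" by (metis abs_ge_self abs_mult)
    also have "\<dots> \<le> \<bar>s\<bar> * R" using a_le[OF that] by (intro mult_left_mono) auto
    finally show ?thesis by simp
  qed
  have int_e: "integrable N (\<lambda>x. u x * exp (s * a x))" for s
  proof (rule Bochner_Integration.integrable_bound)
    show "integrable N (\<lambda>x. u x * exp (\<bar>s\<bar> * R))" using u by simp
    show "AE x in N. norm (u x * exp (s * a x)) \<le> norm (u x * exp (\<bar>s\<bar> * R))"
      using bd[of _ s] by (auto simp: abs_mult intro!: AE_I2 mult_left_mono)
  qed measurable
  have int_ae: "integrable N (\<lambda>x. u x * a x * exp (s * a x))" for s
  proof (rule Bochner_Integration.integrable_bound)
    show "integrable N (\<lambda>x. u x * R * exp (\<bar>s\<bar> * R))" using u by simp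
    show "AE x in N. norm (u x * a x * exp (s * a x)) \<le> norm (u x * R * exp (\<bar>s\<bar> * R))"
    proof (rule AE_I2)
      fix x assume x: "x \<in> space N"
      have "\<bar>a x\<bar> \<le> \<bar>R\<bar>" using a_le[OF x] by linarith
      then have "abs (u x) * abs (a x) * abs (exp (s * a x)) \<le> abs (u x) * abs R * exp (abs s * R)"
        by (intro mult_mono bd[OF x] mult_nonneg_nonneg) auto
      then show "norm (u x * a x * exp (s * a x)) \<le> norm (u x * R * exp (\<bar>s\<bar> * R))"
        by (simp add: abs_mult)
    qed
  qed measurable
  \<comment> \<open>The factors bound, uniformly in \<open>x\<close>, the square of
    \<open>a x\<close>, the value \<open>exp (t * a x)\<close>, and
    \<open>exp \<bar>h * a x\<bar>\<close> from the remainder, the last one for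
    \<open>\<bar>h\<bar> \<le> 1\<close>.\<close>
  define C where "C = R\<^sup>2 * exp (abs t * R) * exp (abs R) * (LINT x|N. abs (u x))"
  define q where "q h = ((LINT x|N. u x * exp ((t + h) * a x)) - (LINT x|N. u x * exp (t * a x))) / h
    - (LINT x|N. u x * a x * exp (t * a x))" for h
  have q_le: "\<bar>q h\<bar> \<le> C * \<bar>h\<bar>" if h: "h \<noteq> 0" "\<bar>h\<bar> \<le> 1" for h
  proof -
    have q_eq: "q h = (LINT x|N. u x * exp (t * a x) * ((exp (h * a x) - 1 - h * a x) / h))"
    proof -
      have "q h = (LINT x|N. (u x * exp ((t + h) * a x) - u x * exp (t * a x)) / h - u x * a x * exp (t * a x))"
        unfolding q_def using int_e int_ae by simp
      also have "\<dots> = (LINT x|N. u x * exp (t * a x) * ((exp (h * a x) - 1 - h * a x) / h))"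
      proof (intro Bochner_Integration.integral_cong refl)
        fix x
        have "(v * (e * e') - v * e) / h - v * c * e = v * e * ((e' - 1 - h * c) / h)" for v e e' c :: real
          using h by (simp add: field_simps)
        then show "(u x * exp ((t + h) * a x) - u x * exp (t * a x)) / h - u x * a x * exp (t * a x) =
            u x * exp (t * a x) * ((exp (h * a x) - 1 - h * a x) / h)"
          by (simp only: distrib_right exp_add)
      qed
      finally show ?thesis .
    qed
    have "\<bar>q h\<bar> \<le> (LINT x|N. \<bar>u x * exp (t * a x) * ((exp (h * a x) - 1 - h * a x) / h)\<bar>)"
      unfolding q_eq by (rule integral_abs_bound)
    also have "\<dots> \<le> (LINT x|N. abs (u x) * (R\<^sup>2 * exp (abs t * R) * exp (abs R) * abs h))"
    proof (rule integral_mono')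
      show "integrable N (\<lambda>x. abs (u x) * (R\<^sup>2 * exp (abs t * R) * exp (abs R) * abs h))"
        using u by simp
      fix x assume x: "x \<in> space N"
      have aR: "\<bar>a x\<bar> \<le> \<bar>R\<bar>" using a_le[OF x] by linarith
      have "\<bar>h * a x\<bar> \<le> 1 * \<bar>R\<bar>" unfolding abs_mult using h aR by (intro mult_mono) auto
      then have e: "exp \<bar>h * a x\<bar> \<le> exp \<bar>R\<bar>" by simp
      have a2: "(a x)\<^sup>2 \<le> R\<^sup>2" using aR abs_le_square_iff by blast
      define r where "r = (exp (h * a x) - 1 - h * a x) / h"
      have "abs r \<le> (h * a x)\<^sup>2 * exp (abs (h * a x)) / abs h"
        unfolding r_def using abs_exp_remainder_le[of "h * a x"] by (simp add: divide_right_mono)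
      also have "\<dots> = abs h * ((a x)\<^sup>2 * exp (abs (h * a x)))"
      proof -
        have "(h * a x)\<^sup>2 = abs h * abs h * (a x)\<^sup>2" by (simp add: power_mult_distrib power2_eq_square)
        moreover have "y * y * p * e / y = y * (p * e)" if "y \<noteq> 0" for y p e :: real
          using that by simp
        moreover have "abs h \<noteq> 0" using h by simp
        ultimately show ?thesis by (simp only:)
      qed
      also have "\<dots> \<le> abs h * (R\<^sup>2 * exp (abs R))"
        using a2 e by (intro mult_left_mono mult_mono) auto
      finally have r: "abs r \<le> abs h * (R\<^sup>2 * exp (abs R))" .
      have "abs (u x) * (abs (exp (t * a x)) * abs r) \<le> abs (u x) * (exp (abs t * R) * (abs h * (R\<^sup>2 * exp (abs R))))"
        by (intro mult_left_mono mult_mono bd[OF x] r) simp_all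
      then show "abs (u x * exp (t * a x) * ((exp (h * a x) - 1 - h * a x) / h)) \<le>
          abs (u x) * (R\<^sup>2 * exp (abs t * R) * exp (abs R) * abs h)"
        unfolding r_def[symmetric] by (simp add: abs_mult mult_ac)
    qed (intro mult_nonneg_nonneg zero_le_power2 exp_ge_zero abs_ge_zero)
    also have "\<dots> = C * \<bar>h\<bar>" by (simp add: C_def)
    finally show ?thesis .
  qed
  have "(q \<longlongrightarrow> 0) (at 0)"
  proof (rule Lim_null_comparison)
    have "\<forall>\<^sub>F h in at 0. h \<noteq> (0::real) \<and> \<bar>h\<bar> \<le> 1"
      unfolding eventually_at by (rule exI[of _ 1]) (auto simp: dist_real_def)
    then show "\<forall>\<^sub>F h in at 0. norm (q h) \<le> C * \<bar>h\<bar>"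
      by (rule eventually_mono) (use q_le in auto)
    have "((\<lambda>h. C * \<bar>h\<bar>) \<longlongrightarrow> C * \<bar>0\<bar>) (at 0)"
      by (intro tendsto_intros)
    then show "((\<lambda>h. C * \<bar>h\<bar>) \<longlongrightarrow> 0) (at 0)" by simp
  qed
  then have "((\<lambda>h. q h + (LINT x|N. u x * a x * exp (t * a x))) \<longlongrightarrow> 0 + (LINT x|N. u x * a x * exp (t * a x))) (at 0)"
    by (intro tendsto_add tendsto_const)
  then show ?thesis
    unfolding DERIV_def q_def by simp
qed

text \<open>For \<open>A \<subseteq> J\<close> this is the mixed derivative, in the directions
  \<open>A\<close>, of the weighted Laplace transform given by \<open>A = {}\<close>: each
  differentiation in \<open>z j\<close> brings down one factor \<open>a j\<close>.\<close>

definition exp_moment_int :: "'x measure \<Rightarrow> ('x \<Rightarrow> real) \<Rightarrow> ('j \<Rightarrow> 'x \<Rightarrow> real) \<Rightarrow> 'j set \<Rightarrow> 'j set \<Rightarrow> ('j \<Rightarrow> real) \<Rightarrow> real" where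
  "exp_moment_int N w a J A z = (LINT x|N. w x * (\<Prod>i\<in>A. a i x) * exp (\<Sum>i\<in>J. z i * a i x))"

locale bounded_exponents = 
  fixes N :: "'x measure" and w :: "'x \<Rightarrow> real" and a :: "'j \<Rightarrow> 'x \<Rightarrow> real" and J :: "'j set" and R :: real
  assumes sf: "sigma_finite_measure N"
    and w_int: "integrable N w" and w_nonneg: "\<And>x. x \<in> space N \<Longrightarrow> 0 \<le> w x"
    and w_pos: "0 < (LINT x|N. w x)"
    and a_meas [measurable]: "\<And>i. i \<in> J \<Longrightarrow> a i \<in> borel_measurable N"
    and a_bound: "\<And>i x. i \<in> J \<Longrightarrow> x \<in> space N \<Longrightarrow> \<bar>a i x\<bar> \<le> R"
    and fin: "finite J" and R0: "0 \<le> R"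
begin

abbreviation "Q \<equiv> exp_moment_int N w a J"

lemma prod_bound: "A \<subseteq> J \<Longrightarrow> x \<in> space N \<Longrightarrow> \<bar>\<Prod>i\<in>A. a i x\<bar> \<le> R ^ card A"
  using prod_mono[of A "\<lambda>i. \<bar>a i x\<bar>" "\<lambda>_. R"] a_bound by (auto simp: abs_prod)

lemma sum_bound: "K \<subseteq> J \<Longrightarrow> x \<in> space N \<Longrightarrow> \<bar>\<Sum>i\<in>K. z i * a i x\<bar> \<le> (\<Sum>i\<in>J. \<bar>z i\<bar> * R)"
proof -
  assume K: "K \<subseteq> J" and x: "x \<in> space N"
  have "\<bar>\<Sum>i\<in>K. z i * a i x\<bar> \<le> (\<Sum>i\<in>K. \<bar>z i\<bar> * R)"
    using a_bound x K by (intro order_trans[OF sum_abs] sum_mono) (auto simp: abs_mult intro!: mult_left_mono)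
  also have "\<dots> \<le> (\<Sum>i\<in>J. \<bar>z i\<bar> * R)"
    using K R0 fin by (intro sum_mono2) auto
  finally show ?thesis .
qed

lemma w_meas [measurable]: "w \<in> borel_measurable N"
  using w_int by auto

lemma integrable_moment:
  assumes "A \<subseteq> J" "K \<subseteq> J"
  shows "integrable N (\<lambda>x. w x * (\<Prod>i\<in>A. a i x) * exp (\<Sum>i\<in>K. z i * a i x))"
proof (rule Bochner_Integration.integrable_bound)
  let ?E = "exp (\<Sum>i\<in>J. \<bar>z i\<bar> * R)"
  show "integrable N (\<lambda>x. w x * (R ^ card A * ?E))" using w_int by simp
  show "(\<lambda>x. w x * (\<Prod>i\<in>A. a i x) * exp (\<Sum>i\<in>K. z i * a i x)) \<in> borel_measurable N"
    using assms a_meas by (intro borel_measurable_times borel_measurable_prod measurable_compose[OF _ borel_measurable_exp] borel_measurable_sum w_meas borel_measurable_const) auto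
  show "AE x in N. norm (w x * (\<Prod>i\<in>A. a i x) * exp (\<Sum>i\<in>K. z i * a i x)) \<le> norm (w x * (R ^ card A * ?E))"
  proof (rule AE_I2)
    fix x assume x: "x \<in> space N"
    have "\<bar>\<Prod>i\<in>A. a i x\<bar> * exp (\<Sum>i\<in>K. z i * a i x) \<le> R ^ card A * ?E"
      using prod_bound[OF assms(1) x] sum_bound[OF assms(2) x, of z] R0 by (intro mult_mono) auto
    then have "abs (w x) * (abs (\<Prod>i\<in>A. a i x) * exp (\<Sum>i\<in>K. z i * a i x)) \<le> abs (w x) * (R ^ card A * ?E)"
      by (intro mult_left_mono) auto
    then show "norm (w x * (\<Prod>i\<in>A. a i x) * exp (\<Sum>i\<in>K. z i * a i x)) \<le> norm (w x * (R ^ card A * ?E))"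
      using R0 by (simp add: abs_mult mult.assoc)
  qed
qed

lemma Q_deriv:
  assumes j: "j \<in> J" "A \<subseteq> J" "j \<notin> A"
  shows "((\<lambda>s. Q A (z(j := s))) has_real_derivative Q (insert j A) (z(j := t))) (at t)"
proof -
  let ?u = "\<lambda>x. w x * (\<Prod>i\<in>A. a i x) * exp (\<Sum>i\<in>J - {j}. z i * a i x)"
  have S: "(\<Sum>i\<in>J. (z(j := s)) i * a i x) = s * a j x + (\<Sum>i\<in>J - {j}. z i * a i x)" for s x
    using j fin by (subst sum.remove[of J j]) (auto intro!: sum.cong)
  have A: "finite A" using j fin finite_subset by blast
  have 1: "Q A (z(j := s)) = (LINT x|N. ?u x * exp (s * a j x))" for s
    unfolding exp_moment_int_def S by (simp add: exp_add mult_ac)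
  have 2: "Q (insert j A) (z(j := t)) = (LINT x|N. ?u x * a j x * exp (t * a j x))"
    unfolding exp_moment_int_def S using j A by (simp add: exp_add mult_ac)
  show ?thesis
    unfolding 1 2
    by (rule has_real_derivative_integral_exp[where R = R])
       (use j a_bound in \<open>auto intro!: integrable_moment\<close>)
qed

lemma Q_bound:
  assumes A: "A \<subseteq> J" shows "\<bar>Q A z\<bar> \<le> R ^ card A * Q {} z"
proof -
  have "\<bar>Q A z\<bar> \<le> (LINT x|N. \<bar>w x * (\<Prod>i\<in>A. a i x) * exp (\<Sum>i\<in>J. z i * a i x)\<bar>)"
    unfolding exp_moment_int_def by (rule integral_abs_bound)
  also have "\<dots> \<le> (LINT x|N. R ^ card A * (w x * (\<Prod>i\<in>{}. a i x) * exp (\<Sum>i\<in>J. z i * a i x)))"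
  proof (rule integral_mono)
    show "integrable N (\<lambda>x. \<bar>w x * (\<Prod>i\<in>A. a i x) * exp (\<Sum>i\<in>J. z i * a i x)\<bar>)"
      using A by (intro integrable_abs integrable_moment) auto
    show "integrable N (\<lambda>x. R ^ card A * (w x * (\<Prod>i\<in>{}. a i x) * exp (\<Sum>i\<in>J. z i * a i x)))"
      by (intro integrable_mult_right integrable_moment) auto
    fix x assume x: "x \<in> space N"
    have "\<bar>\<Prod>i\<in>A. a i x\<bar> * (w x * exp (\<Sum>i\<in>J. z i * a i x)) \<le> R ^ card A * (w x * exp (\<Sum>i\<in>J. z i * a i x))"
      using prod_bound[OF A x] w_nonneg[OF x] by (intro mult_right_mono) auto
    then show "\<bar>w x * (\<Prod>i\<in>A. a i x) * exp (\<Sum>i\<in>J. z i * a i x)\<bar> \<le> R ^ card A * (w x * (\<Prod>i\<in>{}. a i x) * exp (\<Sum>i\<in>J. z i * a i x))"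
      using w_nonneg[OF x] by (simp add: abs_mult mult_ac)
  qed
  finally show ?thesis by (simp add: exp_moment_int_def)
qed

lemma Q_pos: "0 < Q {} z"
proof -
  let ?e = "exp (- (\<Sum>i\<in>J. \<bar>z i\<bar> * R))"
  have "0 < ?e * (LINT x|N. w x)" using w_pos by simp
  also have "\<dots> = (LINT x|N. ?e * w x)" by simp
  also have "\<dots> \<le> Q {} z"
    unfolding exp_moment_int_def
  proof (rule integral_mono)
    show "integrable N (\<lambda>x. w x * (\<Prod>i\<in>{}. a i x) * exp (\<Sum>i\<in>J. z i * a i x))"
      by (rule integrable_moment) auto
    fix x assume x: "x \<in> space N"
    have "?e \<le> exp (\<Sum>i\<in>J. z i * a i x)" using sum_bound[OF subset_refl x, of z] by simp
    then show "?e * w x \<le> w x * (\<Prod>i\<in>{}. a i x) * exp (\<Sum>i\<in>J. z i * a i x)"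
      using w_nonneg[OF x] by (simp add: mult.commute mult_left_mono)
  qed (use w_int in auto)
  finally show ?thesis .
qed

lemma Q_meas:
  assumes A: "A \<subseteq> J" shows "Q A \<in> borel_measurable (PiM UNIV (\<lambda>_. borel))"
proof -
  interpret sigma_finite_measure N by (rule sf)
  have zm: "(\<lambda>p. fst p i) \<in> borel_measurable (PiM UNIV (\<lambda>_. borel) \<Otimes>\<^sub>M N)" for i :: 'j
    by (rule measurable_compose[OF measurable_fst, where g = "\<lambda>t. t i"]) simp
  show ?thesis
    unfolding exp_moment_int_def
    by (rule borel_measurable_lebesgue_integral, unfold case_prod_unfold,
        intro borel_measurable_times borel_measurable_prod measurable_compose[OF _ borel_measurable_exp]
          borel_measurable_sum zm measurable_compose[OF measurable_snd w_meas] measurable_compose[OF measurable_snd a_meas])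
       (use A in auto)
qed

sublocale moment_family J R Q
  by unfold_locales (use R0 Q_deriv Q_bound Q_pos Q_meas fin in auto)

end

text \<open>Each bound is relative to its own positive function \<open>Q1 {}\<close> or
  \<open>Q2 {}\<close>, so it may be raised to the common \<open>R\<close> before the two are
  added.\<close>

lemma moment_family_add:
  assumes "moment_family J R1 Q1" "moment_family J R2 Q2" "R1 \<le> R" "R2 \<le> R"
  shows "moment_family J R (\<lambda>A z. Q1 A z + Q2 A z)"
proof -
  interpret q1: moment_family J R1 Q1 by fact
  interpret q2: moment_family J R2 Q2 by fact
  have R: "0 \<le> R" using assms q1.R_nonneg by linarith
  show ?thesis
  proof
    fix A z assume A: "A \<subseteq> J"
    have "\<bar>Q1 A z\<bar> \<le> R ^ card A * Q1 {} z"
      using q1.Q_bound[OF A, of z] power_mono[OF assms(3) q1.R_nonneg, of "card A"] q1.Q_pos[of z]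
      by (meson less_imp_le mult_right_mono order_trans)
    moreover have "\<bar>Q2 A z\<bar> \<le> R ^ card A * Q2 {} z"
      using q2.Q_bound[OF A, of z] power_mono[OF assms(4) q2.R_nonneg, of "card A"] q2.Q_pos[of z]
      by (meson less_imp_le mult_right_mono order_trans)
    ultimately show "\<bar>Q1 A z + Q2 A z\<bar> \<le> R ^ card A * (Q1 {} z + Q2 {} z)"
      by (simp add: distrib_left)
  qed (auto intro!: DERIV_add q1.Q_deriv q2.Q_deriv add_pos_pos q1.Q_pos q2.Q_pos borel_measurable_add q1.Q_meas q2.Q_meas R q1.fin_J)
qed

text \<open>Completing the square: multiplied by \<open>exp (c * y $ j)\<close>, the Gaussian
  density becomes, up to the factor \<open>exp (c\<^sup>2 / 2)\<close>, its translate by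
  \<open>c\<close> along axis \<open>j\<close>, and Lebesgue measure is translation
  invariant.\<close>

lemma (in noisy_process) integrable_exp_eps:
  "integrable M (\<lambda>\<omega>. exp (c * eps k \<omega> $ j))"
proof -
  let ?g = "gauss_dens :: real^'l \<Rightarrow> real" and ?v = "axis j c :: real^'l"
  have "integrable M (\<lambda>\<omega>. 1 :: real)" by simp
  then have g: "integrable lborel ?g"
    using distributed_integrable[OF eps_gauss[of k], of "\<lambda>_. 1 :: real"] gauss_dens_pos
    by (auto intro: less_imp_le)
  have "integrable (distr lborel borel ((+) (- ?v))) ?g"
    using g by (simp add: lborel_distr_plus)
  then have shift: "integrable lborel (\<lambda>y. ?g (- ?v + y))"
    by (subst (asm) integrable_distr_eq) auto
  have "?g y * exp (c * y $ j) = exp (c\<^sup>2 / 2) * ?g (- ?v + y)" for y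
  proof -
    have "(norm (- ?v + y))\<^sup>2 = (norm y)\<^sup>2 - 2 * (c * y $ j) + c\<^sup>2"
    proof -
      have "(norm (y - ?v))\<^sup>2 = (norm y)\<^sup>2 - 2 * inner y ?v + (norm ?v)\<^sup>2"
        by (simp only: power2_norm_eq_inner inner_diff_left inner_diff_right inner_commute)
      moreover have "inner y ?v = c * y $ j" by (simp add: inner_axis mult.commute)
      moreover have "(norm ?v)\<^sup>2 = c\<^sup>2" unfolding power2_norm_eq_inner inner_axis by (simp add: axis_def power2_eq_square)
      ultimately show ?thesis by simp
    qed
    then have "- (norm y)\<^sup>2 / 2 + c * y $ j = c\<^sup>2 / 2 + - (norm (- ?v + y))\<^sup>2 / 2"
      by (simp add: field_simps)
    then have "exp (- (norm y)\<^sup>2 / 2) * exp (c * y $ j) = exp (c\<^sup>2 / 2) * exp (- (norm (- ?v + y))\<^sup>2 / 2)"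
      by (simp only: exp_add[symmetric])
    then show ?thesis by (simp add: gauss_dens_def mult_ac)
  qed
  then have "integrable lborel (\<lambda>y. ?g y * exp (c * y $ j))"
    using shift by simp
  moreover have "(\<lambda>y::real^'l. exp (c * y $ j)) \<in> borel_measurable lborel" by measurable
  ultimately show ?thesis
    using distributed_integrable[OF eps_gauss[of k], of "\<lambda>y. exp (c * y $ j)"] gauss_dens_pos
    by (auto intro: less_imp_le)
qed

section \<open>Hellinger distance and Gaussian shifts\<close>

text \<open>Here \<open>s\<close> will be the root of a density ratio. For
  \<open>u = sqrt ((1 + s\<^sup>2) / 2)\<close>, the bound \<open>ln u \<le> u - 1\<close> gives
  \<open>2 * ln u \<le> u\<^sup>2 - 1 - (u - 1)\<^sup>2\<close>. From
  \<open>u\<^sup>2 - 1 = (s - 1) * (s + 1) / 2\<close> and \<open>u + 1 \<le> 2 * (s + 1)\<close>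
  follows \<open>\<bar>u - 1\<bar> \<ge> \<bar>s - 1\<bar> / 4\<close>, the origin of 16.\<close>

lemma ln_mean_le:
  fixes s :: real
  assumes s: "0 \<le> s"
  shows "ln ((1 + s\<^sup>2) / 2) \<le> (s\<^sup>2 - 1) / 2 - (s - 1)\<^sup>2 / 16"
proof -
  define u where "u = sqrt ((1 + s\<^sup>2) / 2)"
  have u0: "0 < u" and u2: "u\<^sup>2 = (1 + s\<^sup>2) / 2"
    by (auto simp: u_def add_pos_nonneg)
  have "u\<^sup>2 \<le> (1 + s)\<^sup>2"
    unfolding u2 using s by (simp add: power2_sum)
  then have us: "u \<le> 1 + s" by (rule power2_le_imp_le) (use s in simp)
  have "\<bar>s - 1\<bar> / 4 \<le> \<bar>u - 1\<bar>"
  proof -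
    have "(u - 1) * (u + 1) = (s - 1) * (s + 1) / 2"
      using u2 by (simp add: power2_eq_square algebra_simps)
    then have "\<bar>(u - 1) * (u + 1)\<bar> = \<bar>(s - 1) * (s + 1) / 2\<bar>" by (rule arg_cong)
    moreover have "\<bar>(u - 1) * (u + 1)\<bar> = \<bar>u - 1\<bar> * (u + 1)" using u0 by (simp add: abs_mult)
    moreover have "\<bar>(s - 1) * (s + 1) / 2\<bar> = \<bar>s - 1\<bar> * (s + 1) / 2" using s by (simp add: abs_mult)
    moreover have "\<bar>u - 1\<bar> * (u + 1) \<le> \<bar>u - 1\<bar> * (2 * (s + 1))"
      using us s by (intro mult_left_mono) auto
    ultimately have "\<bar>s - 1\<bar> / 4 * (s + 1) \<le> \<bar>u - 1\<bar> * (s + 1)" by linarith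
    then show ?thesis by (rule mult_right_le_imp_le) (use s in simp)
  qed
  then have u1: "(s - 1)\<^sup>2 / 16 \<le> (u - 1)\<^sup>2"
    using power_mono[of "\<bar>s - 1\<bar> / 4" "\<bar>u - 1\<bar>" 2] by (simp add: power_divide)
  have "ln ((1 + s\<^sup>2) / 2) = 2 * ln u"
    unfolding u2[symmetric] using u0 by (simp add: ln_realpow)
  also have "\<dots> \<le> 2 * (u - 1)" using ln_le_minus_one[OF u0] by simp
  also have "\<dots> = u\<^sup>2 - 1 - (u - 1)\<^sup>2" by (simp add: power2_eq_square algebra_simps)
  also have "\<dots> = (s\<^sup>2 - 1) / 2 - (u - 1)\<^sup>2" unfolding u2 by (simp add: field_simps)
  also have "\<dots> \<le> (s\<^sup>2 - 1) / 2 - (s - 1)\<^sup>2 / 16"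
    using u1 by (rule diff_left_mono)
  finally show ?thesis .
qed

text \<open>The pointwise bound at \<open>s = sqrt (p x) / sqrt (q x)\<close> is multiplied by
  \<open>q x\<close>. Its part \<open>(p x - q x) / 2\<close> integrates to zero because both masses
  are one, and the quadratic part becomes the Hellinger integrand.\<close>

lemma integral_ln_mean_le:
  fixes p q :: "'a \<Rightarrow> real"
  assumes p: "integrable N p" "\<And>x. x \<in> space N \<Longrightarrow> 0 \<le> p x" "(LINT x|N. p x) = 1"
    and q: "integrable N q" "\<And>x. x \<in> space N \<Longrightarrow> 0 < q x" "(LINT x|N. q x) = 1"
    and int: "integrable N (\<lambda>x. q x * ln ((p x + q x) / (2 * q x)))"
  shows "(LINT x|N. q x * ln ((p x + q x) / (2 * q x))) \<le> - (LINT x|N. (sqrt (p x) - sqrt (q x))\<^sup>2) / 16"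
proof -
  have [measurable]: "p \<in> borel_measurable N" "q \<in> borel_measurable N" using p(1) q(1) by auto
  have hint: "integrable N (\<lambda>x. (sqrt (p x) - sqrt (q x))\<^sup>2)"
  proof (rule Bochner_Integration.integrable_bound)
    show "integrable N (\<lambda>x. p x + q x)" using p(1) q(1) by simp
    show "AE x in N. norm ((sqrt (p x) - sqrt (q x))\<^sup>2) \<le> norm (p x + q x)"
    proof (rule AE_I2)
      fix x assume "x \<in> space N"
      then have pq: "0 \<le> p x" "0 < q x" using p q by auto
      have "(sqrt (p x) - sqrt (q x))\<^sup>2 = p x + q x - 2 * (sqrt (p x) * sqrt (q x))"
        using pq by (simp add: power2_diff)
      moreover have "0 \<le> sqrt (p x) * sqrt (q x)" using pq by simp
      moreover have "norm (p x + q x) = p x + q x" using pq by simp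
      moreover have "norm ((sqrt (p x) - sqrt (q x))\<^sup>2) = (sqrt (p x) - sqrt (q x))\<^sup>2" by simp
      ultimately show "norm ((sqrt (p x) - sqrt (q x))\<^sup>2) \<le> norm (p x + q x)"
        by linarith
    qed
  qed measurable
  have "(LINT x|N. q x * ln ((p x + q x) / (2 * q x))) \<le> (LINT x|N. (p x - q x) / 2 - (sqrt (p x) - sqrt (q x))\<^sup>2 / 16)"
  proof (rule integral_mono[OF int])
    show "integrable N (\<lambda>x. (p x - q x) / 2 - (sqrt (p x) - sqrt (q x))\<^sup>2 / 16)"
      using p(1) q(1) hint by simp
    fix x assume "x \<in> space N"
    then have pq: "0 \<le> p x" "0 < q x" using p q by auto
    define s where "s = sqrt (p x) / sqrt (q x)"
    have s2: "s\<^sup>2 = p x / q x" using pq by (simp add: s_def power_divide)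
    have e: "(1 + s\<^sup>2) / 2 = (p x + q x) / (2 * q x)" unfolding s2 using pq by (simp add: field_simps)
    have "q x * ln ((1 + s\<^sup>2) / 2) \<le> q x * ((s\<^sup>2 - 1) / 2 - (s - 1)\<^sup>2 / 16)"
      using pq by (intro mult_left_mono ln_mean_le) (auto simp: s_def)
    moreover have "q x * (s\<^sup>2 - 1) = p x - q x" unfolding s2 using pq by (simp add: field_simps)
    moreover have "q x * (s - 1)\<^sup>2 = (sqrt (p x) - sqrt (q x))\<^sup>2"
    proof -
      have "q x * (s - 1)\<^sup>2 = (sqrt (q x) * (s - 1))\<^sup>2" using pq by (simp add: power_mult_distrib)
      also have "sqrt (q x) * (s - 1) = sqrt (p x) - sqrt (q x)" using pq by (simp add: s_def field_simps)
      finally show ?thesis .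
    qed
    ultimately show "q x * ln ((p x + q x) / (2 * q x)) \<le> (p x - q x) / 2 - (sqrt (p x) - sqrt (q x))\<^sup>2 / 16"
      unfolding e by (simp add: right_diff_distrib)
  qed
  also have "\<dots> = - (LINT x|N. (sqrt (p x) - sqrt (q x))\<^sup>2) / 16"
    using p q hint by simp
  finally show ?thesis .
qed

text \<open>Scalar coordinates indexed by \<open>(k, j)\<close> allow differentiation in one real
  variable at a time. The padding by \<open>0\<close> supplies the support condition of
  \<open>concentrated_process\<close>.\<close>

definition flat :: "nat \<Rightarrow> (nat \<Rightarrow> real^'l) \<Rightarrow> nat \<times> 'l \<Rightarrow> real" where
  "flat b y = (\<lambda>(k, j). if k < b then y k $ j else 0)"

text \<open>
  Expanding the square in the Gaussian density of \<open>y k - f (x k)\<close> leaves the weight \<open>tilt b f \<nu>\<close> and the exponential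
  of the bilinear form in \<open>flat b y\<close> and \<open>coord f\<close>.
\<close>
definition tilt :: "nat \<Rightarrow> ('x \<Rightarrow> real^'l) \<Rightarrow> ((nat \<Rightarrow> 'x) \<Rightarrow> real) \<Rightarrow> (nat \<Rightarrow> 'x) \<Rightarrow> real" where
  "tilt b f \<nu> x = \<nu> x * exp (- (\<Sum>k<b. (norm (f (x k)))\<^sup>2) / 2)"

definition coord :: "('x \<Rightarrow> real^'l) \<Rightarrow> nat \<times> 'l \<Rightarrow> (nat \<Rightarrow> 'x) \<Rightarrow> real" where
  "coord f = (\<lambda>(k, j) x. f (x k) $ j)"

lemma flat_measurable [measurable]:
  "flat b \<in> measurable (PiM {..<b} (\<lambda>_. lborel)) (PiM UNIV (\<lambda>_. borel))"
proof (rule measurable_PiM_single')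
  fix i :: "nat \<times> 'a"
  obtain k j where i: "i = (k, j)" by (cases i)
  show "(\<lambda>y. flat b y i) \<in> borel_measurable (PiM {..<b} (\<lambda>_. lborel :: (real^'a) measure))"
  proof (cases "k < b")
    case True
    have "(\<lambda>y. y k) \<in> measurable (PiM {..<b} (\<lambda>_. lborel :: (real^'a) measure)) lborel"
      using True by (intro measurable_component_singleton) auto
    then have "(\<lambda>y. y k $ j) \<in> borel_measurable (PiM {..<b} (\<lambda>_. lborel :: (real^'a) measure))"
      by (rule measurable_compose[where g = "\<lambda>v. v $ j"]) measurable
    with True show ?thesis by (simp add: i flat_def)
  qed (simp add: i flat_def)
qed (auto simp: space_PiM)

lemma gauss_dens_le: "gauss_dens (y :: real^'l) \<le> (2 * pi) powr (- real CARD('l) / 2)"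
  unfolding gauss_dens_def by (intro mult_left_le) auto

lemma nn_integral_lborel_shift:
  fixes c :: "'a :: euclidean_space"
  assumes [measurable]: "f \<in> borel_measurable borel"
  shows "(\<integral>\<^sup>+ y. f (c + y) \<partial>lborel) = (\<integral>\<^sup>+ y. f y \<partial>lborel)"
  by (subst (2) lborel_distr_plus[of c, symmetric]) (simp add: nn_integral_distr)

lemma shift_preimage_borel:
  fixes c :: "'a :: euclidean_space"
  assumes "A \<in> sets borel" shows "{e. c + e \<in> A} \<in> sets borel"
proof -
  have "(\<lambda>e. c + e) \<in> borel_measurable borel" by measurable
  from measurable_sets[OF this assms] show ?thesis by (simp add: vimage_def)
qed

interpretation vec_lborel: product_sigma_finite "\<lambda>_::nat. lborel :: (real^'l) measure"
  by standard

locale noisy_density = noisy_process M mu X eps fstar b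
  for M :: "'w measure" and mu :: "'x measure" and X eps and fstar :: "'x \<Rightarrow> real^'l" and b +
  assumes mu_sf: "sigma_finite_measure mu"
begin

lemma psf_mu: "product_sigma_finite (\<lambda>_::nat. mu)"
  by (simp add: product_sigma_finite_def mu_sf)

lemma sf_XN: "sigma_finite_measure XN"
  using product_sigma_finite.sigma_finite[OF psf_mu, of "{..<b}"] by simp

lemma sf_LN: "sigma_finite_measure LN"
  using vec_lborel.sigma_finite[of "{..<b}"] by simp

lemma shift_meas: "(\<lambda>e. \<lambda>k\<in>{..<b}. c k + e k) \<in> measurable LN LN" for c :: "nat \<Rightarrow> real^'l"
proof (rule measurable_restrict)
  fix k assume "k \<in> {..<b}"
  then have "(\<lambda>e. e k) \<in> measurable LN lborel" by (rule measurable_component_singleton)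
  then have "(\<lambda>e. e k) \<in> borel_measurable LN" by simp
  then have "(\<lambda>e. c k + e k) \<in> borel_measurable LN" by (intro borel_measurable_add borel_measurable_const)
  then show "(\<lambda>e. c k + e k) \<in> measurable LN lborel" by simp
qed

lemma comp_meas: "k < b \<Longrightarrow> (\<lambda>e. e k) \<in> borel_measurable LN"
  using measurable_component_singleton[of k "{..<b}" "\<lambda>_. lborel :: (real^'l) measure"] by simp

text \<open>Both sides agree on boxes with the product of the Gaussian laws centred at the
  \<open>c k\<close>; with \<open>c k = f (x k)\<close> this is the law of a block of observations
  given its states.\<close>

lemma distr_shift_GN:
  fixes c :: "nat \<Rightarrow> real^'l"
  shows "distr GN LN (\<lambda>e. \<lambda>k\<in>{..<b}. c k + e k) = density LN (\<lambda>y. ennreal (\<Prod>k<b. gauss_dens (y k - c k)))"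
proof -
  let ?D = "\<lambda>k. density lborel (\<lambda>y::real^'l. ennreal (gauss_dens (y - c k)))"
  let ?G = "density lborel (\<lambda>y::real^'l. ennreal (gauss_dens y))"
  have gi: "(\<integral>\<^sup>+ y. ennreal (gauss_dens (y :: real^'l)) \<partial>lborel) = 1"
    using prob_space.emeasure_space_1[OF prob_space_gauss] by (simp add: emeasure_density)
  have ps: "prob_space (?D k)" for k
    by (rule prob_spaceI) (use nn_integral_lborel_shift[of "\<lambda>y. ennreal (gauss_dens y)" "- c k"] gi in \<open>simp add: emeasure_density\<close>)
  interpret D: product_sigma_finite ?D
    by (simp add: product_sigma_finite_def ps prob_space_imp_sigma_finite)
  interpret G: prob_space ?G by (rule prob_space_gauss)
  interpret PG: product_sigma_finite "\<lambda>_::nat. ?G" ..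
  have sm [measurable]: "(\<lambda>e. \<lambda>k\<in>{..<b}. c k + e k) \<in> measurable GN LN"
    by (subst measurable_cong_sets[OF sets_GN refl]) (rule shift_meas)
  have "distr GN LN (\<lambda>e. \<lambda>k\<in>{..<b}. c k + e k) = PiM {..<b} ?D"
  proof (rule D.PiM_eqI)
    show "sets (distr GN LN (\<lambda>e. \<lambda>k\<in>{..<b}. c k + e k)) = sets (PiM {..<b} ?D)"
      unfolding sets_distr sets_density by (rule sets_PiM_cong) auto
    fix A :: "nat \<Rightarrow> (real^'l) set" assume "\<And>i. i \<in> {..<b} \<Longrightarrow> A i \<in> sets (?D i)"
    then have A [measurable]: "\<And>i. i < b \<Longrightarrow> A i \<in> sets borel" by simp
    have PA: "Pi\<^sub>E {..<b} A \<in> sets LN" using A by (intro sets_PiM_I_finite) auto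
    have vim: "(\<lambda>e. \<lambda>k\<in>{..<b}. c k + e k) -` (Pi\<^sub>E {..<b} A) \<inter> space GN = Pi\<^sub>E {..<b} (\<lambda>k. {e. c k + e \<in> A k})"
    proof (rule set_eqI)
      fix e :: "nat \<Rightarrow> real^'l"
      have 1: "e \<in> space GN \<longleftrightarrow> e \<in> extensional {..<b}"
        unfolding GN_def space_PiM PiE_def by simp
      have 2: "(\<lambda>k\<in>{..<b}. c k + e k) \<in> Pi\<^sub>E {..<b} A \<longleftrightarrow> (\<forall>k<b. c k + e k \<in> A k)"
        unfolding PiE_iff by auto
      have 3: "e \<in> Pi\<^sub>E {..<b} (\<lambda>k. {e. c k + e \<in> A k}) \<longleftrightarrow> (\<forall>k<b. c k + e k \<in> A k) \<and> e \<in> extensional {..<b}"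
        unfolding PiE_iff by auto
      show "e \<in> (\<lambda>e. \<lambda>k\<in>{..<b}. c k + e k) -` (Pi\<^sub>E {..<b} A) \<inter> space GN \<longleftrightarrow>
          e \<in> Pi\<^sub>E {..<b} (\<lambda>k. {e. c k + e \<in> A k})"
        unfolding Int_iff vimage_eq 1 2 3 ..
    qed
    have "emeasure (distr GN LN (\<lambda>e. \<lambda>k\<in>{..<b}. c k + e k)) (Pi\<^sub>E {..<b} A) =
        emeasure GN (Pi\<^sub>E {..<b} (\<lambda>k. {e. c k + e \<in> A k}))"
      unfolding vim[symmetric] by (rule emeasure_distr[OF sm PA])
    also have "\<dots> = (\<Prod>k<b. emeasure ?G {e. c k + e \<in> A k})"
      unfolding GN_def
    proof (rule PG.emeasure_PiM)
      fix k assume "k \<in> {..<b}"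
      then have "A k \<in> sets borel" using A by simp
      then show "{e. c k + e \<in> A k} \<in> sets ?G" by (simp add: shift_preimage_borel)
    qed simp
    also have "\<dots> = (\<Prod>k<b. emeasure (?D k) (A k))"
    proof (rule prod.cong[OF refl])
      fix k assume "k \<in> {..<b}"
      then have Ak [measurable]: "A k \<in> sets borel" using A by simp
      note [measurable] = shift_preimage_borel[OF Ak, of "c k"]
      have "emeasure ?G {e. c k + e \<in> A k} = (\<integral>\<^sup>+ e. ennreal (gauss_dens ((c k + e) - c k)) * indicator (A k) (c k + e) \<partial>lborel)"
        by (subst emeasure_density) (auto intro!: nn_integral_cong simp: indicator_def)
      also have "\<dots> = (\<integral>\<^sup>+ y. ennreal (gauss_dens (y - c k)) * indicator (A k) y \<partial>lborel)"
        by (rule nn_integral_lborel_shift) measurable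
      also have "\<dots> = emeasure (?D k) (A k)"
        by (subst emeasure_density) auto
      finally show "emeasure ?G {e. c k + e \<in> A k} = emeasure (?D k) (A k)" .
    qed
    finally show "emeasure (distr GN LN (\<lambda>e. \<lambda>k\<in>{..<b}. c k + e k)) (Pi\<^sub>E {..<b} A) = (\<Prod>i<b. emeasure (?D i) (A i))" .
  qed simp
  moreover have "density LN (\<lambda>y. ennreal (\<Prod>k<b. gauss_dens (y k - c k))) = PiM {..<b} ?D"
  proof (rule D.PiM_eqI)
    show "sets (density LN (\<lambda>y. ennreal (\<Prod>k<b. gauss_dens (y k - c k)))) = sets (PiM {..<b} ?D)"
      unfolding sets_distr sets_density by (rule sets_PiM_cong) auto
    fix A :: "nat \<Rightarrow> (real^'l) set" assume "\<And>i. i \<in> {..<b} \<Longrightarrow> A i \<in> sets (?D i)"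
    then have A [measurable]: "\<And>i. i < b \<Longrightarrow> A i \<in> sets borel" by simp
    have PA: "Pi\<^sub>E {..<b} A \<in> sets LN" using A by (intro sets_PiM_I_finite) auto
    have gm: "(\<lambda>y. ennreal (\<Prod>k<b. gauss_dens (y k - c k))) \<in> borel_measurable LN"
      using comp_meas by measurable
    have "emeasure (density LN (\<lambda>y. ennreal (\<Prod>k<b. gauss_dens (y k - c k)))) (Pi\<^sub>E {..<b} A) =
       (\<integral>\<^sup>+ y. ennreal (\<Prod>k<b. gauss_dens (y k - c k)) * indicator (Pi\<^sub>E {..<b} A) y \<partial>LN)"
      by (rule emeasure_density[OF gm PA])
    also have "\<dots> = (\<integral>\<^sup>+ y. (\<Prod>k<b. ennreal (gauss_dens (y k - c k)) * indicator (A k) (y k)) \<partial>LN)"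
    proof (rule nn_integral_cong)
      fix y assume y: "y \<in> space LN"
      show "ennreal (\<Prod>k<b. gauss_dens (y k - c k)) * indicator (Pi\<^sub>E {..<b} A) y =
          (\<Prod>k<b. ennreal (gauss_dens (y k - c k)) * indicator (A k) (y k))"
      proof (cases "y \<in> Pi\<^sub>E {..<b} A")
        case True
        then show ?thesis
          by (simp add: PiE_iff prod_ennreal less_imp_le[OF gauss_dens_pos])
      next
        case False
        then obtain k where "k < b" "y k \<notin> A k" using y by (auto simp: space_PiM PiE_iff)
        then have "(\<Prod>k<b. ennreal (gauss_dens (y k - c k)) * indicator (A k) (y k)) = 0"
          by (intro prod_zero) (auto intro!: bexI[of _ k])
        with False show ?thesis by simp
      qed
    qed
    also have "\<dots> = (\<Prod>k<b. (\<integral>\<^sup>+ y. ennreal (gauss_dens (y - c k)) * indicator (A k) y \<partial>lborel))"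
      using A by (intro vec_lborel.product_nn_integral_prod) auto
    also have "\<dots> = (\<Prod>k<b. emeasure (?D k) (A k))"
      using A by (intro prod.cong refl) (auto simp: emeasure_density)
    finally show "emeasure (density LN (\<lambda>y. ennreal (\<Prod>k<b. gauss_dens (y k - c k)))) (Pi\<^sub>E {..<b} A) = (\<Prod>i<b. emeasure (?D i) (A i))" .
  qed simp
  ultimately show ?thesis by simp
qed

end

section \<open>Densities of the blocks\<close>

context noisy_density
begin

lemma joint_gauss_meas:
  fixes f :: "'x \<Rightarrow> real^'l"
  assumes f: "f \<in> borel_measurable mu"
  shows "(\<lambda>p. \<Prod>k<b. gauss_dens (snd p k - f (fst p k))) \<in> borel_measurable (XN \<Otimes>\<^sub>M LN)"
proof (rule borel_measurable_prod)
  fix k assume k: "k \<in> {..<b}"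
  have "(\<lambda>p. snd p k) \<in> borel_measurable (XN \<Otimes>\<^sub>M LN)"
    using comp_meas[of k] k by (intro measurable_compose[OF measurable_snd]) auto
  moreover have "(\<lambda>p. f (fst p k)) \<in> borel_measurable (XN \<Otimes>\<^sub>M LN)"
    by (rule measurable_compose[OF measurable_compose[OF measurable_fst measurable_component_singleton[OF k]] f])
  ultimately show "(\<lambda>p. gauss_dens (snd p k - f (fst p k))) \<in> borel_measurable (XN \<Otimes>\<^sub>M LN)"
    by (intro measurable_compose[OF borel_measurable_diff gauss_dens_measurable])
qed

lemma integrable_density:
  assumes "prob_density mu b \<nu>"
  shows "integrable XN \<nu>" "(LINT x|XN. \<nu> x) = 1"
proof -
  have m: "\<nu> \<in> borel_measurable XN" and n: "\<And>x. x \<in> space XN \<Longrightarrow> 0 \<le> \<nu> x"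
    and i: "(\<integral>\<^sup>+ x. ennreal (\<nu> x) \<partial>XN) = 1"
    using assms unfolding prob_density_def by auto
  show "integrable XN \<nu>"
    using m n i by (intro integrableI_nonneg) (auto intro!: AE_I2)
  show "(LINT x|XN. \<nu> x) = 1"
    using m n i by (subst integral_eq_nn_integral) (auto intro!: AE_I2)
qed

lemma gauss_prod_bounds:
  fixes v :: "nat \<Rightarrow> real^'l"
  shows "0 \<le> (\<Prod>k<b. gauss_dens (v k))" "(\<Prod>k<b. gauss_dens (v k)) \<le> ((2 * pi) powr (- real CARD('l) / 2)) ^ b"
proof -
  show "0 \<le> (\<Prod>k<b. gauss_dens (v k))"
    by (intro prod_nonneg) (auto intro: less_imp_le gauss_dens_pos)
  have "(\<Prod>k<b. gauss_dens (v k)) \<le> (\<Prod>k<b. (2 * pi) powr (- real CARD('l) / 2))"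
    by (intro prod_mono conjI gauss_dens_le) (auto intro: less_imp_le gauss_dens_pos)
  then show "(\<Prod>k<b. gauss_dens (v k)) \<le> ((2 * pi) powr (- real CARD('l) / 2)) ^ b" by simp
qed

lemma integrable_p_dens_integrand:
  fixes f :: "'x \<Rightarrow> real^'l"
  assumes f: "f \<in> borel_measurable mu" and \<nu>: "prob_density mu b \<nu>"
  shows "integrable XN (\<lambda>x. \<nu> x * (\<Prod>k<b. gauss_dens (y k - f (x k))))"
proof (rule Bochner_Integration.integrable_bound)
  let ?C = "((2 * pi) powr (- real CARD('l) / 2)) ^ b"
  show "integrable XN (\<lambda>x. \<nu> x * ?C)" using integrable_density[OF \<nu>] by simp
  have "(\<lambda>x. \<Prod>k<b. gauss_dens (y k - f (x k))) \<in> borel_measurable XN"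
  proof (rule borel_measurable_prod)
    fix k assume k: "k \<in> {..<b}"
    have "(\<lambda>x. f (x k)) \<in> borel_measurable XN"
      by (rule measurable_compose[OF measurable_component_singleton[OF k] f])
    then show "(\<lambda>x. gauss_dens (y k - f (x k))) \<in> borel_measurable XN"
      by (intro measurable_compose[OF borel_measurable_diff gauss_dens_measurable]) auto
  qed
  then show "(\<lambda>x. \<nu> x * (\<Prod>k<b. gauss_dens (y k - f (x k)))) \<in> borel_measurable XN"
    using integrable_density[OF \<nu>] by (intro borel_measurable_times) auto
  show "AE x in XN. norm (\<nu> x * (\<Prod>k<b. gauss_dens (y k - f (x k)))) \<le> norm (\<nu> x * ?C)"
  proof (rule AE_I2)
    fix x
    have "\<bar>\<Prod>k<b. gauss_dens (y k - f (x k))\<bar> \<le> \<bar>?C\<bar>"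
      using gauss_prod_bounds(1)[of "\<lambda>k. y k - f (x k)"] gauss_prod_bounds(2)[of "\<lambda>k. y k - f (x k)"] by linarith
    then show "norm (\<nu> x * (\<Prod>k<b. gauss_dens (y k - f (x k)))) \<le> norm (\<nu> x * ?C)"
      unfolding real_norm_def abs_mult by (intro mult_left_mono) auto
  qed
qed

lemma p_dens_nonneg:
  fixes f :: "'x \<Rightarrow> real^'l"
  assumes "prob_density mu b \<nu>" shows "0 \<le> p_dens mu b f \<nu> y"
  unfolding p_dens_def
  using assms gauss_prod_bounds(1) by (intro integral_nonneg_AE AE_I2 mult_nonneg_nonneg) (auto simp: prob_density_def)

lemma p_dens_measurable:
  fixes f :: "'x \<Rightarrow> real^'l"
  assumes f: "f \<in> borel_measurable mu" and \<nu>: "prob_density mu b \<nu>"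
  shows "p_dens mu b f \<nu> \<in> borel_measurable LN"
proof -
  interpret sigma_finite_measure XN by (rule sf_XN)
  have "(\<lambda>p. \<nu> (snd p) * (\<Prod>k<b. gauss_dens (fst p k - f (snd p k)))) \<in> borel_measurable (LN \<Otimes>\<^sub>M XN)"
  proof (rule borel_measurable_times)
    show "(\<lambda>p. \<nu> (snd p)) \<in> borel_measurable (LN \<Otimes>\<^sub>M XN)"
      using integrable_density(1)[OF \<nu>] by (intro measurable_compose[OF measurable_snd]) auto
    have "(\<lambda>p. (snd p, fst p)) \<in> measurable (LN \<Otimes>\<^sub>M XN) (XN \<Otimes>\<^sub>M LN)" by measurable
    from measurable_compose[OF this joint_gauss_meas[OF f]]
    show "(\<lambda>p. \<Prod>k<b. gauss_dens (fst p k - f (snd p k))) \<in> borel_measurable (LN \<Otimes>\<^sub>M XN)" by simp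
  qed
  then show ?thesis
    unfolding p_dens_def by (intro borel_measurable_lebesgue_integral) (simp add: case_prod_unfold)
qed

text \<open>Given the states, the observations follow a shifted noise law; averaging over
  \<open>\<nu>\<close> and interchanging the integrals leaves \<open>p_dens\<close>. With
  \<open>A\<close> the whole space this shows that \<open>p_dens\<close> has mass one, and for
  general \<open>A\<close> it identifies the law of the first block.\<close>

lemma p_dens_section:
  fixes f :: "'x \<Rightarrow> real^'l"
  assumes f: "f \<in> borel_measurable mu" and \<nu>: "prob_density mu b \<nu>" and A: "A \<in> sets LN"
  shows "(\<integral>\<^sup>+ x. ennreal (\<nu> x) * emeasure GN {e \<in> space GN. (\<lambda>k\<in>{..<b}. f (x k) + e k) \<in> A} \<partial>XN) =
    (\<integral>\<^sup>+ y. ennreal (p_dens mu b f \<nu> y) * indicator A y \<partial>LN)"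
proof -
  interpret XL: pair_sigma_finite XN LN
    by (simp add: pair_sigma_finite_def sf_XN sf_LN)
  let ?g = "\<lambda>x y. \<Prod>k<b. gauss_dens (y k - f (x k))"
  have \<nu>m: "\<nu> \<in> borel_measurable XN" and \<nu>0: "\<And>x. x \<in> space XN \<Longrightarrow> 0 \<le> \<nu> x"
    using \<nu> unfolding prob_density_def by auto
  have gm: "(\<lambda>p. ennreal (?g (fst p) (snd p))) \<in> borel_measurable (XN \<Otimes>\<^sub>M LN)"
    using joint_gauss_meas[OF f] by simp
  have gmx: "(\<lambda>y. ennreal (?g x y)) \<in> borel_measurable LN" if "x \<in> space XN" for x
    using measurable_compose[OF measurable_Pair1'[OF that] gm] by simp
  have Am: "indicator A \<in> borel_measurable LN" using A by simp
  have sec: "emeasure GN {e \<in> space GN. (\<lambda>k\<in>{..<b}. f (x k) + e k) \<in> A} = (\<integral>\<^sup>+ y. ennreal (?g x y) * indicator A y \<partial>LN)"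
    if x: "x \<in> space XN" for x
  proof -
    have m: "(\<lambda>e. \<lambda>k\<in>{..<b}. f (x k) + e k) \<in> measurable GN LN"
      by (subst measurable_cong_sets[OF sets_GN refl]) (rule shift_meas)
    have "{e \<in> space GN. (\<lambda>k\<in>{..<b}. f (x k) + e k) \<in> A} = (\<lambda>e. \<lambda>k\<in>{..<b}. f (x k) + e k) -` A \<inter> space GN" by auto
    then have "emeasure GN {e \<in> space GN. (\<lambda>k\<in>{..<b}. f (x k) + e k) \<in> A} = emeasure (distr GN LN (\<lambda>e. \<lambda>k\<in>{..<b}. f (x k) + e k)) A"
      using emeasure_distr[OF m A] by simp
    then show ?thesis
      unfolding distr_shift_GN emeasure_density[OF gmx[OF x] A] .
  qed
  have "(\<integral>\<^sup>+ x. ennreal (\<nu> x) * emeasure GN {e \<in> space GN. (\<lambda>k\<in>{..<b}. f (x k) + e k) \<in> A} \<partial>XN) =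
     (\<integral>\<^sup>+ x. (\<integral>\<^sup>+ y. ennreal (\<nu> x) * (ennreal (?g x y) * indicator A y) \<partial>LN) \<partial>XN)"
  proof (rule nn_integral_cong)
    fix x assume x: "x \<in> space XN"
    show "ennreal (\<nu> x) * emeasure GN {e \<in> space GN. (\<lambda>k\<in>{..<b}. f (x k) + e k) \<in> A} =
      (\<integral>\<^sup>+ y. ennreal (\<nu> x) * (ennreal (?g x y) * indicator A y) \<partial>LN)"
      unfolding sec[OF x] by (rule nn_integral_cmult[symmetric]) (intro borel_measurable_times_ennreal gmx[OF x] Am)
  qed
  also have "\<dots> = (\<integral>\<^sup>+ y. (\<integral>\<^sup>+ x. ennreal (\<nu> x) * (ennreal (?g x y) * indicator A y) \<partial>XN) \<partial>LN)"
  proof (rule XL.Fubini'[symmetric])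
    have "(\<lambda>p. ennreal (\<nu> (fst p)) * (ennreal (?g (fst p) (snd p)) * indicator A (snd p))) \<in> borel_measurable (XN \<Otimes>\<^sub>M LN)"
      by (intro borel_measurable_times_ennreal gm measurable_compose[OF measurable_snd Am]
          measurable_compose[OF measurable_compose[OF measurable_fst \<nu>m] measurable_ennreal])
    then show "(\<lambda>(x, y). ennreal (\<nu> x) * (ennreal (?g x y) * indicator A y)) \<in> borel_measurable (XN \<Otimes>\<^sub>M LN)"
      by (simp add: case_prod_unfold)
  qed
  also have "\<dots> = (\<integral>\<^sup>+ y. ennreal (p_dens mu b f \<nu> y) * indicator A y \<partial>LN)"
  proof (rule nn_integral_cong)
    fix y
    have "(\<integral>\<^sup>+ x. ennreal (\<nu> x) * (ennreal (?g x y) * indicator A y) \<partial>XN) = (\<integral>\<^sup>+ x. ennreal (\<nu> x * ?g x y) * indicator A y \<partial>XN)"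
      using \<nu>0 gauss_prod_bounds(1) by (intro nn_integral_cong) (simp add: ennreal_mult mult.assoc)
    also have "\<dots> = (\<integral>\<^sup>+ x. ennreal (\<nu> x * ?g x y) \<partial>XN) * indicator A y"
      using integrable_p_dens_integrand[OF f \<nu>, of y] by (intro nn_integral_multc) auto
    also have "(\<integral>\<^sup>+ x. ennreal (\<nu> x * ?g x y) \<partial>XN) = ennreal (p_dens mu b f \<nu> y)"
      unfolding p_dens_def
      by (rule nn_integral_eq_integral[OF integrable_p_dens_integrand[OF f \<nu>]])
         (use \<nu>0 gauss_prod_bounds(1) in \<open>auto intro!: AE_I2 mult_nonneg_nonneg\<close>)
    finally show "(\<integral>\<^sup>+ x. ennreal (\<nu> x) * (ennreal (?g x y) * indicator A y) \<partial>XN) = ennreal (p_dens mu b f \<nu> y) * indicator A y" .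
  qed
  finally show ?thesis .
qed

lemma p_dens_integral:
  fixes f :: "'x \<Rightarrow> real^'l"
  assumes f: "f \<in> borel_measurable mu" and \<nu>: "prob_density mu b \<nu>"
  shows "integrable LN (p_dens mu b f \<nu>)" "(LINT y|LN. p_dens mu b f \<nu> y) = 1"
proof -
  interpret GN: prob_space GN by (rule GN_prob)
  have GNs: "emeasure GN {e \<in> space GN. (\<lambda>k\<in>{..<b}. f (x k) + e k) \<in> space LN} = 1" for x
  proof -
    have "(\<lambda>k\<in>{..<b}. f (x k) + e k) \<in> space LN" for e by (simp add: space_PiM)
    then show ?thesis by (simp add: GN.emeasure_space_1)
  qed
  have "(\<integral>\<^sup>+ y. ennreal (p_dens mu b f \<nu> y) \<partial>LN) = (\<integral>\<^sup>+ y. ennreal (p_dens mu b f \<nu> y) * indicator (space LN) y \<partial>LN)"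
    by (intro nn_integral_cong) simp
  also have "\<dots> = 1"
    unfolding p_dens_section[OF f \<nu> sets.top, symmetric] GNs using \<nu> by (simp add: prob_density_def)
  finally have i: "(\<integral>\<^sup>+ y. ennreal (p_dens mu b f \<nu> y) \<partial>LN) = 1" .
  note m = p_dens_measurable[OF f \<nu>]
  show "integrable LN (p_dens mu b f \<nu>)"
    using m i p_dens_nonneg[OF \<nu>] by (intro integrableI_nonneg) (auto intro!: AE_I2)
  show "(LINT y|LN. p_dens mu b f \<nu> y) = 1"
    using m i p_dens_nonneg[OF \<nu>] by (subst integral_eq_nn_integral) (auto intro!: AE_I2)
qed

text \<open>\<open>sections_Ob\<close> freezes the noise whereas \<open>p_dens_section\<close>
  freezes the states, so the integrals over sample point and noise are interchanged in
  between.\<close>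

lemma distributed_Ob:
  assumes nustar: "prob_density mu b nustar"
    and law: "distributed M XN (\<lambda>\<omega>. \<lambda>j\<in>{..<b}. X (int j) \<omega>) (\<lambda>x. ennreal (nustar x))"
  shows "distributed M LN (Ob 0) (\<lambda>y. ennreal (p_dens mu b fstar nustar y))"
proof -
  interpret GN: prob_space GN by (rule GN_prob)
  interpret MG: pair_sigma_finite M GN ..
  have Xb0: "Xb 0 = (\<lambda>\<omega>. \<lambda>j\<in>{..<b}. X (int j) \<omega>)" by (simp add: Xb_def fun_eq_iff)
  have law': "distr M XN (Xb 0) = density XN (\<lambda>x. ennreal (nustar x))"
    using distributed_distr_eq_density[OF law] unfolding Xb0 .
  have pm: "(\<lambda>y. ennreal (p_dens mu b fstar nustar y)) \<in> borel_measurable LN"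
    using p_dens_measurable[OF fstar_meas nustar] by simp
  have "distr M LN (Ob 0) = density LN (\<lambda>y. ennreal (p_dens mu b fstar nustar y))"
  proof (rule measure_eqI)
    show "sets (distr M LN (Ob 0)) = sets (density LN (\<lambda>y. ennreal (p_dens mu b fstar nustar y)))" by simp
    fix A assume "A \<in> sets (distr M LN (Ob 0))"
    then have A [measurable]: "A \<in> sets LN" by simp
    have ind: "(\<lambda>(\<omega>, e). indicator A (obs (Xb 0 \<omega>) e) :: ennreal) \<in> borel_measurable (M \<Otimes>\<^sub>M GN)"
      by (simp add: case_prod_unfold)
    have xm: "(\<lambda>x. emeasure GN {e \<in> space GN. obs x e \<in> A}) \<in> borel_measurable XN"
    proof -
      have "(\<lambda>x. emeasure GN (Pair x -` {p \<in> space (XN \<Otimes>\<^sub>M GN). obs (fst p) (snd p) \<in> A})) \<in> borel_measurable XN"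
        by (rule GN.measurable_emeasure_Pair) measurable
      moreover have "Pair x -` {p \<in> space (XN \<Otimes>\<^sub>M GN). obs (fst p) (snd p) \<in> A} = {e \<in> space GN. obs x e \<in> A}"
        if "x \<in> space XN" for x using that by (auto simp: space_pair_measure)
      ultimately show ?thesis by (simp cong: measurable_cong)
    qed
    have "emeasure (distr M LN (Ob 0)) A = emeasure M {\<omega> \<in> space M. Ob 0 \<omega> \<in> A}"
      by (subst emeasure_distr) (auto intro!: arg_cong[where f = "emeasure M"])
    also have "\<dots> = (\<integral>\<^sup>+ e. emeasure M {\<omega> \<in> space M. obs (Xb 0 \<omega>) e \<in> A} \<partial>GN)"
      by (rule sections_Ob[OF A])
    also have "\<dots> = (\<integral>\<^sup>+ e. (\<integral>\<^sup>+ \<omega>. indicator A (obs (Xb 0 \<omega>) e) \<partial>M) \<partial>GN)"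
    proof (rule nn_integral_cong)
      fix e assume "e \<in> space GN"
      then have [measurable]: "e \<in> space LN" using sets_eq_imp_space_eq[OF sets_GN] by simp
      show "emeasure M {\<omega> \<in> space M. obs (Xb 0 \<omega>) e \<in> A} = (\<integral>\<^sup>+ \<omega>. indicator A (obs (Xb 0 \<omega>) e) \<partial>M)"
        by (intro nn_integral_pred[symmetric]) (auto simp: indicator_def)
    qed
    also have "\<dots> = (\<integral>\<^sup>+ \<omega>. (\<integral>\<^sup>+ e. indicator A (obs (Xb 0 \<omega>) e) \<partial>GN) \<partial>M)"
      by (rule MG.Fubini'[OF ind])
    also have "\<dots> = (\<integral>\<^sup>+ \<omega>. emeasure GN {e \<in> space GN. obs (Xb 0 \<omega>) e \<in> A} \<partial>M)"
    proof (rule nn_integral_cong)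
      fix \<omega> assume "\<omega> \<in> space M"
      then have [measurable]: "Xb 0 \<omega> \<in> space XN" using measurable_space[OF Xb_meas] by blast
      show "(\<integral>\<^sup>+ e. indicator A (obs (Xb 0 \<omega>) e) \<partial>GN) = emeasure GN {e \<in> space GN. obs (Xb 0 \<omega>) e \<in> A}"
        by (intro nn_integral_pred) (auto simp: indicator_def)
    qed
    also have "\<dots> = (\<integral>\<^sup>+ x. emeasure GN {e \<in> space GN. obs x e \<in> A} \<partial>distr M XN (Xb 0))"
      by (rule nn_integral_distr[symmetric]) (use xm in simp_all)
    also have "\<dots> = (\<integral>\<^sup>+ x. ennreal (nustar x) * emeasure GN {e \<in> space GN. obs x e \<in> A} \<partial>XN)"
      unfolding law' using nustar xm by (intro nn_integral_density) (auto simp: prob_density_def)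
    also have "\<dots> = (\<integral>\<^sup>+ y. ennreal (p_dens mu b fstar nustar y) * indicator A y \<partial>LN)"
      unfolding obs_def by (rule p_dens_section[OF fstar_meas nustar A])
    also have "\<dots> = emeasure (density LN (\<lambda>y. ennreal (p_dens mu b fstar nustar y))) A"
      by (rule emeasure_density[OF pm A, symmetric])
    finally show "emeasure (distr M LN (Ob 0)) A = emeasure (density LN (\<lambda>y. ennreal (p_dens mu b fstar nustar y))) A" .
  qed
  then show ?thesis
    using pm Ob_meas unfolding distributed_def by blast
qed

section \<open>Block densities as exponential moment integrals\<close>

definition "JJ = {..<b} \<times> (UNIV :: 'l set)"

lemma finite_JJ: "finite JJ" by (simp add: JJ_def)

lemma card_JJ: "card JJ = b * CARD('l)" by (simp add: JJ_def)

abbreviation "QQ f \<nu> \<equiv> exp_moment_int XN (tilt b f \<nu>) (coord (f :: 'x \<Rightarrow> real^'l)) JJ"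

lemma p_dens_eq_QQ:
  fixes f :: "'x \<Rightarrow> real^'l"
  shows "p_dens mu b f \<nu> y = ((2 * pi) powr (- real CARD('l) / 2)) ^ b * exp (- (\<Sum>k<b. (norm (y k))\<^sup>2) / 2) * QQ f \<nu> {} (flat b y)"
proof -
  let ?c = "((2 * pi) powr (- real CARD('l) / 2)) ^ b * exp (- (\<Sum>k<b. (norm (y k))\<^sup>2) / 2)"
  have "\<nu> x * (\<Prod>k<b. gauss_dens (y k - f (x k))) =
     ?c * (tilt b f \<nu> x * (\<Prod>i\<in>{}. coord f i x) * exp (\<Sum>i\<in>JJ. flat b y i * coord f i x))" for x
  proof -
    have J: "(\<Sum>i\<in>JJ. flat b y i * coord f i x) = (\<Sum>k<b. inner (y k) (f (x k)))"
    proof -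
      have "(\<Sum>i\<in>JJ. flat b y i * coord f i x) = (\<Sum>(k, j)\<in>{..<b} \<times> UNIV. y k $ j * f (x k) $ j)"
        unfolding JJ_def by (intro sum.cong refl) (auto simp: flat_def coord_def)
      then show ?thesis
        by (simp add: sum.cartesian_product[symmetric] inner_vec_def)
    qed
    have g: "gauss_dens (y k - f (x k)) = (2 * pi) powr (- real CARD('l) / 2) *
        exp (- (norm (y k))\<^sup>2 / 2 + (- (norm (f (x k)))\<^sup>2 / 2 + inner (y k) (f (x k))))" for k
    proof -
      have "(norm (y k - f (x k)))\<^sup>2 = (norm (y k))\<^sup>2 - 2 * inner (y k) (f (x k)) + (norm (f (x k)))\<^sup>2"
        by (simp only: power2_norm_eq_inner inner_diff_left inner_diff_right) (simp add: inner_commute)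
      then have "- (norm (y k - f (x k)))\<^sup>2 / 2 = - (norm (y k))\<^sup>2 / 2 + (- (norm (f (x k)))\<^sup>2 / 2 + inner (y k) (f (x k)))"
        by (simp add: field_simps)
      then show ?thesis unfolding gauss_dens_def by (simp only:)
    qed
    have "(\<Prod>k<b. gauss_dens (y k - f (x k))) = ((2 * pi) powr (- real CARD('l) / 2)) ^ b *
        exp (\<Sum>k<b. - (norm (y k))\<^sup>2 / 2 + (- (norm (f (x k)))\<^sup>2 / 2 + inner (y k) (f (x k))))"
      unfolding g prod.distrib exp_sum[OF finite_lessThan] by simp
    also have "(\<Sum>k<b. - (norm (y k))\<^sup>2 / 2 + (- (norm (f (x k)))\<^sup>2 / 2 + inner (y k) (f (x k)))) =
       - (\<Sum>k<b. (norm (y k))\<^sup>2) / 2 + (- (\<Sum>k<b. (norm (f (x k)))\<^sup>2) / 2 + (\<Sum>k<b. inner (y k) (f (x k))))"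
      by (simp add: sum.distrib sum_subtractf sum_negf sum_divide_distrib[symmetric])
    finally show ?thesis
      unfolding tilt_def J exp_add by (simp add: mult_ac)
  qed
  then show ?thesis
    unfolding p_dens_def exp_moment_int_def by simp
qed

lemma bounded_exponents_QQ:
  fixes f :: "'x \<Rightarrow> real^'l"
  assumes f: "f \<in> borel_measurable mu" and \<nu>: "prob_density mu b \<nu>"
    and R: "\<And>x j. x \<in> space mu \<Longrightarrow> \<bar>f x $ j\<bar> \<le> R" and R0: "0 \<le> R"
  shows "bounded_exponents XN (tilt b f \<nu>) (coord f) JJ R"
proof (rule bounded_exponents.intro)
  have fk: "(\<lambda>x. f (x k)) \<in> borel_measurable XN" if "k < b" for k
    using measurable_compose[OF measurable_component_singleton[of k "{..<b}"] f] that by simp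
  have tm: "tilt b f \<nu> \<in> borel_measurable XN"
    unfolding tilt_def
  proof (rule borel_measurable_times)
    show "\<nu> \<in> borel_measurable XN" using \<nu> by (simp add: prob_density_def)
    have "(\<lambda>x. \<Sum>k<b. (norm (f (x k)))\<^sup>2) \<in> borel_measurable XN"
      using fk by (intro borel_measurable_sum borel_measurable_power measurable_compose[OF _ borel_measurable_norm]) auto
    then show "(\<lambda>x. exp (- (\<Sum>k<b. (norm (f (x k)))\<^sup>2) / 2)) \<in> borel_measurable XN"
      by measurable
  qed
  show sf: "sigma_finite_measure XN" by (rule sf_XN)
  have \<nu>0: "\<And>x. x \<in> space XN \<Longrightarrow> 0 \<le> \<nu> x" using \<nu> by (simp add: prob_density_def)
  show "0 \<le> tilt b f \<nu> x" if "x \<in> space XN" for x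
    using \<nu>0[OF that] by (simp add: tilt_def)
  have e1: "exp (- (\<Sum>k<b. (norm (f (x k)))\<^sup>2) / 2) \<le> 1" for x
    by (simp add: sum_nonneg)
  show int: "integrable XN (tilt b f \<nu>)"
  proof (rule Bochner_Integration.integrable_bound[OF integrable_density(1)[OF \<nu>] tm])
    show "AE x in XN. norm (tilt b f \<nu> x) \<le> norm (\<nu> x)"
      unfolding tilt_def real_norm_def abs_mult
      by (intro AE_I2 mult_left_le) (use e1 in auto)
  qed
  show "0 < (LINT x|XN. tilt b f \<nu> x)"
  proof -
    \<comment> \<open>The Euclidean norm is at most the sum of the absolute coordinates, so each of
      the \<open>b\<close> squared norms in the tilt is at most
      \<open>(real CARD('l) * R)\<^sup>2\<close>. Hence the tilted weight dominates
      \<open>c * \<nu>\<close>, which has mass \<open>c > 0\<close>.\<close>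
    define c where "c = exp (- (real b * (real CARD('l) * R)\<^sup>2) / 2)"
    have "c * \<nu> x \<le> tilt b f \<nu> x" if x: "x \<in> space XN" for x
    proof -
      have "norm (f (x k)) \<le> real CARD('l) * R" if "k < b" for k
      proof -
        have "x k \<in> space mu" using x that by (auto simp: space_PiM)
        then have "(\<Sum>j\<in>UNIV. \<bar>f (x k) $ j\<bar>) \<le> (\<Sum>j\<in>(UNIV :: 'l set). R)"
          by (intro sum_mono R)
        then show ?thesis using norm_le_l1_cart[of "f (x k)"] by simp
      qed
      then have "(\<Sum>k<b. (norm (f (x k)))\<^sup>2) \<le> (\<Sum>k<b. (real CARD('l) * R)\<^sup>2)"
        by (intro sum_mono power_mono) auto
      then have "c \<le> exp (- (\<Sum>k<b. (norm (f (x k)))\<^sup>2) / 2)"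
        unfolding c_def by simp
      then have "\<nu> x * c \<le> tilt b f \<nu> x"
        unfolding tilt_def by (rule mult_left_mono[OF _ \<nu>0[OF x]])
      then show ?thesis by (simp add: mult.commute)
    qed
    then have "(LINT x|XN. c * \<nu> x) \<le> (LINT x|XN. tilt b f \<nu> x)"
      using integrable_density[OF \<nu>] int by (intro integral_mono) auto
    moreover have "(LINT x|XN. c * \<nu> x) = c"
      using integrable_density[OF \<nu>] by simp
    moreover have "0 < c" by (simp add: c_def)
    ultimately show ?thesis by linarith
  qed
  show "coord f i \<in> borel_measurable XN" if "i \<in> JJ" for i
  proof -
    obtain k j where i: "i = (k, j)" by (cases i)
    with that have "k < b" by (simp add: JJ_def)
    from measurable_compose[OF fk[OF this], of "\<lambda>v. v $ j" borel]
    have "(\<lambda>x. f (x k) $ j) \<in> borel_measurable XN" by measurable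
    then show ?thesis by (simp add: i coord_def)
  qed
  show "\<bar>coord f i x\<bar> \<le> R" if "i \<in> JJ" "x \<in> space XN" for i x
    using that R by (auto simp: JJ_def coord_def space_PiM)
  show "finite JJ" by (rule finite_JJ)
  show "0 \<le> R" by (rule R0)
qed

lemma ln_ratio_eq:
  fixes f g :: "'x \<Rightarrow> real^'l"
  assumes pos: "0 < QQ f \<nu> {} (flat b y)" "0 < QQ g \<nu>' {} (flat b y)"
  shows "ln ((p_dens mu b f \<nu> y + p_dens mu b g \<nu>' y) / (2 * p_dens mu b g \<nu>' y)) =
    ln (QQ f \<nu> {} (flat b y) + QQ g \<nu>' {} (flat b y)) - ln (QQ g \<nu>' {} (flat b y)) - ln 2"
proof -
  have alg: "(c * q + c * r) / (2 * (c * r)) = (q + r) / (r * 2)" if "c \<noteq> 0" "r \<noteq> 0" for c q r :: real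
    using that by (simp add: field_simps)
  have "ln ((QQ f \<nu> {} (flat b y) + QQ g \<nu>' {} (flat b y)) / (QQ g \<nu>' {} (flat b y) * 2)) =
     ln (QQ f \<nu> {} (flat b y) + QQ g \<nu>' {} (flat b y)) - ln (QQ g \<nu>' {} (flat b y)) - ln 2"
    using pos by (subst ln_div) (auto simp: ln_mult)
  then show ?thesis
    unfolding p_dens_eq_QQ using pos by (subst alg) auto
qed

end

section \<open>Stochastic order symbols\<close>

lemma bigOP_if_tendsto_0:
  assumes "\<And>T. T \<ge> K \<Longrightarrow> (\<lambda>n. measure M {\<omega> \<in> space M. \<bar>Z n \<omega>\<bar> > T * \<alpha> n}) \<longlonglongrightarrow> 0"
  shows "bigOP M Z \<alpha>"
proof -
  have "limsup (\<lambda>n. ereal (measure M {\<omega> \<in> space M. \<bar>Z n \<omega>\<bar> > T * \<alpha> n})) = 0" if "T \<ge> K" for T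
  proof (rule lim_imp_Limsup)
    show "(\<lambda>n. ereal (measure M {\<omega> \<in> space M. \<bar>Z n \<omega>\<bar> > T * \<alpha> n})) \<longlonglongrightarrow> 0"
      using tendsto_ereal[OF assms[OF that]] by (simp add: zero_ereal_def)
  qed simp
  then have "\<forall>\<^sub>F T in at_top. limsup (\<lambda>n. ereal (measure M {\<omega> \<in> space M. \<bar>Z n \<omega>\<bar> > T * \<alpha> n})) = 0"
    unfolding eventually_at_top_linorder by blast
  then show ?thesis
    unfolding bigOP_def by (rule tendsto_eventually)
qed

text \<open>A single \<open>T\<close> with small limsup suffices, because \<open>\<beta>\<close>
  eventually exceeds \<open>T * \<alpha>\<close>. It is applied to the tolerance, whose scale
  \<open>lam n / n\<close> is negligible against \<open>lam n\<close>.\<close>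

lemma (in prob_space) bigOP_tendsto_0:
  assumes OP: "bigOP M Z \<alpha>" and [measurable]: "\<And>n. Z n \<in> borel_measurable M"
    and dom: "\<And>T. T > 0 \<Longrightarrow> \<forall>\<^sub>F n in sequentially. T * \<alpha> n \<le> \<beta> n"
  shows "(\<lambda>n. prob {\<omega> \<in> space M. \<bar>Z n \<omega>\<bar> > \<beta> n}) \<longlonglongrightarrow> 0"
proof (rule order_tendstoI)
  fix e :: real assume e: "0 < e"
  have "\<forall>\<^sub>F T in at_top. limsup (\<lambda>n. ereal (prob {\<omega> \<in> space M. \<bar>Z n \<omega>\<bar> > T * \<alpha> n})) < ereal e"
    using order_tendstoD(2)[OF OP[unfolded bigOP_def], of "ereal e"] e by (simp add: zero_ereal_def)
  then have "\<forall>\<^sub>F T in at_top. limsup (\<lambda>n. ereal (prob {\<omega> \<in> space M. \<bar>Z n \<omega>\<bar> > T * \<alpha> n})) < ereal e \<and> T > 0"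
    using eventually_gt_at_top[of 0] by (rule eventually_conj)
  then obtain T where T: "limsup (\<lambda>n. ereal (prob {\<omega> \<in> space M. \<bar>Z n \<omega>\<bar> > T * \<alpha> n})) < ereal e" "T > 0"
    using eventually_happens'[OF trivial_limit_at_top_linorder] by blast
  have "\<forall>\<^sub>F n in sequentially. ereal (prob {\<omega> \<in> space M. \<bar>Z n \<omega>\<bar> > T * \<alpha> n}) < ereal e"
    by (rule Limsup_lessD[OF T(1)])
  with dom[OF T(2)] show "\<forall>\<^sub>F n in sequentially. prob {\<omega> \<in> space M. \<bar>Z n \<omega>\<bar> > \<beta> n} < e"
  proof eventually_elim
    case (elim n)
    have "prob {\<omega> \<in> space M. \<bar>Z n \<omega>\<bar> > \<beta> n} \<le> prob {\<omega> \<in> space M. \<bar>Z n \<omega>\<bar> > T * \<alpha> n}"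
      using elim(1) by (intro finite_measure_mono) auto
    with elim(2) show ?case by simp
  qed
qed (auto intro!: always_eventually less_le_trans[OF _ measure_nonneg])

text \<open>Outside the event \<open>bad n\<close>, on which \<open>W\<close> or \<open>rho\<close>
  is comparable to \<open>lam n\<close>, the inequality is deterministic and yields both bounds with
  fixed constants. The probability of \<open>bad n\<close> vanishes by Markov's inequality, since
  \<open>sqrt n / lam n\<close> tends to 0, and by the order of \<open>rho\<close>.\<close>

lemma (in prob_space) bigOP_of_basic_inequality:
  fixes H Iv W rho :: "nat \<Rightarrow> 'a \<Rightarrow> real" and lam :: "nat \<Rightarrow> real"
  assumes basic: "\<And>n \<omega>. \<omega> \<in> space M \<Longrightarrow>
      lam n * Iv n \<omega> + real n * H n \<omega> / 4 \<le> lam n * I0 + rho n \<omega> + c1 * (1 + Iv n \<omega>) * W n \<omega>"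
    and c1: "0 \<le> c1" and I0: "0 \<le> I0"
    and H0: "\<And>n \<omega>. \<omega> \<in> space M \<Longrightarrow> 0 \<le> H n \<omega>" and Iv0: "\<And>n \<omega>. \<omega> \<in> space M \<Longrightarrow> 0 \<le> Iv n \<omega>"
    and Hm [measurable]: "\<And>n. H n \<in> borel_measurable M" and Im [measurable]: "\<And>n. Iv n \<in> borel_measurable M"
    and rm [measurable]: "\<And>n. rho n \<in> borel_measurable M"
    and Wint: "\<And>n. integrable M (W n)" and W0: "\<And>n \<omega>. 0 \<le> W n \<omega>"
    and EW: "\<And>n. expectation (W n) \<le> c * sqrt (real n)"
    and lam_pos: "\<And>n. lam n > 0"
    and lam_sqrt: "filterlim (\<lambda>n. lam n / sqrt (real n)) at_top sequentially"
    and rho_OP: "bigOP M rho (\<lambda>n. lam n / real n)"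
  shows "bigOP M H (\<lambda>n. lam n / real n)" "bigOP M Iv (\<lambda>n. 1)"
proof -
  \<comment> \<open>Chosen so that \<open>c1 * \<delta> \<le> 1 / 2\<close>: the deviation term then
    absorbs at most half of \<open>lam n * Iv n \<omega>\<close> and leaves the other half on the
    left.\<close>
  define \<delta> where "\<delta> = 1 / (2 * (c1 + 1))"
  have \<delta>: "0 < \<delta>" "c1 * \<delta> \<le> 1 / 2" using c1 by (auto simp: \<delta>_def field_simps)
  have Wm [measurable]: "W n \<in> borel_measurable M" for n using Wint by auto
  define bad where "bad n = {\<omega> \<in> space M. \<delta> * lam n \<le> W n \<omega>} \<union> {\<omega> \<in> space M. \<bar>rho n \<omega>\<bar> > lam n}" for n
  have bad_ev [measurable]: "bad n \<in> events" for n unfolding bad_def by measurable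
  have good: "Iv n \<omega> \<le> 2 * I0 + 3 \<and> real n * H n \<omega> \<le> lam n * (4 * I0 + 6)"
    if \<omega>: "\<omega> \<in> space M" "\<omega> \<notin> bad n" for n \<omega>
  proof -
    have w: "W n \<omega> \<le> \<delta> * lam n" and r: "rho n \<omega> \<le> lam n" using \<omega> by (auto simp: bad_def)
    have "c1 * (1 + Iv n \<omega>) * W n \<omega> \<le> c1 * (1 + Iv n \<omega>) * (\<delta> * lam n)"
      using c1 Iv0[OF \<omega>(1)] by (intro mult_left_mono w) auto
    also have "\<dots> = (c1 * \<delta>) * ((1 + Iv n \<omega>) * lam n)" by simp
    also have "\<dots> \<le> 1 / 2 * ((1 + Iv n \<omega>) * lam n)"
      using \<delta>(2) Iv0[OF \<omega>(1), of n] lam_pos[of n] by (intro mult_right_mono) auto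
    \<comment> \<open>The constant \<open>3 / 2\<close> is made of 1 from the tolerance and 1/2 from
      the part of the deviation term that is free of \<open>Iv\<close>.\<close>
    finally have main: "lam n * Iv n \<omega> / 2 + real n * H n \<omega> / 4 \<le> lam n * (I0 + 3 / 2)"
      using basic[OF \<omega>(1), of n] r by (simp add: algebra_simps)
    have "lam n * Iv n \<omega> \<le> lam n * (2 * I0 + 3)"
      using main mult_nonneg_nonneg[OF _ H0[OF \<omega>(1)], of "real n" n] by (simp add: algebra_simps)
    then have "Iv n \<omega> \<le> 2 * I0 + 3" using lam_pos[of n] by simp
    moreover have "real n * H n \<omega> \<le> lam n * (4 * I0 + 6)"
      using main mult_nonneg_nonneg[OF _ Iv0[OF \<omega>(1)], of "lam n" n] lam_pos[of n] by (simp add: algebra_simps)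
    ultimately show ?thesis by blast
  qed
  have bad_lim: "(\<lambda>n. prob (bad n)) \<longlonglongrightarrow> 0"
  proof (rule tendsto_sandwich[OF always_eventually _ tendsto_const])
    let ?r = "\<lambda>n. prob {\<omega> \<in> space M. \<bar>rho n \<omega>\<bar> > lam n}"
    show "\<forall>\<^sub>F n in sequentially. prob (bad n) \<le> c / \<delta> * inverse (lam n / sqrt (real n)) + ?r n"
    proof (rule eventually_sequentiallyI[of 1])
      fix n :: nat assume n: "1 \<le> n"
      have "prob {\<omega> \<in> space M. \<delta> * lam n \<le> W n \<omega>} \<le> expectation (W n) / (\<delta> * lam n)"
        using \<delta>(1) lam_pos[of n] W0 by (intro integral_Markov_inequality_measure[where A = "{}"] Wint) auto
      also have "\<dots> \<le> c * sqrt (real n) / (\<delta> * lam n)"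
        using EW[of n] \<delta>(1) lam_pos[of n] by (intro divide_right_mono) auto
      also have "\<dots> = c / \<delta> * inverse (lam n / sqrt (real n))"
        using \<delta>(1) lam_pos[of n] n by (simp add: field_simps)
      finally have "prob {\<omega> \<in> space M. \<delta> * lam n \<le> W n \<omega>} \<le> c / \<delta> * inverse (lam n / sqrt (real n))" .
      moreover have "prob (bad n) \<le> prob {\<omega> \<in> space M. \<delta> * lam n \<le> W n \<omega>} + ?r n"
        unfolding bad_def by (rule measure_Un_le) measurable
      ultimately show "prob (bad n) \<le> c / \<delta> * inverse (lam n / sqrt (real n)) + ?r n" by linarith
    qed
    have "?r \<longlonglongrightarrow> 0"
    proof (rule bigOP_tendsto_0[OF rho_OP rm])
      fix T :: real assume T: "T > 0"
      obtain N :: nat where N: "T \<le> real N" using real_arch_simple by blast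
      show "\<forall>\<^sub>F n in sequentially. T * (lam n / real n) \<le> lam n"
      proof (rule eventually_sequentiallyI[of "max N 1"])
        fix n assume "max N 1 \<le> n"
        then have "T \<le> real n" "real n > 0" using N by auto
        then have "T * lam n \<le> real n * lam n" using lam_pos[of n] by (intro mult_right_mono) auto
        with \<open>real n > 0\<close> show "T * (lam n / real n) \<le> lam n" by (simp add: field_simps)
      qed
    qed
    moreover have "(\<lambda>n. inverse (lam n / sqrt (real n))) \<longlonglongrightarrow> 0"
      by (rule filterlim_compose[OF tendsto_inverse_0_at_top[OF filterlim_ident] lam_sqrt])
    ultimately have "(\<lambda>n. c / \<delta> * inverse (lam n / sqrt (real n)) + ?r n) \<longlonglongrightarrow> c / \<delta> * 0 + 0"
      by (intro tendsto_intros)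
    then show "(\<lambda>n. c / \<delta> * inverse (lam n / sqrt (real n)) + ?r n) \<longlonglongrightarrow> 0" by simp
  qed simp
  \<comment> \<open>At \<open>n = 0\<close> the quotient \<open>lam n / real n\<close> is
    \<open>0\<close> by the convention for division, so the inclusion is asked for
    \<open>n \<ge> 1\<close> only; the limit does not see this index.\<close>
  have conv: "(\<lambda>n. prob (S n)) \<longlonglongrightarrow> 0"
    if "\<And>n. n \<ge> 1 \<Longrightarrow> S n \<subseteq> bad n" for S
  proof (rule tendsto_sandwich[OF always_eventually _ tendsto_const bad_lim])
    show "\<forall>\<^sub>F n in sequentially. prob (S n) \<le> prob (bad n)"
      by (rule eventually_sequentiallyI[of 1]) (use that in \<open>intro finite_measure_mono bad_ev, auto\<close>)
  qed simp
  show "bigOP M H (\<lambda>n. lam n / real n)"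
  proof (rule bigOP_if_tendsto_0[where K = "4 * I0 + 6"], rule conv)
    fix T n assume T: "T \<ge> 4 * I0 + 6" and n: "(1 :: nat) \<le> n"
    show "{\<omega> \<in> space M. \<bar>H n \<omega>\<bar> > T * (lam n / real n)} \<subseteq> bad n"
    proof (rule ccontr)
      assume "\<not> {\<omega> \<in> space M. \<bar>H n \<omega>\<bar> > T * (lam n / real n)} \<subseteq> bad n"
      then obtain \<omega> where \<omega>: "\<omega> \<in> space M" "\<bar>H n \<omega>\<bar> > T * (lam n / real n)" "\<omega> \<notin> bad n" by auto
      then have "T * lam n < real n * H n \<omega>"
        using n H0[OF \<omega>(1), of n] by (simp add: field_simps)
      moreover have "real n * H n \<omega> \<le> lam n * (4 * I0 + 6)" using good[OF \<omega>(1,3)] by simp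
      moreover have "lam n * (4 * I0 + 6) \<le> lam n * T" using T lam_pos[of n] by (intro mult_left_mono) auto
      ultimately show False by (simp add: mult.commute)
    qed
  qed
  show "bigOP M Iv (\<lambda>n. 1)"
  proof (rule bigOP_if_tendsto_0[where K = "2 * I0 + 3"], rule conv)
    fix T n assume T: "T \<ge> 2 * I0 + 3" and n: "(1 :: nat) \<le> n"
    show "{\<omega> \<in> space M. \<bar>Iv n \<omega>\<bar> > T * 1} \<subseteq> bad n"
      using good T Iv0 by fastforce
  qed
qed

section \<open>Growth of the radius against the penalty\<close>

lemma powr_le_one_plus: 
  fixes x e :: real assumes "0 \<le> x" "0 < e" "e \<le> 1" shows "x powr e \<le> 1 + x"
proof (cases "x \<le> 1")
  case True
  then have "x powr e \<le> 1 powr e" using assms by (intro powr_mono2) auto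
  then show ?thesis using assms by simp
next
  case False
  then have "x powr e \<le> x powr 1" using assms by (intro powr_mono) auto
  then show ?thesis using False by simp
qed

text \<open>The exponent condition makes the \<open>d\<close>-th power of
  \<open>C * I1 powr ups\<close> grow at most linearly in \<open>I1\<close>, and the maximum is
  bounded by the sum of its three candidates. With \<open>d = b * CARD('l)\<close> this is where the
  exponent of H2 meets the dimension of a block.\<close>

lemma max_power_le:
  fixes C I0 I1 ups :: real
  assumes C: "0 < C" and I: "0 \<le> I0" "0 \<le> I1" and ups: "0 < ups" and d: "0 < d" "real d * ups \<le> 1"
  shows "(max 1 (max (C * I1 powr ups) (C * I0 powr ups))) ^ d \<le> (1 + C ^ d + (C * I0 powr ups) ^ d) * (1 + I1)"
proof -
  let ?a = "C * I1 powr ups" and ?b = "C * I0 powr ups"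
  have ab: "0 \<le> ?a" "0 \<le> ?b" using C by auto
  have "?a ^ d = C ^ d * I1 powr (real d * ups)"
    using d by (cases "I1 = 0") (simp_all add: power_mult_distrib powr_power mult.commute)
  also have "\<dots> \<le> C ^ d * (1 + I1)"
    using powr_le_one_plus[of I1 "real d * ups"] I ups d C by (intro mult_left_mono) auto
  finally have a: "?a ^ d \<le> C ^ d * (1 + I1)" .
  have b: "?b ^ d \<le> ?b ^ d * (1 + I1)"
    using mult_left_mono[OF _ zero_le_power[OF ab(2)], of 1 "1 + I1" d] I by simp
  have e: "(1 + C ^ d + ?b ^ d) * (1 + I1) = (1 + I1) + C ^ d * (1 + I1) + ?b ^ d * (1 + I1)"
    by (simp add: distrib_right)
  have nn: "0 \<le> C ^ d * (1 + I1)" "0 \<le> ?b ^ d * (1 + I1)" using C I ab by auto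
  consider "max 1 (max ?a ?b) = 1" | "max 1 (max ?a ?b) = ?a" | "max 1 (max ?a ?b) = ?b"
    by (metis max_def)
  then show ?thesis
  proof cases
    case 1
    show ?thesis unfolding 1 e using nn I by simp
  next
    case 2
    show ?thesis unfolding 2 e using nn I a by linarith
  next
    case 3
    show ?thesis unfolding 3 e using nn I b by linarith
  qed
qed

section \<open>The maximum penalized likelihood estimator\<close>

lemma (in noisy_process) concentrated_Ob:
  assumes bound: "\<And>x j. x \<in> space mu \<Longrightarrow> \<bar>fstar x $ j\<bar> \<le> R"
    and sum: "summable (\<lambda>i. sqrt (phiX M mu X (int (Suc i))))"
  shows "concentrated_process M (\<lambda>k \<omega>. flat b (Ob k \<omega>)) ({..<b} \<times> UNIV) (1 + 2 * (\<Sum>i. phiX M mu X (int (Suc i))))"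
proof
  let ?J = "{..<b} \<times> (UNIV :: 'l set)"
  define d where "d = real (card ?J)"
  show fm: "(\<lambda>\<omega>. flat b (Ob k \<omega>)) \<in> measurable M (PiM UNIV (\<lambda>_. borel))" for k
    by (rule measurable_compose[OF Ob_meas flat_measurable])
  show "flat b (Ob k \<omega>) i = 0" if "i \<notin> ?J" for k \<omega> i
    using that by (auto simp: flat_def split: prod.splits)
  show fin: "finite ?J" by simp
  show "0 \<le> 1 + 2 * (\<Sum>i. phiX M mu X (int (Suc i)))"
    using phiX_nonneg by (intro add_nonneg_nonneg mult_nonneg_nonneg suminf_nonneg summable_phiX[OF sum]) auto
  show "integrable M (\<lambda>\<omega>. exp (2 * (\<Sum>i\<in>?J. \<bar>flat b (Ob k \<omega>) i\<bar>)))" for k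
  proof (rule Bochner_Integration.integrable_bound)
    \<comment> \<open>The sum of the absolute coordinates is at most \<open>d\<close> times the
      largest one, and the exponential of the largest is at most the sum over all coordinates. Only
      exponential moments of single noise coordinates are then left; the two signs account for the
      absolute value.\<close>
    let ?e = "\<lambda>i \<omega>. exp (2 * d * R) * (exp (2 * d * eps (k * b + fst i) \<omega> $ snd i) + exp (- 2 * d * eps (k * b + fst i) \<omega> $ snd i))"
    show "integrable M (\<lambda>\<omega>. \<Sum>i\<in>?J. ?e i \<omega>)"
      by (intro Bochner_Integration.integrable_sum integrable_mult_right Bochner_Integration.integrable_add integrable_exp_eps)
    have "(\<lambda>\<omega>. flat b (Ob k \<omega>) i) \<in> borel_measurable M" for i
      using measurable_compose[OF fm measurable_component_singleton[of i UNIV]] by simp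
    then show "(\<lambda>\<omega>. exp (2 * (\<Sum>i\<in>?J. \<bar>flat b (Ob k \<omega>) i\<bar>))) \<in> borel_measurable M"
      by measurable
    show "AE \<omega> in M. norm (exp (2 * (\<Sum>i\<in>?J. \<bar>flat b (Ob k \<omega>) i\<bar>))) \<le> norm (\<Sum>i\<in>?J. ?e i \<omega>)"
    proof (rule AE_I2)
      fix \<omega> assume \<omega>: "\<omega> \<in> space M"
      let ?z = "\<lambda>i. \<bar>flat b (Ob k \<omega>) i\<bar>"
      have ne: "?z ` ?J \<noteq> {}" using b_pos by (auto simp: lessThan_empty_iff)
      obtain i where i: "i \<in> ?J" "Max (?z ` ?J) = ?z i"
        using Max_in[OF finite_imageI[OF fin] ne] by (auto simp del: Max_in)
      have "(\<Sum>i\<in>?J. ?z i) \<le> (\<Sum>j\<in>?J. ?z i)"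
        unfolding i(2)[symmetric] by (intro sum_mono Max_ge) auto
      then have s: "(\<Sum>i\<in>?J. ?z i) \<le> d * ?z i" by (simp add: d_def)
      obtain m j where mj: "i = (m, j)" "m < b" using i(1) by (cases i) auto
      have zi: "flat b (Ob k \<omega>) i = fstar (X (int (k * b + m)) \<omega>) $ j + eps (k * b + m) \<omega> $ j"
        using mj by (simp add: flat_def Ob_def obs_def Xb_def Eb_def)
      have "\<bar>fstar (X (int (k * b + m)) \<omega>) $ j\<bar> \<le> R"
        using measurable_space[OF X_meas \<omega>] by (intro bound)
      then have "?z i \<le> R + \<bar>eps (k * b + m) \<omega> $ j\<bar>" unfolding zi by linarith
      then have "2 * (d * ?z i) \<le> 2 * (d * (R + \<bar>eps (k * b + m) \<omega> $ j\<bar>))"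
        by (intro mult_left_mono) (auto simp: d_def)
      with s have "2 * (\<Sum>i\<in>?J. ?z i) \<le> 2 * d * R + \<bar>2 * d * eps (k * b + m) \<omega> $ j\<bar>"
        by (simp add: algebra_simps abs_mult d_def)
      then have "exp (2 * (\<Sum>i\<in>?J. ?z i)) \<le> exp (2 * d * R) * exp \<bar>2 * d * eps (k * b + m) \<omega> $ j\<bar>"
        by (simp only: exp_add[symmetric] exp_le_cancel_iff)
      also have "exp \<bar>2 * d * eps (k * b + m) \<omega> $ j\<bar> \<le> exp (2 * d * eps (k * b + m) \<omega> $ j) + exp (- 2 * d * eps (k * b + m) \<omega> $ j)"
      proof -
        have "exp \<bar>x\<bar> \<le> exp x + exp (- x)" for x :: real
          by (cases "0 \<le> x") (auto simp: add_increasing add_increasing2)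
        from this[of "2 * d * eps (k * b + m) \<omega> $ j"] show ?thesis by simp
      qed
      finally have "exp (2 * (\<Sum>i\<in>?J. ?z i)) \<le> ?e i \<omega>"
        unfolding mj by simp
      also have "?e i \<omega> \<le> (\<Sum>i\<in>?J. ?e i \<omega>)"
        by (rule member_le_sum[OF i(1)]) (auto intro!: add_nonneg_nonneg)
      finally show "norm (exp (2 * (\<Sum>i\<in>?J. ?z i))) \<le> norm (\<Sum>i\<in>?J. ?e i \<omega>)"
        by simp
    qed
  qed
  fix A :: "(nat \<times> 'l \<Rightarrow> real) set" and n assume A: "A \<in> sets (PiM UNIV (\<lambda>_. borel))"
  have A': "flat b -` A \<inter> space LN \<in> sets LN"
    by (rule measurable_sets[OF flat_measurable A])
  have ind: "indicator A (flat b (Ob k \<omega>)) = (indicator (flat b -` A \<inter> space LN) (Ob k \<omega>) :: real)" for k \<omega>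
    by (simp add: indicator_def Ob_def obs_def space_PiM)
  show "expectation (\<lambda>\<omega>. ((\<Sum>k<n. indicator A (flat b (Ob k \<omega>))) - real n * expectation (\<lambda>\<omega>. indicator A (flat b (Ob 0 \<omega>))))\<^sup>2)
      \<le> (1 + 2 * (\<Sum>i. phiX M mu X (int (Suc i)))) * real n * expectation (\<lambda>\<omega>. indicator A (flat b (Ob 0 \<omega>)))"
    unfolding ind by (rule variance_Ob_le[OF A' sum])
qed

context noisy_density
begin

text \<open>Of the factor \<open>2 * ratio_const (card JJ)\<close>, one half comes from
  \<open>ln (Q + Qs)\<close> and the other from \<open>ln Qs\<close>. The negative term is the mean
  of the log-ratio; 16 becomes 8 because the squared Hellinger distance contains a factor 1/2. The
  constant \<open>ln 2\<close> is the same in sample and mean and drops out.\<close>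

lemma log_ratio_deviation:
  fixes f :: "'x \<Rightarrow> real^'l"
  assumes nustar: "prob_density mu b nustar"
    and law: "distributed M XN (\<lambda>\<omega>. \<lambda>j\<in>{..<b}. X (int j) \<omega>) (\<lambda>x. ennreal (nustar x))"
    and conc: "concentrated_process M (\<lambda>k \<omega>. flat b (Ob k \<omega>)) JJ K"
    and f: "f \<in> borel_measurable mu" and \<nu>: "prob_density mu b \<nu>"
    and Rf: "\<And>x j. x \<in> space mu \<Longrightarrow> \<bar>f x $ j\<bar> \<le> R" and Rs: "\<And>x j. x \<in> space mu \<Longrightarrow> \<bar>fstar x $ j\<bar> \<le> R"
    and R: "1 \<le> R"
  shows "(\<Sum>k<n. ln ((p_dens mu b f \<nu> (Ob k \<omega>) + p_dens mu b fstar nustar (Ob k \<omega>)) / (2 * p_dens mu b fstar nustar (Ob k \<omega>))))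
    \<le> 2 * ratio_const (card JJ) * R ^ card JJ * concentrated_process.total_dev M (\<lambda>k \<omega>. flat b (Ob k \<omega>)) JJ n \<omega>
      - real n * (hellinger b (p_dens mu b f \<nu>) (p_dens mu b fstar nustar))\<^sup>2 / 8" (is ?dev)
    and "0 < p_dens mu b f \<nu> y"
proof -
  have R0: "0 \<le> R" using R by simp
  interpret c: concentrated_process M "\<lambda>k \<omega>. flat b (Ob k \<omega>)" JJ K by (rule conc)
  interpret f: bounded_exponents XN "tilt b f \<nu>" "coord f" JJ R
    by (rule bounded_exponents_QQ[OF f \<nu> Rf R0])
  interpret s: bounded_exponents XN "tilt b fstar nustar" "coord fstar" JJ R
    by (rule bounded_exponents_QQ[OF fstar_meas nustar Rs R0])
  interpret sum: moment_family JJ R "\<lambda>A z. QQ f \<nu> A z + QQ fstar nustar A z"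
    by (rule moment_family_add[OF f.moment_family_axioms s.moment_family_axioms]) auto
  obtain js where js: "set js = JJ" "distinct js" using finite_distinct_list[OF finite_JJ] by blast
  have len: "length js = card JJ" using distinct_card[OF js(2)] js(1) by simp
  define h where "h z = ln (QQ f \<nu> {} z + QQ fstar nustar {} z) - ln (QQ fstar nustar {} z)" for z
  define B where "B = 2 * ratio_const (card JJ)"
  have B: "0 \<le> B" using ratio_const_ge_1[of "card JJ"] by (simp add: B_def)
  have h: "mixed_bdd R False js h B"
    using mixed_bdd_diff[OF sum.mixed_bdd_ln[OF js(2)] s.mixed_bdd_ln[OF js(2)]] js(1)
    unfolding h_def len B_def by simp
  note dev = c.uniform_deviation[OF h js(2,1) R B]
  let ?p = "p_dens mu b f \<nu>" and ?q = "p_dens mu b fstar nustar"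
  let ?g = "\<lambda>y. ln ((?p y + ?q y) / (2 * ?q y))"
  have g: "?g y = h (flat b y) - ln 2" for y
    unfolding h_def by (rule ln_ratio_eq[OF f.Q_pos s.Q_pos])
  show p_pos: "0 < ?p y" for y
    unfolding p_dens_eq_QQ using f.Q_pos by (intro mult_pos_pos zero_less_power) auto
  have q_pos: "0 < ?q y" for y
    unfolding p_dens_eq_QQ using s.Q_pos by (intro mult_pos_pos zero_less_power) auto
  have D: "distributed M LN (Ob 0) (\<lambda>y. ennreal (?q y))"
    by (rule distributed_Ob[OF nustar law])
  have gm: "?g \<in> borel_measurable LN"
    unfolding g using measurable_compose[OF flat_measurable mixed_bdd_measurable[OF h]]
    by (intro borel_measurable_diff borel_measurable_const)
  have int_g: "integrable M (\<lambda>\<omega>. ?g (Ob 0 \<omega>))"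
    unfolding g using dev(1) by (intro Bochner_Integration.integrable_diff) auto
  have Eg: "expectation (\<lambda>\<omega>. ?g (Ob 0 \<omega>)) = expectation (\<lambda>\<omega>. h (flat b (Ob 0 \<omega>))) - ln 2"
    unfolding g using dev(1) by (simp add: prob_space)
  have int_q: "integrable LN (\<lambda>y. ?q y * ?g y)"
    using distributed_integrable[OF D gm] int_g q_pos by (auto intro: less_imp_le)
  have "expectation (\<lambda>\<omega>. ?g (Ob 0 \<omega>)) = (LINT y|LN. ?q y * ?g y)"
    by (rule distributed_integral[OF D gm, symmetric]) (use q_pos in \<open>auto intro: less_imp_le\<close>)
  also have "\<dots> \<le> - (LINT y|LN. (sqrt (?p y) - sqrt (?q y))\<^sup>2) / 16"
    using p_dens_integral[OF f \<nu>] p_dens_integral[OF fstar_meas nustar] p_pos q_pos int_q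
    by (intro integral_ln_mean_le) (auto intro: less_imp_le)
  also have "\<dots> = - (hellinger b ?p ?q)\<^sup>2 / 8"
    unfolding hellinger_def by (subst real_sqrt_pow2) (auto intro!: mult_nonneg_nonneg integral_nonneg_AE)
  finally have Eh: "expectation (\<lambda>\<omega>. h (flat b (Ob 0 \<omega>))) - ln 2 \<le> - (hellinger b ?p ?q)\<^sup>2 / 8"
    unfolding Eg .
  have "(\<Sum>k<n. ?g (Ob k \<omega>)) = (\<Sum>k<n. h (flat b (Ob k \<omega>))) - real n * ln 2"
    unfolding g by (simp add: sum_subtractf)
  also have "\<dots> \<le> B * R ^ card JJ * c.total_dev n \<omega> + real n * (expectation (\<lambda>\<omega>. h (flat b (Ob 0 \<omega>))) - ln 2)"
    using dev(2)[where n = n and \<omega> = \<omega>] by (simp add: algebra_simps)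
  also have "\<dots> \<le> B * R ^ card JJ * c.total_dev n \<omega> + real n * (- (hellinger b ?p ?q)\<^sup>2 / 8)"
    using Eh by (intro add_left_mono mult_left_mono) auto
  finally show ?dev by (simp add: B_def)
qed

end

text \<open>The arithmetic-geometric mean inequality
  \<open>4 * (p * q) \<le> (p + q)\<^sup>2\<close>, divided by \<open>4 * q\<^sup>2\<close> and
  taken to logarithms.\<close>

lemma ln_ratio_le_twice_ln_mean:
  fixes p q :: real
  assumes "0 < p" "0 < q"
  shows "ln p - ln q \<le> 2 * ln ((p + q) / (2 * q))"
proof -
  have "4 * (p * q) \<le> (p + q)\<^sup>2"
    using zero_le_power2[of "p - q"] by (simp add: power2_eq_square algebra_simps)
  then have "p / q \<le> ((p + q) / (2 * q))\<^sup>2"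
    using assms by (simp add: power_divide power2_eq_square field_simps)
  then have "ln (p / q) \<le> ln (((p + q) / (2 * q))\<^sup>2)"
    using assms by (subst ln_le_cancel_iff) auto
  then show ?thesis
    using assms by (simp add: ln_div ln_realpow)
qed

theorem mainTheorem1:
  fixes M :: "'w measure" and mu :: "'x measure"
    and X :: "int \<Rightarrow> 'w \<Rightarrow> 'x"
    and eps :: "nat \<Rightarrow> 'w \<Rightarrow> real^'l"
    and fstar :: "'x \<Rightarrow> real^'l"
    and b :: nat
    and F :: "('x \<Rightarrow> real^'l) set"
    and D :: "((nat \<Rightarrow> 'x) \<Rightarrow> real) set"
    and nustar :: "(nat \<Rightarrow> 'x) \<Rightarrow> real"
    and I :: "('x \<Rightarrow> real^'l) \<Rightarrow> real"
    and C ups :: real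
    and lam :: "nat \<Rightarrow> real"
    and rho :: "nat \<Rightarrow> 'w \<Rightarrow> real"
    and fhat :: "nat \<Rightarrow> 'w \<Rightarrow> ('x \<Rightarrow> real^'l)"
    and nuhat :: "nat \<Rightarrow> 'w \<Rightarrow> ((nat \<Rightarrow> 'x) \<Rightarrow> real)"
    and Y :: "nat \<Rightarrow> 'w \<Rightarrow> real^'l"
    and Yb :: "nat \<Rightarrow> 'w \<Rightarrow> (nat \<Rightarrow> real^'l)"
  assumes P: "prob_space M"
    and mu_sf: "sigma_finite_measure mu"
    (* stationary process with values in X *)
    and X_meas: "\<And>k. X k \<in> measurable M mu"
    and stationary: "\<And>h::int. distr M (PiM UNIV (\<lambda>_::int. mu)) (\<lambda>\<omega> k. X (k + h) \<omega>)
                              = distr M (PiM UNIV (\<lambda>_::int. mu)) (\<lambda>\<omega> k. X k \<omega>)"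
    (* i.i.d. standard Gaussian noise, independent of X *)
    and eps_gauss: "\<And>k. distributed M lborel (eps k) (\<lambda>y. ennreal (gauss_dens y))"
    and eps_indep: "prob_space.indep_vars M (\<lambda>_. lborel) eps UNIV"
    and eps_X_indep: "prob_space.indep_set M (gen_sigma M mu X UNIV)
                        (sigma_sets (space M) (\<Union>k. {eps k -` A \<inter> space M | A. A \<in> sets (lborel :: (real^'l) measure)}))"
    (* observations and blocks *)
    and b_pos: "b \<ge> 1"
    and Y_def: "\<And>k \<omega>. Y k \<omega> = fstar (X (int k) \<omega>) + eps k \<omega>"
    and Yb_def: "\<And>k \<omega>. Yb k \<omega> = (\<lambda>j\<in>{..<b}. Y (k * b + j) \<omega>)"
    (* model classes *)
    and F_meas: "\<And>f. f \<in> F \<Longrightarrow> f \<in> borel_measurable mu"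
    and fstar_F: "fstar \<in> F"
    and D_dens: "\<And>\<nu>. \<nu> \<in> D \<Longrightarrow> prob_density mu b \<nu>"
    and nustar_D: "nustar \<in> D"
    and nustar_law: "distributed M (PiM {..<b} (\<lambda>_. mu)) (\<lambda>\<omega>. \<lambda>j\<in>{..<b}. X (int j) \<omega>)
                       (\<lambda>x. ennreal (nustar x))"
    and I_nonneg: "\<And>f. f \<in> F \<Longrightarrow> 0 \<le> I f"
    (* H1 *)
    and H1: "summable (\<lambda>i. sqrt (phiX M mu X (int (Suc i))))"
    (* H2 *)
    and C_pos: "C > 0" and ups_pos: "ups > 0"
    and H2: "\<And>f x j. f \<in> F \<Longrightarrow> x \<in> space mu \<Longrightarrow> \<bar>f x $ j\<bar> \<le> C * I f powr ups"
    and bl_ups: "real b * real CARD('l) * ups < 1"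
    (* H3 *)
    and H3: "\<exists>num nup. 0 < num \<and> num < nup \<and>
               (\<forall>\<nu>\<in>D. \<forall>x\<in>space (PiM {..<b} (\<lambda>_. mu)). num \<le> \<nu> x \<and> \<nu> x \<le> nup)"
    (* penalty and tolerance sequences *)
    and lam_pos: "\<And>n. lam n > 0"
    and lam_n: "(\<lambda>n. lam n / real n) \<longlonglongrightarrow> 0"
    and lam_sqrt: "filterlim (\<lambda>n. lam n / sqrt (real n)) at_top sequentially"
    and rho_nonneg: "\<And>n \<omega>. \<omega> \<in> space M \<Longrightarrow> 0 \<le> rho n \<omega>"
    and rho_meas: "\<And>n. rho n \<in> borel_measurable M"
    and rho_OP: "bigOP M rho (\<lambda>n. lam n / real n)"
    (* (fhat, nuhat) is a rho_n-MPLE *)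
    and fhat_F: "\<And>n \<omega>. \<omega> \<in> space M \<Longrightarrow> fhat n \<omega> \<in> F"
    and nuhat_D: "\<And>n \<omega>. \<omega> \<in> space M \<Longrightarrow> nuhat n \<omega> \<in> D"
    and MPLE: "\<And>n \<omega> f \<nu>. \<omega> \<in> space M \<Longrightarrow> f \<in> F \<Longrightarrow> \<nu> \<in> D \<Longrightarrow>
        (\<Sum>k<n. ln (p_dens mu b f \<nu> (Yb k \<omega>))) - lam n * I f
          \<le> (\<Sum>k<n. ln (p_dens mu b (fhat n \<omega>) (nuhat n \<omega>) (Yb k \<omega>)))
             - lam n * I (fhat n \<omega>) + rho n \<omega>"
    (* the quantities in the conclusion are random variables *)
    and hell_meas: "\<And>n. (\<lambda>\<omega>. (hellinger b (p_dens mu b (fhat n \<omega>) (nuhat n \<omega>))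
                                       (p_dens mu b fstar nustar))\<^sup>2) \<in> borel_measurable M"
    and I_meas: "\<And>n. (\<lambda>\<omega>. I (fhat n \<omega>)) \<in> borel_measurable M"
  shows "bigOP M (\<lambda>n \<omega>. (hellinger b (p_dens mu b (fhat n \<omega>) (nuhat n \<omega>))
                                   (p_dens mu b fstar nustar))\<^sup>2) (\<lambda>n. lam n / real n)
       \<and> bigOP M (\<lambda>n \<omega>. I (fhat n \<omega>)) (\<lambda>n. 1)"
proof -
  interpret noisy_density M mu X eps fstar b
    by (intro noisy_density.intro noisy_process.intro noisy_process_axioms.intro noisy_density_axioms.intro
        P X_meas stationary eps_gauss eps_indep eps_X_indep b_pos F_meas fstar_F mu_sf)
  have Yb: "Yb k \<omega> = Ob k \<omega>" for k \<omega>
    by (auto simp: Yb_def Y_def Ob_def obs_def Xb_def Eb_def fun_eq_iff)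
  have bound_star: "\<bar>fstar x $ j\<bar> \<le> C * I fstar powr ups" if "x \<in> space mu" for x j
    by (rule H2[OF fstar_F that])
  define K where "K = 1 + 2 * (\<Sum>i. phiX M mu X (int (Suc i)))"
  have conc: "concentrated_process M (\<lambda>k \<omega>. flat b (Ob k \<omega>)) JJ K"
    unfolding JJ_def K_def by (rule concentrated_Ob[OF bound_star H1])
  interpret c: concentrated_process M "\<lambda>k \<omega>. flat b (Ob k \<omega>)" JJ K by (rule conc)
  obtain c where c: "\<And>n. expectation (c.total_dev n) \<le> c * sqrt (real n)"
    using c.expectation_total_dev by blast
  define d where "d = card JJ"
  have d: "0 < d" "real d * ups \<le> 1"
    using b_pos bl_ups by (auto simp: d_def card_JJ)
  define c0 where "c0 = 1 + C ^ d + (C * I fstar powr ups) ^ d"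
  \<comment> \<open>The outer 2 stems from passing to the mean of the two densities,
    \<open>2 * ratio_const d\<close> from the two logarithms, and \<open>c0\<close> from bounding
    \<open>R ^ d\<close> by a multiple of \<open>1 + I f\<close>.\<close>
  define c1 where "c1 = 2 * (2 * ratio_const d * c0)"
  have c0: "0 \<le> c0" using C_pos by (simp add: c0_def)
  have rc: "0 \<le> ratio_const d" using ratio_const_ge_1[of d] by simp
  let ?h = "\<lambda>n \<omega>. (hellinger b (p_dens mu b (fhat n \<omega>) (nuhat n \<omega>)) (p_dens mu b fstar nustar))\<^sup>2"
  have basic: "lam n * I (fhat n \<omega>) + real n * ?h n \<omega> / 4 \<le>
      lam n * I fstar + rho n \<omega> + c1 * (1 + I (fhat n \<omega>)) * c.total_dev n \<omega>" if \<omega>: "\<omega> \<in> space M" for n \<omega>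
  proof -
    let ?f = "fhat n \<omega>" and ?\<nu> = "nuhat n \<omega>"
    let ?p = "p_dens mu b ?f ?\<nu>" and ?q = "p_dens mu b fstar nustar"
    let ?Rf = "C * I ?f powr ups" and ?Rs = "C * I fstar powr ups"
    have fF: "?f \<in> F" and \<nu>D: "?\<nu> \<in> D" using fhat_F nuhat_D \<omega> by auto
    \<comment> \<open>This radius depends on \<open>\<omega>\<close> through the estimator. That is
      harmless, since the deviation bound holds for each fixed \<open>\<omega>\<close> and every
      admissible pair, while \<open>total_dev\<close> involves neither the pair nor
      \<open>R\<close>.\<close>
    define R where "R = max 1 (max ?Rf ?Rs)"
    have Rf: "\<bar>?f x $ j\<bar> \<le> R" and Rs: "\<bar>fstar x $ j\<bar> \<le> R" if "x \<in> space mu" for x j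
      using H2[OF fF that, of j] bound_star[OF that, of j] unfolding R_def by linarith+
    have R1: "1 \<le> R" by (simp add: R_def)
    note ratio = log_ratio_deviation[OF D_dens[OF nustar_D] nustar_law conc F_meas[OF fF] D_dens[OF \<nu>D] Rf Rs R1]
    \<comment> \<open>Positivity of the true density is the second conclusion of the deviation
      lemma, taken with the true pair in both places.\<close>
    have q_pos: "0 < ?q y" for y
      by (rule log_ratio_deviation(2)[OF D_dens[OF nustar_D] nustar_law conc F_meas[OF fstar_F] D_dens[OF nustar_D] Rs Rs R1])
    have "R ^ d \<le> c0 * (1 + I ?f)"
      unfolding R_def c0_def using C_pos I_nonneg fF fstar_F ups_pos d by (intro max_power_le) auto
    then have "2 * ratio_const d * R ^ d * c.total_dev n \<omega> \<le> 2 * ratio_const d * (c0 * (1 + I ?f)) * c.total_dev n \<omega>"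
      using rc c.total_dev_nonneg by (intro mult_right_mono mult_left_mono) auto
    with ratio(1)[where n = n and \<omega> = \<omega>]
    have dev: "(\<Sum>k<n. ln ((?p (Ob k \<omega>) + ?q (Ob k \<omega>)) / (2 * ?q (Ob k \<omega>)))) \<le>
       2 * ratio_const d * (c0 * (1 + I ?f)) * c.total_dev n \<omega> - real n * ?h n \<omega> / 8"
      unfolding d_def by linarith
    have arith: "e - r - b \<le> c - a" if "a - b \<le> c - e + r" for a b c e r :: real
      using that by linarith
    \<comment> \<open>The true pair belongs to the model and serves as the competitor in the
      maximality of the estimator.\<close>
    have "lam n * I ?f - rho n \<omega> - lam n * I fstar \<le> (\<Sum>k<n. ln (?p (Ob k \<omega>))) - (\<Sum>k<n. ln (?q (Ob k \<omega>)))"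
      by (rule arith[OF MPLE[OF \<omega> fstar_F nustar_D, of n, unfolded Yb]])
    also have "\<dots> = (\<Sum>k<n. ln (?p (Ob k \<omega>)) - ln (?q (Ob k \<omega>)))"
      by (simp add: sum_subtractf)
    also have "\<dots> \<le> (\<Sum>k<n. 2 * ln ((?p (Ob k \<omega>) + ?q (Ob k \<omega>)) / (2 * ?q (Ob k \<omega>))))"
      by (intro sum_mono ln_ratio_le_twice_ln_mean ratio(2) q_pos)
    also have "\<dots> = 2 * (\<Sum>k<n. ln ((?p (Ob k \<omega>) + ?q (Ob k \<omega>)) / (2 * ?q (Ob k \<omega>))))"
      by (simp add: sum_distrib_left)
    also have "\<dots> \<le> 2 * (2 * ratio_const d * (c0 * (1 + I ?f)) * c.total_dev n \<omega> - real n * ?h n \<omega> / 8)"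
      by (rule mult_left_mono[OF dev]) simp
    finally have "lam n * I ?f - rho n \<omega> - lam n * I fstar \<le>
       2 * (2 * ratio_const d * (c0 * (1 + I ?f)) * c.total_dev n \<omega> - real n * ?h n \<omega> / 8)" .
    moreover have "2 * (2 * ratio_const d * (c0 * (1 + I ?f)) * c.total_dev n \<omega>) = c1 * (1 + I ?f) * c.total_dev n \<omega>"
      by (simp add: c1_def)
    ultimately show ?thesis by (simp add: right_diff_distrib)
  qed
  have c1: "0 \<le> c1" using c0 rc by (simp add: c1_def)
  note * = bigOP_of_basic_inequality[where W = c.total_dev and Iv = "\<lambda>n \<omega>. I (fhat n \<omega>)" and H = ?h,
      OF basic c1 I_nonneg[OF fstar_F] _ _ hell_meas I_meas rho_meas c.integrable_total_dev c.total_dev_nonneg c lam_pos lam_sqrt rho_OP]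
  show ?thesis
    by (intro conjI * zero_le_power2 I_nonneg fhat_F)
qed

end
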